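(* Suppose $\zeta(\beta+i\gamma)=0$ with $\beta>1/2$. Then for every $\eta>1$ there is $q_0(\beta,\gamma,\eta)$ such that the relation $$h(-q)>\frac{\log q}{(\log\log q)^{\eta}}$$ holds for every $q>q_0(\beta,\gamma,\eta)$ for which there is a real primitive Dirichlet character $\chi$ modulo $q$ with $\chi(-1)=-1$.
   Context: $\zeta$ is the Riemann zeta function and $h(-q)$ is the class number of the imaginary quadratic field $\mathbb{Q}(\sqrt{-q})$. The paper's standing assumption is that $q$ is the modulus of a real primitive Dirichlet character $\chi$ with $\chi(-1)=-1$. *)

theory Defs
  imports
    "HOL-Complex_Analysis.Complex_Analysis"
    "HOL-Algebra.Ideal_Product"
    "HOL-Algebra.Coset"
begin

section \<open>The Riemann zeta function\<close>

text \<open>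
  The analytic continuation of the Dirichlet series from the half-plane \<open>Re s > 1\<close> to the
  punctured plane. By the identity theorem it is determined at every \<open>s \<noteq> 1\<close>; at the pole
  \<open>s = 1\<close> the value is arbitrary, so statements about zeros have to exclude that point.
\<close>

definition zeta :: "complex \<Rightarrow> complex" where
  "zeta = (SOME f. f holomorphic_on (- {1}) \<and>
             (\<forall>s. Re s > 1 \<longrightarrow> (\<lambda>n. of_nat (Suc n) powr (- s)) sums f s))"

section \<open>Dirichlet characters\<close>

text \<open>
  Characters modulo \<open>q\<close> are functions on all integers, extended by \<open>0\<close> to the integers not
  coprime to \<open>q\<close>. Multiplicativity and non-vanishing at \<open>1\<close> give \<open>X 1 = 1\<close>.
\<close>

definition dirichlet_character :: "nat \<Rightarrow> (int \<Rightarrow> complex) \<Rightarrow> bool" where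
  "dirichlet_character q X \<longleftrightarrow> q > 0 \<and>
     (\<forall>m n. X (m * n) = X m * X n) \<and>
     (\<forall>n. X (n + int q) = X n) \<and>
     (\<forall>n. X n \<noteq> 0 \<longleftrightarrow> coprime n (int q))"

text \<open>Primitive: not induced by a character to a proper divisor of the modulus.\<close>

definition primitive_character :: "nat \<Rightarrow> (int \<Rightarrow> complex) \<Rightarrow> bool" where
  "primitive_character q X \<longleftrightarrow> dirichlet_character q X \<and>
     \<not> (\<exists>d Y. d dvd q \<and> d < q \<and> dirichlet_character d Y \<and>
            (\<forall>n. coprime n (int q) \<longrightarrow> X n = Y n))"

definition real_character :: "(int \<Rightarrow> complex) \<Rightarrow> bool" where
  "real_character X \<longleftrightarrow> (\<forall>n. X n \<in> \<real>)"

section \<open>Class numbers of number fields\<close>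

text \<open>
  Number fields are represented as subfields of the complex numbers, with the inherited operations.
\<close>

definition complex_ring :: "complex set \<Rightarrow> complex ring" where
  "complex_ring S = \<lparr>carrier = S, mult = (*), one = 1, zero = 0, add = (+)\<rparr>"

definition integers_of :: "complex set \<Rightarrow> complex set" where
  "integers_of K = {x \<in> K. algebraic_int x}"

definition fractional_ideal :: "complex set \<Rightarrow> complex set \<Rightarrow> bool" where
  "fractional_ideal K I \<longleftrightarrow> I \<subseteq> K \<and> I \<noteq> {0} \<and>
     (\<exists>d \<in> integers_of K - {0}. ideal ((*) d ` I) (complex_ring (integers_of K)))"

definition ideal_group :: "complex set \<Rightarrow> complex set monoid" where
  "ideal_group K = \<lparr>carrier = {I. fractional_ideal K I},
                    mult = ideal_prod (complex_ring K),
                    one = integers_of K\<rparr>"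

definition principal_ideals :: "complex set \<Rightarrow> complex set set" where
  "principal_ideals K = {(*) c ` integers_of K | c. c \<in> K - {0}}"

definition class_group :: "complex set \<Rightarrow> complex set set monoid" where
  "class_group K = ideal_group K Mod principal_ideals K"

definition class_number :: "complex set \<Rightarrow> nat" where
  "class_number K = Coset.order (class_group K)"

text \<open>The field generated over the rationals by a square root of \<open>-q\<close>.\<close>

definition imag_quadratic_field :: "nat \<Rightarrow> complex set" where
  "imag_quadratic_field q = {of_rat a + of_rat b * csqrt (- of_nat q) | a b. True}"

end

theory Submission
  imports Defs "HOL-Number_Theory.Number_Theory" "HOL-Real_Asymp.Real_Asymp"
begin

text \<open>
  Let \<open>w = \<beta> + i\<gamma>\<close>. Every ideal class of \<open>\<rat>(\<surd>-q)\<close> contains a reduced lattice \<open>\<int>a + \<int>(x - \<omega>)\<close> with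
  \<open>a\<close> at most of order \<open>\<surd>q\<close>, and the norm form of this lattice represents \<open>k\<close> in as many ways as there are
  ideals of norm \<open>k\<close> in the class, up to units. Summing over all classes gives
  \<open>2\<zeta>(s)L(s,\<chi>)\<close>, where the splitting of primes is governed by \<open>\<chi>\<close> (via Gauss sums). At \<open>s = w\<close> the
  factor \<open>\<zeta>\<close> vanishes, whereas each form contributes \<open>2a\<^bsup>-w\<^esup>\<zeta>(2w)\<close> from its axis plus a lattice point
  error, which is small since \<open>\<beta> > 1/2\<close>. Hence the sum of \<open>a\<^bsup>-w\<^esup>\<close> over the reduced lattices is \<open>O(h q\<^bsup>-\<delta>\<^esup>)\<close>.

  On the other hand, if a prime \<open>p\<close> not dividing \<open>q\<close> splits, then the powers of a prime ideal above \<open>p\<close>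
  yield many reduced lattices, so \<open>p\<close> is at least about \<open>(q/4)\<^bsup>1/(2h)\<^esup>\<close>. If \<open>h \<le> log q / (log log q)\<^bsup>\<eta>\<^esup>\<close>, then
  this exceeds every power of \<open>log q\<close>, and up to a negligible error only squarefree norms composed of primes
  dividing \<open>q\<close> matter. Their contribution is close to the product of \<open>1 + p\<^bsup>-w\<^esup>\<close> over the primes \<open>p\<close>
  dividing \<open>q\<close>; its absolute value is at least \<open>4\<^bsup>-t\<^esup>\<close> with \<open>t\<close> factors, and \<open>2\<^bsup>t\<^esup> \<le> 4h\<close> because distinct
  products of ramified primes lie in distinct classes. For large \<open>q\<close> this contradicts the upper bound.
\<close>

section \<open>Rational numbers with bounded denominators\<close>

text \<open>The hypothesis speaks of a character, the conclusion of a field. The bridge is the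
  polynomial x^2 - q x + (q^2 + q)/4, the norm of x - \<omega> with \<omega> = (q + sqrt(-q))/2; the
  trace q serves odd and even q alike. Its roots modulo k are matched with primitive representations
  by forms on one side and, prime by prime, with values of the character on the other. That -q is a
  fundamental discriminant has to be extracted from the primitivity of the character; congruences
  modulo 4 and modulo primes are therefore computed in the ring generated by the q-th roots of
  unity. The number of lattice points in an ellipse has the same main term for every class, so the
  main terms add up to a multiple of \<zeta>(s), which vanishes at w as well. The two bounds for the
  class sum compare 1/(16 h^2) with h times an error, so that a factor (log q)^3 has to be beaten.
  The error from split primes is (q/4)^(-1/(4 h)), at most exp(-(log log q)^\<eta>/8), and it does
  so because \<eta> > 1.\<close>

lemma prime_common_divisor:
  fixes a b :: int
  assumes "\<not> coprime a b" "b \<noteq> 0"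
  obtains p where "prime p" "p dvd a" "p dvd b"
proof -
  have "gcd a b \<noteq> 0" "\<not> is_unit (gcd a b)"
    using assms by (auto simp: is_unit_gcd)
  then obtain p where "prime p" "p dvd gcd a b"
    using prime_divisor_exists by blast
  then show ?thesis using that by auto
qed

text \<open>Every power of the denominator divides \<open>D\<close>, which only the denominator 1
  allows. This plays the role of integral closedness, both for rational elements of a cyclotomic
  ring and for norms of algebraic integers.\<close>

lemma rat_bounded_denominators:
  fixes r :: rat
  assumes D: "D > 0" and pow: "\<And>n. of_int D * r ^ n \<in> \<int>"
  shows "r \<in> \<int>"
proof -
  obtain a b where ab: "quotient_of r = (a, b)" by (cases "quotient_of r")
  have b0: "b > 0" and cop: "coprime a b" and r: "r = of_int a / of_int b"
    using quotient_of_denom_pos[OF ab] quotient_of_coprime[OF ab] quotient_of_div[OF ab] by auto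
  have dv: "b ^ n dvd D" for n
  proof -
    obtain z where z: "of_int D * r ^ n = of_int z" using pow[of n] by (auto elim: Ints_cases)
    have "(of_int (D * a ^ n) :: rat) = of_int (z * b ^ n)"
      using z b0 by (simp add: r field_simps)
    then have "D * a ^ n = z * b ^ n" by (simp only: of_int_eq_iff)
    then have "b ^ n dvd D * a ^ n" by simp
    moreover have "coprime (b ^ n) (a ^ n)" using cop by (simp add: coprime_commute)
    ultimately show ?thesis using coprime_dvd_mult_left_iff by blast
  qed
  have "b = 1"
  proof (rule ccontr)
    assume "b \<noteq> 1"
    then have b2: "b \<ge> 2" using b0 by simp
    have "D < 2 ^ nat D" using of_nat_less_two_power[of "nat D", where 'a = int] D by simp
    also have "\<dots> \<le> b ^ nat D" using b2 by (intro power_mono) auto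
    also have "\<dots> \<le> D" using dv[of "nat D"] D zdvd_imp_le by blast
    finally show False by simp
  qed
  then show ?thesis using r by simp
qed

text \<open>Obtained by extending 1 to a basis of the complex numbers over the rationals. It reads
  off rational elements of a ring with finitely many additive generators, where a common denominator
  on the generators bounds all denominators.\<close>

lemma rat_linear_functional:
  "\<exists>\<phi> :: complex \<Rightarrow> rat. (\<forall>x y. \<phi> (x + y) = \<phi> x + \<phi> y) \<and> (\<forall>r x. \<phi> (of_rat r * x) = r * \<phi> x) \<and> \<phi> 1 = 1"
proof -
  interpret V: vector_space "\<lambda>(r::rat) (x::complex). of_rat r * x"
    by standard (auto simp: algebra_simps of_rat_add of_rat_mult)
  interpret W: vector_space "\<lambda>(r::rat) (x::rat). r * x"
    by standard (auto simp: algebra_simps)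
  interpret VW: vector_space_pair "\<lambda>(r::rat) (x::complex). of_rat r * x" "\<lambda>(r::rat) (x::rat). r * x" ..
  have "V.independent {1}" using V.dependent_single[of "1::complex"] by simp
  then obtain g where g: "Vector_Spaces.linear (\<lambda>(r::rat) (x::complex). of_rat r * x) (*) g" "g 1 = (1::rat)"
    using VW.linear_independent_extend[of "{1}" "\<lambda>_. 1"] by auto
  then show ?thesis
    using VW.linear_add[OF g(1)] VW.linear_scale[OF g(1)] by metis
qed

section \<open>Gauss sums of real primitive characters\<close>

text \<open>
  Primitivity is expressed through the kernel: for a proper divisor \<open>d\<close> the character is
  not trivial on the residues that are \<open>1\<close> modulo \<open>d\<close>.
\<close>

locale real_primitive =
  fixes q :: int and \<psi> :: "int \<Rightarrow> int"
  assumes q_pos: "q > 0"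
    and mult: "\<And>m n. \<psi> (m * n) = \<psi> m * \<psi> n"
    and per: "\<And>n. \<psi> (n + q) = \<psi> n"
    and val: "\<And>n. coprime n q \<Longrightarrow> \<psi> n = 1 \<or> \<psi> n = - 1"
    and zero: "\<And>n. \<not> coprime n q \<Longrightarrow> \<psi> n = 0"
    and prim: "\<And>d. d dvd q \<Longrightarrow> 0 < d \<Longrightarrow> d < q \<Longrightarrow> \<exists>u. [u = 1] (mod d) \<and> coprime u q \<and> \<psi> u = - 1"
begin

lemma chi_cases: "\<psi> n = 0 \<or> \<psi> n = 1 \<or> \<psi> n = - 1"
  using val zero by blast

lemma chi_1: "\<psi> 1 = 1"
  using val[of 1] mult[of 1 1] by auto

lemma chi_sq: "\<psi> n * \<psi> n = (if coprime n q then 1 else 0)"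
  using val[of n] zero[of n] by auto

lemma chi_power: "\<psi> (n ^ k) = \<psi> n ^ k"
  by (induction k) (auto simp: chi_1 mult)

lemma chi_add_mult: "\<psi> (n + q * k) = \<psi> n"
proof -
  have A: "\<psi> (n + q * int k) = \<psi> n" for n k
  proof (induction k)
    case (Suc k)
    have "\<psi> (n + q * int (Suc k)) = \<psi> ((n + q * int k) + q)" by (simp add: algebra_simps)
    also have "\<dots> = \<psi> n" unfolding per by (rule Suc)
    finally show ?case .
  qed auto
  show ?thesis
  proof (cases "k \<ge> 0")
    case True then show ?thesis using A[of n "nat k"] by simp
  next
    case False
    then show ?thesis using A[of "n + q * k" "nat (- k)"] by simp
  qed
qed

lemma chi_cong: "[a = b] (mod q) \<Longrightarrow> \<psi> a = \<psi> b"
  using chi_add_mult by (metis cong_iff_lin mult.commute)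

lemma chi_mod: "\<psi> (a mod q) = \<psi> a"
  by (rule chi_cong) simp

definition e :: "int \<Rightarrow> complex" where
  "e k = exp (2 * of_real pi * \<i> * of_int k / of_int q)"

lemma e_add: "e (a + b) = e a * e b"
  by (simp add: e_def add_divide_distrib algebra_simps exp_add [symmetric])

lemma e_0 [simp]: "e 0 = 1" by (simp add: e_def)

lemma e_uminus: "e (- a) = cnj (e a)"
  by (simp add: e_def exp_cnj)

lemma e_eq_1_iff: "e a = 1 \<longleftrightarrow> q dvd a"
proof
  assume "e a = 1"
  then obtain n :: int where n: "2 * pi * (of_int a / of_int q) = of_int (2 * n) * pi"
    by (auto simp: e_def exp_eq_1)
  then have "(of_int a :: real) = of_int (n * q)" using q_pos by (simp add: field_simps)
  then show "q dvd a" by (simp only: of_int_eq_iff) simp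
next
  assume "q dvd a"
  then obtain n where "a = q * n" by blast
  then have "e a = exp (2 * of_real pi * \<i> * of_int n)" using q_pos by (simp add: e_def mult.assoc)
  then show "e a = 1" using exp_eq_1 by (auto intro!: exI[of _ n])
qed

lemma e_cong: "[a = b] (mod q) \<Longrightarrow> e a = e b"
proof -
  assume "[a = b] (mod q)"
  then have "e (a - b) = 1" using e_eq_1_iff by (simp add: cong_iff_dvd_diff)
  then show ?thesis using e_add[of "a - b" b] by simp
qed

lemma e_mult_power: "e (a * int n) = e a ^ n"
  by (induction n) (auto simp: e_add algebra_simps)

abbreviation P :: "int set" where "P \<equiv> {0..<q}"

lemma bij_affine:
  assumes "coprime u q" shows "bij_betw (\<lambda>a. (u * a + v) mod q) P P"
proof -
  have "inj_on (\<lambda>a. (u * a + v) mod q) P"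
  proof (rule inj_onI)
    fix a b assume ab: "a \<in> P" "b \<in> P" "(u * a + v) mod q = (u * b + v) mod q"
    then have "[u * a = u * b] (mod q)" unfolding cong_def[symmetric] by (simp add: cong_add_rcancel)
    then have "[a = b] (mod q)" using assms by (simp add: cong_mult_lcancel)
    then show "a = b" using ab by (simp add: cong_def)
  qed
  moreover have "(\<lambda>a. (u * a + v) mod q) ` P \<subseteq> P" using q_pos by auto
  ultimately show ?thesis
    by (simp add: bij_betw_def endo_inj_surj)
qed

lemma sum_reindex:
  fixes g :: "int \<Rightarrow> 'a :: comm_monoid_add"
  assumes "\<And>a. g (a mod q) = g a" "coprime u q"
  shows "(\<Sum>a\<in>P. g (u * a + v)) = (\<Sum>a\<in>P. g a)"
  using sum.reindex_bij_betw[OF bij_affine[OF assms(2), of v], of g] assms(1) by simp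

lemma e_mod: "e (a mod q) = e a" by (rule e_cong) simp

lemma e_mod_mult: "e (a mod q * k) = e (a * k)"
  by (rule e_cong) (simp add: cong_def mod_simps)

text \<open>Replacing a by a + 1 multiplies the sum by \<open>e k\<close>, which differs from 1
  unless q divides k.\<close>

lemma sum_e: "(\<Sum>a\<in>P. e (a * k)) = (if q dvd k then of_int q else 0)"
proof (cases "q dvd k")
  case True
  then have "e (a * k) = 1" for a using e_eq_1_iff by simp
  then show ?thesis using True q_pos by simp
next
  case False
  have "(\<Sum>a\<in>P. e (a * k)) = (\<Sum>a\<in>P. e ((1 * a + 1) * k))"
    by (rule sum_reindex[symmetric]) (auto simp: e_mod_mult)
  also have "\<dots> = e k * (\<Sum>a\<in>P. e (a * k))"
    by (simp add: sum_distrib_left e_add algebra_simps)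
  finally show ?thesis using False e_eq_1_iff by auto
qed

definition G :: "int \<Rightarrow> complex" where "G k = (\<Sum>a\<in>P. of_int (\<psi> a) * e (a * k))"

lemma G_reindex:
  assumes "coprime u q"
  shows "G k = of_int (\<psi> u) * G (u * k)"
proof -
  have "G k = (\<Sum>a\<in>P. of_int (\<psi> (u * a + 0)) * e ((u * a + 0) * k))"
    unfolding G_def by (rule sum_reindex[symmetric]) (auto simp: e_mod_mult chi_mod assms)
  then show ?thesis by (simp add: G_def sum_distrib_left mult algebra_simps)
qed

text \<open>For \<open>k\<close> not coprime to \<open>q\<close>, primitivity provides a substitution that changes the sign of the sum.\<close>

lemma G_eq: "G k = of_int (\<psi> k) * G 1"
proof (cases "coprime k q")
  case True
  have "G 1 = of_int (\<psi> k) * G k" using G_reindex[OF True, of 1] by simp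
  moreover have "of_int (\<psi> k) * of_int (\<psi> k) = (1 :: complex)"
    using chi_sq[of k] True by (simp flip: of_int_mult)
  ultimately show ?thesis by (simp flip: mult.assoc)
next
  case False
  define g where "g = gcd k q"
  have g: "g > 0" "g \<noteq> 1" using False q_pos by (auto simp: g_def coprime_iff_gcd_eq_1)
  obtain d k' where d: "q = g * d" and k': "k = g * k'"
    by (metis g_def dvd_def gcd_dvd1 gcd_dvd2)
  have "d > 0" using d g q_pos by (simp add: zero_less_mult_iff)
  moreover have "d < q" using d g \<open>d > 0\<close> by simp
  ultimately obtain u where u: "[u = 1] (mod d)" "coprime u q" "\<psi> u = - 1"
    using prim[of d] d by auto
  obtain j where j: "u - 1 = d * j" using u(1) unfolding cong_iff_dvd_diff by blast
  \<comment> \<open>k is divisible by g and u - 1 by q/g, so u k and k agree modulo q, while the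
    substitution costs the sign \<open>\<psi> u = - 1\<close>.\<close>
  have "u * k - k = (u - 1) * k" by (simp add: algebra_simps)
  also have "\<dots> = q * (j * k')" unfolding j d k' by simp
  finally have "[u * k = k] (mod q)" unfolding cong_iff_dvd_diff by simp
  then have "G (u * k) = G k" unfolding G_def
    by (intro sum.cong refl arg_cong2[where f = "(*)"] e_cong) (simp add: cong_mult)
  then have "G k = - G k" using G_reindex[OF u(2), of k] u(3) by simp
  then have "G k = 0" by (simp add: equation_minus_iff)
  then show ?thesis using zero[OF False] by simp
qed

lemma cnj_G: "cnj (G 1) = of_int (\<psi> (- 1)) * G 1"
proof -
  have "cnj (G 1) = G (- 1)" by (simp add: G_def e_uminus)
  then show ?thesis using G_eq[of "- 1"] by simp
qed

text \<open>Primitivity enters through \<open>G_eq\<close>, which absorbs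
  \<open>of_int (\<psi> a) * G 1\<close> into \<open>G a\<close> for every residue a, coprime to q
  or not. Orthogonality then leaves a single term.\<close>

lemma G_cnj: "G 1 * cnj (G 1) = of_int q"
proof -
  have "G 1 * cnj (G 1) = (\<Sum>a\<in>P. (of_int (\<psi> a) * G 1) * e (- a))"
    by (simp add: G_def[of 1] e_uminus sum_distrib_left algebra_simps)
  also have "\<dots> = (\<Sum>a\<in>P. \<Sum>b\<in>P. of_int (\<psi> b) * e (a * (b - 1)))"
    unfolding G_eq[symmetric] unfolding G_def sum_distrib_right
    by (intro sum.cong refl) (simp add: e_add[symmetric] algebra_simps mult.assoc)
  also have "\<dots> = (\<Sum>b\<in>P. \<Sum>a\<in>P. of_int (\<psi> b) * e (a * (b - 1)))" by (rule sum.swap)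
  also have "\<dots> = (\<Sum>b\<in>P. if q dvd b - 1 then of_int q else 0)"
    unfolding sum_distrib_left[symmetric] sum_e
  proof (intro sum.cong refl)
    fix b assume "b \<in> P"
    show "of_int (\<psi> b) * (if q dvd b - 1 then of_int q else 0) = (if q dvd b - 1 then of_int q else (0::complex))"
      using chi_cong[of b 1] chi_1 by (auto simp: cong_iff_dvd_diff)
  qed
  \<comment> \<open>The surviving residue is written \<open>1 mod q\<close>, since for q = 1 it is
    0.\<close>
  also have "\<dots> = (\<Sum>b\<in>P. if b = 1 mod q then of_int q else 0)"
    by (intro sum.cong refl) (auto simp: cong_iff_dvd_diff[symmetric] cong_def)
  also have "\<dots> = of_int q" using q_pos by simp
  finally show ?thesis .
qed

lemma chi_minus_1: "\<psi> (- 1) = 1 \<or> \<psi> (- 1) = - 1" using val[of "- 1"] by simp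

lemma G_square: "G 1 ^ 2 = of_int (\<psi> (- 1) * q)"
proof -
  have "of_int (\<psi> (- 1)) * of_int (\<psi> (- 1)) = (1 :: complex)" using chi_minus_1 by auto
  then have "G 1 ^ 2 = of_int (\<psi> (- 1)) * (G 1 * cnj (G 1))"
    by (simp add: cnj_G power2_eq_square flip: mult.assoc) 
  then show ?thesis unfolding G_cnj by simp
qed

text \<open>The ring Z[e 1]. It is generated additively, so that statements about linear functionals
  follow by induction over the generators \<open>e k\<close>; closure under products is a
  consequence.\<close>

inductive_set A :: "complex set" where
  A_e: "e k \<in> A" | A_add: "x \<in> A \<Longrightarrow> y \<in> A \<Longrightarrow> x + y \<in> A" | A_neg: "x \<in> A \<Longrightarrow> - x \<in> A"

lemma A_mult: assumes "x \<in> A" "y \<in> A" shows "x * y \<in> A"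
  using assms(1)
proof induction
  case (A_e k)
  show ?case using assms(2)
  proof induction
    case (A_e l) then show ?case using A.A_e[of "k + l"] by (simp add: e_add)
  qed (auto simp: algebra_simps intro: A.intros)
qed (auto simp: algebra_simps intro: A.intros)

lemma A_1: "1 \<in> A" using A_e[of 0] by simp

lemma A_0: "0 \<in> A" using A_add[OF A_1 A_neg[OF A_1]] by simp

lemma A_diff: "x \<in> A \<Longrightarrow> y \<in> A \<Longrightarrow> x - y \<in> A"
  using A_add[OF _ A_neg] by simp

lemma A_nat: "of_nat n \<in> A"
  by (induction n) (auto intro: A_0 A_1 A_add)

lemma A_int: "of_int n \<in> A"
  by (cases n) (auto intro: A_nat A_neg simp del: of_nat_Suc)

lemma A_power: "x \<in> A \<Longrightarrow> x ^ n \<in> A"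
  by (induction n) (auto intro: A_1 A_mult)

lemma A_sum: "(\<And>i. i \<in> I \<Longrightarrow> f i \<in> A) \<Longrightarrow> sum f I \<in> A"
  by (induction I rule: infinite_finite_induct) (auto intro: A_0 A_add)

lemma A_G: "G k \<in> A"
  unfolding G_def by (intro A_sum A_mult A_int A_e)

text \<open>All powers of \<open>r\<close> lie in \<open>A\<close>. A rational functional that fixes
  1 has bounded denominators on \<open>A\<close>, because \<open>e k\<close> depends only on k
  modulo q and leaves finitely many values on the generators.\<close>

lemma A_rat:
  assumes "of_rat r \<in> A" shows "r \<in> \<int>"
proof -
  obtain \<phi> :: "complex \<Rightarrow> rat" where \<phi>: "\<And>x y. \<phi> (x + y) = \<phi> x + \<phi> y"
    "\<And>r x. \<phi> (of_rat r * x) = r * \<phi> x" "\<phi> 1 = 1"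
    using rat_linear_functional by blast
  have neg: "\<phi> (- x) = - \<phi> x" for x using \<phi>(2)[of "- 1" x] by simp
  define D where "D = (\<Prod>k\<in>P. snd (quotient_of (\<phi> (e k))))"
  have D: "D > 0" unfolding D_def by (intro prod_pos) (simp add: quotient_of_denom_pos')
  have int: "of_int D * \<phi> x \<in> \<int>" if "x \<in> A" for x using that
  proof induction
    case (A_e k)
    have kP: "k mod q \<in> P" using q_pos by simp
    define s where "s = \<phi> (e (k mod q))"
    have "snd (quotient_of s) dvd D" unfolding D_def s_def by (rule dvd_prodI) (use kP in auto)
    then obtain z where z: "D = snd (quotient_of s) * z" by blast
    have s: "s = of_int (fst (quotient_of s)) / of_int (snd (quotient_of s))"
      by (metis prod.collapse quotient_of_div)
    have "of_int (snd (quotient_of s)) \<noteq> (0::rat)"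
      using quotient_of_denom_pos'[of s] by simp
    then have "of_int (snd (quotient_of s)) * s = of_int (fst (quotient_of s))"
      using s by (metis nonzero_mult_div_cancel_left times_divide_eq_right)
    then have "of_int D * s = of_int (z * fst (quotient_of s))" by (simp add: z algebra_simps)
    then show ?case by (simp add: s_def e_mod del: of_int_mult)
  next
    case (A_add x y) then show ?case by (simp add: \<phi>(1) distrib_left)
  next
    case (A_neg x) then show ?case by (simp add: neg)
  qed
  show ?thesis
  proof (rule rat_bounded_denominators[OF D])
    fix n
    have "of_rat (r ^ n) \<in> A" using A_power[OF assms, of n] by (simp add: of_rat_power)
    from int[OF this] \<phi>(2)[of "r ^ n" 1] \<phi>(3) show "of_int D * r ^ n \<in> \<int>" by simp
  qed
qed

text \<open>Congruences between integers that are found in \<open>A\<close> descend to the integers,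
  since the quotient is a rational element of \<open>A\<close>.\<close>

lemma A_int_dvd:
  assumes "z \<in> A" "of_int n = of_int p * z" "p \<noteq> 0" shows "p dvd n"
proof -
  have "z = of_rat (of_int n / of_int p)" using assms(2,3) by (simp add: of_rat_divide field_simps)
  then have "(of_int n / of_int p :: rat) \<in> \<int>" using A_rat assms(1) by blast
  then obtain k where "(of_int n / of_int p :: rat) = of_int k" by (elim Ints_cases)
  then have "(of_int n :: rat) = of_int (p * k)" using assms(3) by (simp add: field_simps)
  then show ?thesis by (simp only: of_int_eq_iff) simp
qed

text \<open>The inner binomial coefficients are divisible by p, and the remaining quotient stays in
  \<open>A\<close>.\<close>

lemma A_frobenius2:
  assumes p: "prime (p::nat)" and x: "x \<in> A" "y \<in> A"
  shows "\<exists>z\<in>A. (x + y) ^ p = x ^ p + y ^ p + of_nat p * z"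
proof -
  have p0: "p > 0" using p prime_gt_0_nat by blast
  define z where "z = (\<Sum>k\<in>{1..<p}. of_nat ((p choose k) div p) * x ^ k * y ^ (p - k))"
  have "(x + y) ^ p = (\<Sum>k\<le>p. of_nat (p choose k) * x ^ k * y ^ (p - k))" by (rule binomial_ring)
  also have "{..p} = insert 0 (insert p {1..<p})" using p0 by auto
  also have "(\<Sum>k\<in>insert 0 (insert p {1..<p}). of_nat (p choose k) * x ^ k * y ^ (p - k)) =
      y ^ p + (x ^ p + (\<Sum>k\<in>{1..<p}. of_nat (p choose k) * x ^ k * y ^ (p - k)))"
    using p0 by simp
  also have "(\<Sum>k\<in>{1..<p}. of_nat (p choose k) * x ^ k * y ^ (p - k)) = of_nat p * z"
    unfolding z_def sum_distrib_left
  proof (intro sum.cong refl)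
    fix k assume k: "k \<in> {1..<p}"
    have "p dvd p choose k" using k p by (intro dvd_choose_prime) auto
    then have "of_nat (p choose k) = (of_nat p * of_nat ((p choose k) div p) :: complex)"
      by (simp flip: of_nat_mult)
    then show "of_nat (p choose k) * x ^ k * y ^ (p - k) =
        of_nat p * (of_nat ((p choose k) div p) * x ^ k * y ^ (p - k))" by simp
  qed
  finally have "(x + y) ^ p = x ^ p + y ^ p + of_nat p * z" by simp
  moreover have "z \<in> A" unfolding z_def by (intro A_sum A_mult A_nat A_power x)
  ultimately show ?thesis by blast
qed

lemma A_frobenius:
  assumes p: "prime (p::nat)" and "finite I" "\<And>i. i \<in> I \<Longrightarrow> f i \<in> A"
  shows "\<exists>z\<in>A. (sum f I) ^ p = (\<Sum>i\<in>I. f i ^ p) + of_nat p * z"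
  using assms(2,3)
proof (induction I)
  case empty
  have "p > 0" using p prime_gt_0_nat by blast
  then show ?case using A_0 by (auto intro!: bexI[of _ 0])
next
  case (insert i I)
  obtain z where z: "z \<in> A" "(sum f I) ^ p = (\<Sum>i\<in>I. f i ^ p) + of_nat p * z"
    using insert by auto
  obtain w where w: "w \<in> A" "(f i + sum f I) ^ p = f i ^ p + (sum f I) ^ p + of_nat p * w"
    using A_frobenius2[OF p, of "f i" "sum f I"] insert by (auto intro: A_sum)
  have "sum f (insert i I) ^ p = (\<Sum>i\<in>insert i I. f i ^ p) + of_nat p * (z + w)"
    using insert w z by (simp add: algebra_simps)
  then show ?case using A_add[OF z(1) w(1)] by blast
qed

text \<open>The Gauss sum proof of quadratic reciprocity. Modulo p, the p-th power of
  \<open>G 1\<close> is \<open>G p\<close>, that is \<psi>(p) times \<open>G 1\<close>, by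
  Frobenius; it is also D^h times \<open>G 1\<close>, since the square of \<open>G 1\<close> is D.
  Euler's criterion identifies D^h.\<close>

lemma chi_odd_prime:
  assumes p: "prime p" "p > 2" "\<not> int p dvd q"
  shows "Legendre (\<psi> (- 1) * q) (int p) = \<psi> (int p)"
proof -
  define D where "D = \<psi> (- 1) * q"
  define h where "h = (p - 1) div 2"
  have "odd p" using p by (simp add: prime_odd_nat)
  then have p2: "p = Suc (2 * h)" by (simp add: h_def)
  have cop: "coprime (int p) q" using p by (simp add: prime_imp_coprime)
  have nD: "\<not> int p dvd D" using p chi_minus_1 by (auto simp: D_def)
  obtain z where z: "z \<in> A" "G 1 ^ p = (\<Sum>a\<in>P. (of_int (\<psi> a) * e (a * 1)) ^ p) + of_nat p * z"
    using A_frobenius[OF p(1), of P "\<lambda>a. of_int (\<psi> a) * e (a * 1)"]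
    unfolding G_def by (auto intro: A_mult A_int A_e)
  have "(\<Sum>a\<in>P. (of_int (\<psi> a) * e (a * 1)) ^ p) = G (int p)"
    unfolding G_def
  proof (intro sum.cong refl)
    fix a
    have "\<psi> a ^ p = \<psi> a" using chi_cases[of a] \<open>odd p\<close> p(2) by auto
    then show "(of_int (\<psi> a) * e (a * 1)) ^ p = of_int (\<psi> a) * e (a * int p)"
      by (simp add: power_mult_distrib e_mult_power flip: of_int_power)
  qed
  then have eq: "G 1 ^ p = of_int (\<psi> (int p)) * G 1 + of_nat p * z" using z(2) G_eq[of "int p"] by simp
  have "G 1 ^ p = G 1 * of_int (D ^ h)"
    unfolding p2 power_Suc power_mult G_square by (simp add: D_def)
  \<comment> \<open>Multiplying by \<open>G 1\<close> replaces it by its square D, an integer prime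
    to p, so the congruence descends to the integers and D can be cancelled.\<close>
  then have "G 1 * (G 1 * of_int (D ^ h)) = G 1 * (of_int (\<psi> (int p)) * G 1 + of_nat p * z)"
    using eq by simp
  then have "G 1 ^ 2 * of_int (D ^ h) = of_int (\<psi> (int p)) * G 1 ^ 2 + of_nat p * (z * G 1)"
    by (simp add: algebra_simps power2_eq_square)
  then have "of_int (D * (D ^ h - \<psi> (int p))) = of_int (int p) * (z * G 1)"
    unfolding G_square D_def[symmetric] by (simp add: algebra_simps)
  then have "int p dvd D * (D ^ h - \<psi> (int p))"
    by (rule A_int_dvd[rotated]) (use z A_G A_mult p in auto)
  then have "int p dvd D ^ h - \<psi> (int p)" using nD p by (simp add: prime_dvd_mult_iff)
  then have "[D ^ h = \<psi> (int p)] (mod int p)" by (simp add: cong_iff_dvd_diff)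
  moreover have "[Legendre D (int p) = D ^ h] (mod int p)"
    unfolding h_def using euler_criterion p by blast
  ultimately have c: "[Legendre D (int p) = \<psi> (int p)] (mod int p)" using cong_trans by blast
  have "Legendre D (int p) = 1 \<or> Legendre D (int p) = - 1"
    using nD by (auto simp: Legendre_def cong_0_iff)
  \<comment> \<open>Both symbols are 1 or -1 and congruent modulo p; distinct values would differ by
    2.\<close>
  moreover have "\<not> int p dvd 2" "\<not> int p dvd - 2"
    using p by (auto dest: zdvd_imp_le)
  ultimately show ?thesis using c val[OF cop] unfolding D_def[symmetric] cong_iff_dvd_diff
    by (elim disjE) simp_all
qed

end

text \<open>Grouping the n-th roots of unity by the gcd of the exponent with n yields the
  corresponding sums for all divisors of n, while the total is 1 or 0; induction on n does the rest.
  It makes the constant \<open>c\<close> of \<open>G_W\<close> an integer.\<close>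

lemma ramanujan_sum_Ints:
  "n > 0 \<Longrightarrow> (\<Sum>k\<in>totatives n. exp (2 * of_real pi * \<i> * of_nat k / of_nat n)) \<in> (\<int> :: complex set)"
proof (induction n rule: less_induct)
  case (less n)
  define E where "E = (\<lambda>n k. exp (2 * of_real pi * \<i> * of_nat k / of_nat n) :: complex)"
  have all: "(\<Sum>k\<in>{0<..n}. E n k) \<in> \<int>"
  proof (cases "n = 1")
    case True
    have "exp (2 * (complex_of_real pi * \<i>)) = 1" using exp_two_pi_i by (simp add: mult.assoc)
    then have "E n 1 = 1" using True by (simp add: E_def mult.assoc)
    moreover have "{0<..n} = {1}" using True by auto
    ultimately show ?thesis by simp
  next
    case False
    define z where "z = E n 1"
    have pw: "E n k = z ^ k" for k
      by (simp add: E_def z_def exp_of_nat_mult [symmetric] algebra_simps)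
    have zn: "z ^ n = 1"
      using less.prems by (simp add: pw[symmetric] E_def)
    have "z \<noteq> 1"
    proof
      assume "z = 1"
      then obtain j :: int where "2 * pi / real n = of_int (2 * j) * pi" by (auto simp: z_def E_def exp_eq_1)
      then have "pi * (2 / real n) = pi * (2 * of_int j)" by (simp add: mult_ac)
      then have "1 / real n = of_int j" unfolding mult_cancel_left using pi_gt_zero by simp
      then have "real_of_int 1 = real_of_int (j * int n)" using less.prems by (simp add: field_simps)
      then have "1 = j * int n" by (simp only: of_int_eq_iff)
      then have "int n dvd 1" by (metis dvd_triv_right)
      then show False using False by simp
    qed
    then have "(\<Sum>k<n. z ^ k) = 0" using zn by (simp add: geometric_sum)
    moreover have "(\<Sum>k\<in>{0<..n}. z ^ k) = (\<Sum>k<n. z ^ Suc k)"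
      by (rule sum.reindex_bij_witness[of _ Suc "\<lambda>k. k - 1"]) auto
    ultimately have "(\<Sum>k\<in>{0<..n}. E n k) = 0" by (simp add: pw sum_distrib_left[symmetric])
    then show ?thesis by simp
  qed
  have "(\<Sum>k\<in>{0<..n}. E n k) = (\<Sum>d\<in>{d. d dvd n}. \<Sum>k\<in>{k\<in>{0<..n}. gcd k n = d}. E n k)"
    using less.prems by (intro sum.group[symmetric]) auto
  also have "\<dots> = (\<Sum>d\<in>{d. d dvd n}. \<Sum>k\<in>totatives (n div d). E (n div d) k)"
  proof (rule sum.cong[OF refl])
    fix d assume d: "d \<in> {d. d dvd n}"
    then obtain m where m: "n = d * m" by blast
    have d0: "d > 0" using less.prems m by (auto intro: Nat.gr0I)
    have "(\<Sum>k\<in>{k\<in>{0<..n}. gcd k n = d}. E n k) = (\<Sum>k\<in>totatives (n div d). E n (k * d))"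
      using less.prems d sum.reindex_bij_betw[OF bij_betw_totatives_gcd_eq[of d n], of "E n"] by simp
    also have "\<dots> = (\<Sum>k\<in>totatives (n div d). E (n div d) k)"
      using d0 by (intro sum.cong refl) (simp add: E_def m mult.assoc)
    finally show "sum (E n) {k \<in> {0<..n}. gcd k n = d} = sum (E (n div d)) (totatives (n div d))" .
  qed
  also have "{d. d dvd n} = insert 1 {d. d dvd n \<and> d \<noteq> 1}" by auto
  also have "(\<Sum>d\<in>insert 1 {d. d dvd n \<and> d \<noteq> 1}. \<Sum>k\<in>totatives (n div d). E (n div d) k) =
     (\<Sum>k\<in>totatives n. E n k) + (\<Sum>d | d dvd n \<and> d \<noteq> 1. \<Sum>k\<in>totatives (n div d). E (n div d) k)"
    using less.prems by simp
  finally have "(\<Sum>k\<in>totatives n. E n k) =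
     (\<Sum>k\<in>{0<..n}. E n k) - (\<Sum>d | d dvd n \<and> d \<noteq> 1. \<Sum>k\<in>totatives (n div d). E (n div d) k)" by simp
  moreover have "(\<Sum>d | d dvd n \<and> d \<noteq> 1. \<Sum>k\<in>totatives (n div d). E (n div d) k) \<in> \<int>"
  proof (rule Ints_sum)
    fix d assume d: "d \<in> {d. d dvd n \<and> d \<noteq> 1}"
    then have "d > 1" "d \<le> n" using less.prems by (auto intro: Suc_lessI dvd_imp_le dvd_pos_nat simp: Suc_lessI)
    then have "n div d < n" "n div d > 0" using less.prems by (auto simp: div_greater_zero_iff)
    from less.IH[OF this] show "(\<Sum>k\<in>totatives (n div d). E (n div d) k) \<in> \<int>"
      by (simp add: E_def)
  qed
  ultimately have "(\<Sum>k\<in>totatives n. E n k) \<in> \<int>" using all by (simp del: of_int_sum)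
  then show ?case by (simp add: E_def)
qed

text \<open>The norm of x - \<omega> for \<omega> = (q + sqrt(-q))/2. For q congruent to 3 or 0
  modulo 4 the division is exact, because 4 divides q (q + 1).\<close>

definition fp :: "int \<Rightarrow> int \<Rightarrow> int" where "fp q x = x ^ 2 - q * x + (q ^ 2 + q) div 4"

lemma fp_eq:
  assumes "q mod 4 = 3 \<or> q mod 4 = 0" shows "4 * fp q x = (2 * x - q) ^ 2 + q"
proof -
  have "4 dvd q \<or> 4 dvd q + 1" using assms by presburger
  then have "4 dvd q * (q + 1)" by (auto intro: dvd_mult dvd_mult2)
  then have "4 * ((q ^ 2 + q) div 4) = q ^ 2 + q" by (simp add: power2_eq_square algebra_simps)
  then show ?thesis by (simp add: fp_def power2_eq_square algebra_simps)
qed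

text \<open>Here -q is a fundamental discriminant. The last clause is the local form of this at the
  ramified primes p: \<open>fp q\<close> has no root modulo p^2. It yields both the maximality of
  Z[\<omega>] and the squarefreeness of the ramified part of primitive norms.\<close>

definition fundamental :: "int \<Rightarrow> bool" where
  "fundamental q \<longleftrightarrow> q > 0 \<and> (q mod 4 = 3 \<or> q mod 4 = 0) \<and>
     (\<forall>p x. prime p \<longrightarrow> p dvd q \<longrightarrow> \<not> p ^ 2 dvd fp q x)"

section \<open>The modulus of an odd real primitive character as a fundamental discriminant\<close>

context real_primitive
begin

text \<open>With c the sum of \<open>e a\<close> over the units, this is (c + G 1)/2. Since it lies
  in \<open>A\<close>, the halving makes the square of the Gauss sum accessible modulo 4 and
  beyond.\<close>

definition W :: complex where "W = (\<Sum>a\<in>P. if \<psi> a = 1 then e a else 0)"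

lemma A_W: "W \<in> A" unfolding W_def by (intro A_sum) (auto intro: A_e A_0)

lemma coprime_sum_Ints:
  assumes "q > 1" shows "(\<Sum>a\<in>P. if coprime a q then e a else 0) \<in> \<int>"
proof -
  have "(\<Sum>a\<in>P. if coprime a q then e a else 0) = (\<Sum>a\<in>{a\<in>P. coprime a q}. e a)"
    by (rule sum.inter_filter[symmetric]) simp
  also have "\<dots> = (\<Sum>k\<in>totatives (nat q). e (int k))"
  proof (rule sum.reindex_bij_witness[of _ int nat])
    fix a assume a: "a \<in> {a\<in>P. coprime a q}"
    then have "a \<noteq> 0" using assms by auto
    then show "nat a \<in> totatives (nat q)" using a 
      by (auto simp: in_totatives_iff coprime_int_iff[symmetric])
  next
    fix k assume k: "k \<in> totatives (nat q)"
    then have "k < nat q" using totatives_less[of k "nat q"] assms by simp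
    moreover have "coprime (int k) (int (nat q))"
      using k unfolding in_totatives_iff coprime_int_iff by blast
    ultimately show "int k \<in> {a\<in>P. coprime a q}" using assms by simp
  qed auto
  also have "\<dots> = (\<Sum>k\<in>totatives (nat q). exp (2 * of_real pi * \<i> * of_nat k / of_nat (nat q)))"
    using q_pos by (intro sum.cong refl) (simp add: e_def)
  also have "\<dots> \<in> \<int>" using q_pos by (intro ramanujan_sum_Ints) auto
  finally show ?thesis .
qed

lemma G_W:
  assumes "q > 1"
  obtains c where "(\<Sum>a\<in>P. if coprime a q then e a else 0) = of_int c" "G 1 = 2 * W - of_int c"
    "of_int (\<psi> (- 1) * q - c ^ 2) = of_int 4 * (W * W - W * of_int c)"
proof -
  obtain c where c: "(\<Sum>a\<in>P. if coprime a q then e a else 0) = of_int c"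
    using coprime_sum_Ints[OF assms] by (elim Ints_cases)
  have G: "G 1 = 2 * W - of_int c"
    unfolding c[symmetric] G_def W_def sum_distrib_left sum_subtractf[symmetric]
  proof (intro sum.cong refl)
    fix a
    show "of_int (\<psi> a) * e (a * 1) = 2 * (if \<psi> a = 1 then e a else 0) - (if coprime a q then e a else 0)"
      using val[of a] zero[of a] by (cases "coprime a q") auto
  qed
  have "of_int (\<psi> (- 1) * q - c ^ 2) = G 1 ^ 2 - (of_int c) ^ 2" unfolding G_square by simp
  also have "\<dots> = of_int 4 * (W * W - W * of_int c)" unfolding G by (simp add: power2_eq_square algebra_simps)
  finally show ?thesis using that c G by blast
qed

text \<open>Stickelberger's congruence: from \<open>G 1 = 2 * W - c\<close>, the square D of the
  Gauss sum is congruent to c^2 modulo 4, and c is odd because D is.\<close>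

lemma disc_mod_4:
  assumes "odd q" "q > 1" shows "(\<psi> (- 1) * q) mod 4 = 1"
proof -
  obtain c where c: "of_int (\<psi> (- 1) * q - c ^ 2) = of_int 4 * (W * W - W * of_int c)"
    using G_W[OF assms(2)] by metis
  have "4 dvd \<psi> (- 1) * q - c ^ 2"
    by (rule A_int_dvd[OF _ c]) (auto intro: A_diff A_mult A_W A_int)
  then have d: "[\<psi> (- 1) * q = c ^ 2] (mod 4)" by (simp add: cong_iff_dvd_diff)
  have "odd (\<psi> (- 1) * q)" using assms chi_minus_1 by auto
  then have "odd c" using cong_dvd_modulus[OF d, of 2] by (auto simp: cong_def)
  then obtain j where "c = 2 * j + 1" by (elim oddE)
  then have "c ^ 2 = 1 + 4 * (j * j + j)" by (simp add: power2_eq_square algebra_simps)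
  then have "c ^ 2 mod 4 = 1" by (simp only: mod_mult_self2) simp
  then show ?thesis using d by (simp add: cong_def)
qed

text \<open>The Frobenius congruence \<open>W\<^sup>2 \<equiv> \<Sum>\<^sub>a e(2a)\<close> modulo \<open>2\<close> replaces Euler's criterion at the prime \<open>2\<close>.\<close>

lemma chi_2:
  assumes "odd q" "q > 1" shows "\<psi> 2 = 1 \<longleftrightarrow> (\<psi> (- 1) * q) mod 8 = 1"
proof -
  define D where "D = \<psi> (- 1) * q"
  obtain c where c0: "(\<Sum>a\<in>P. if coprime a q then e a else 0) = of_int c"
    and c: "of_int (\<psi> (- 1) * q - c ^ 2) = of_int 4 * (W * W - W * of_int c)"
    using G_W[OF assms(2)] by metis
  have "4 dvd \<psi> (- 1) * q - c ^ 2"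
    by (rule A_int_dvd[OF _ c]) (auto intro: A_diff A_mult A_W A_int)
  then obtain N where N: "D - c ^ 2 = 4 * N" unfolding D_def by blast
  \<comment> \<open>W is a root of X^2 - c X - N, so its square is known both from this equation and
    from Frobenius modulo 2.\<close>
  have WN: "W * W = W * of_int c + of_int N"
  proof -
    have "of_int 4 * of_int N = (of_int 4 * (W * W - W * of_int c) :: complex)"
      using c unfolding D_def[symmetric] N by simp
    then have "of_int N = W * W - W * of_int c" by (simp only: mult_cancel_left) simp
    then show ?thesis by simp
  qed
  have cop2: "coprime 2 q" using assms by simp
  have "odd D" using assms chi_minus_1 by (auto simp: D_def)
  moreover have "D = c ^ 2 + 2 * (2 * N)" using N by simp
  ultimately have "odd c" by simp
  then obtain j where j: "c = 2 * j + 1" by (elim oddE)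
  have c8: "c ^ 2 mod 8 = 1"
  proof -
    have "even (j * j + j)" by auto
    then obtain i where "j * j + j = 2 * i" by blast
    then have "c ^ 2 = 8 * i + 1" by (simp add: j power2_eq_square algebra_simps)
    then show ?thesis by simp
  qed
  define f where "f = (\<lambda>a. if \<psi> a = 1 then e a else 0)"
  have "f a \<in> A" for a by (simp add: f_def A_e A_0)
  moreover have "W = sum f P" by (simp add: W_def f_def)
  ultimately obtain z where z: "z \<in> A" "W ^ 2 = (\<Sum>a\<in>P. f a ^ 2) + of_nat 2 * z"
    using A_frobenius[of 2 P f] by auto
  have f2: "f a ^ 2 = (if \<psi> a = 1 then e (2 * a) else 0)" for a
    using e_mult_power[of a 2] by (simp add: f_def mult.commute)
  \<comment> \<open>Squaring the terms replaces a by 2 a. This carries W to itself if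
    \<open>\<psi> 2 = 1\<close> and to the complementary sum c - W otherwise. Comparison with W^2 =
    c W + N for odd c decides the parity of N.\<close>
  have "\<psi> 2 = 1 \<longleftrightarrow> even N"
  proof (cases "\<psi> 2 = 1")
    case True
    have "(\<Sum>a\<in>P. f a ^ 2) = (\<Sum>a\<in>P. f (2 * a + 0))"
      by (intro sum.cong refl, unfold f2) (simp add: f_def mult True)
    also have "\<dots> = W" unfolding W_def f_def
      by (rule sum_reindex) (auto simp: chi_mod e_mod assms)
    finally have "of_int N = of_int 2 * (z - W * of_int j)"
      using z(2) WN by (simp add: j power2_eq_square algebra_simps)
    then have "2 dvd N" by (rule A_int_dvd[rotated]) (auto intro: A_diff A_mult A_W A_int z)
    then show ?thesis using True by simp
  next
    case False
    then have m: "\<psi> 2 = - 1" using val[OF cop2] by auto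
    define g where "g = (\<lambda>a. if \<psi> a = - 1 then e a else 0)"
    have "(\<Sum>a\<in>P. f a ^ 2) = (\<Sum>a\<in>P. g (2 * a + 0))"
      by (intro sum.cong refl, unfold f2) (auto simp: g_def mult m)
    also have "\<dots> = (\<Sum>a\<in>P. g a)" 
      by (rule sum_reindex) (auto simp: g_def chi_mod e_mod assms)
    also have "\<dots> = of_int c - W"
      unfolding c0[symmetric] W_def g_def sum_subtractf[symmetric]
    proof (intro sum.cong refl)
      fix a
      show "(if \<psi> a = - 1 then e a else 0) = (if coprime a q then e a else 0) - (if \<psi> a = 1 then e a else 0)"
        using val[of a] zero[of a] by (cases "coprime a q") auto
    qed
    finally have S: "(\<Sum>a\<in>P. f a ^ 2) = of_int c - W" .
    have "W * W = of_int c - W + 2 * z" using z(2) unfolding S by (simp add: power2_eq_square)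
    then have "of_int N - of_int c = 2 * z - W - W * of_int c" using WN by (simp add: algebra_simps)
    also have "\<dots> = of_int 2 * (z - W * of_int (j + 1))" by (simp add: j algebra_simps)
    finally have eq: "of_int (N - c) = of_int 2 * (z - W * of_int (j + 1))" by simp
    have zA: "z - W * of_int (j + 1) \<in> A" by (intro A_diff A_mult A_W A_int z)
    have "2 dvd N - c" by (rule A_int_dvd[OF zA eq]) simp
    then show ?thesis using m \<open>odd c\<close> by simp
  qed
  moreover have "D mod 8 = (4 * N + 1) mod 8" using N c8 by (metis add.commute diff_add_cancel mod_add_right_eq)
  moreover have "even N \<longleftrightarrow> (4 * N + 1) mod 8 = 1" by presburger
  ultimately show ?thesis unfolding D_def by simp
qed

text \<open>If q = p^2 r, then u = 1 + p r j satisfies u^p = 1 modulo q, because (p r)^2 is a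
  multiple of q. As p is odd, a character with values 1 and -1 is trivial on all such u, against
  primitivity for the divisor p r.\<close>

lemma odd_prime_square_not_dvd:
  assumes p: "prime p" "odd p" shows "\<not> p ^ 2 dvd q"
proof
  assume "p ^ 2 dvd q"
  then obtain r where r: "q = p * p * r" by (auto simp: power2_eq_square)
  define d where "d = p * r"
  have p2: "p > 1" using p(1) prime_gt_1_int by blast
  have "r > 0" using q_pos p2 by (simp add: r zero_less_mult_iff)
  then have "d dvd q" "0 < d" "d < q" using p2 by (auto simp: d_def r)
  then obtain u where u: "[u = 1] (mod d)" "\<psi> u = - 1" using prim by blast
  then obtain j where j: "u = 1 + d * j" unfolding cong_iff_dvd_diff by (metis dvdE add.commute diff_add_cancel)
  have pow: "[u ^ n = 1 + int n * (d * j)] (mod q)" for n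
  proof (induction n)
    case (Suc n)
    have "u * (1 + int n * (d * j)) = 1 + int (Suc n) * (d * j) + q * (r * j * j * int n)"
      by (simp add: j r d_def algebra_simps)
    then have "[u * (1 + int n * (d * j)) = 1 + int (Suc n) * (d * j)] (mod q)"
      unfolding cong_iff_dvd_diff by simp
    then show ?case using cong_scalar_left[OF Suc, of u] by (auto intro: cong_trans)
  qed auto
  have "1 + int (nat p) * (d * j) = 1 + q * j" using p2 by (simp add: d_def r)
  then have "[u ^ nat p = 1 + q * j] (mod q)" using pow[of "nat p"] by metis
  then have "\<psi> (u ^ nat p) = \<psi> (1 + q * j)" by (rule chi_cong)
  then have "(- 1) ^ nat p = (1 :: int)" by (simp add: chi_power u chi_add_mult chi_1)
  then show False using p p2 by (simp add: even_nat_iff)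
qed

text \<open>An odd u congruent to 1 modulo q/2 is congruent to 1 modulo q when q/2 is odd, so the
  character would already live modulo q/2.\<close>

lemma not_2_mod_4: "q mod 4 \<noteq> 2"
proof
  assume q: "q mod 4 = 2"
  define d where "d = q div 2"
  have d: "q = 2 * d" "odd d" using q unfolding d_def by presburger+
  then have "0 < d" "d < q" using q_pos by auto
  then obtain u where u: "[u = 1] (mod d)" "coprime u q" "\<psi> u = - 1" using prim[of d] d by auto
  have "odd u" using u(2) d by auto
  then have "[u = 1] (mod 2)" by (simp add: cong_def odd_iff_mod_2_eq_one)
  moreover have "coprime 2 d" using d by simp
  ultimately have "[u = 1] (mod 2 * d)" using u(1) by (simp add: coprime_cong_mult)
  then show False using chi_cong[of u 1] chi_1 u(3) d by simp
qed

text \<open>For q = 16 r a unit congruent to 1 modulo 8 r is, modulo q, either 1 or the square of 1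
  + 4 r, and the character is not -1 there.\<close>

lemma not_16_dvd: "\<not> 16 dvd q"
proof
  assume "16 dvd q"
  then obtain r where r: "q = 16 * r" by blast
  then have "8 * r dvd q" "0 < 8 * r" "8 * r < q" using q_pos by auto
  then obtain u where u: "[u = 1] (mod 8 * r)" "\<psi> u = - 1" using prim by blast
  then obtain j where j: "u = 1 + 8 * r * j" unfolding cong_iff_dvd_diff by (metis dvdE add.commute diff_add_cancel)
  have "\<psi> u \<ge> 0"
  proof (cases "even j")
    case True
    then obtain i where "j = 2 * i" by blast
    then have "u = 1 + q * i" using j r by simp
    then show ?thesis by (simp add: chi_add_mult chi_1)
  next
    case False
    then obtain i where "j = 2 * i + 1" by (elim oddE)
    then have "u = (1 + 4 * r) * (1 + 4 * r) + q * (i - r)" using j r by (simp add: algebra_simps)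
    then have "\<psi> u = \<psi> (1 + 4 * r) * \<psi> (1 + 4 * r)" by (simp add: chi_add_mult mult)
    then show ?thesis by simp
  qed
  then show False using u by simp
qed

text \<open>For \<open>q = 4m\<close> with \<open>m\<close> odd, the component of the character at \<open>m\<close> is obtained by moving the
  argument to the residue class that is \<open>1\<close> modulo \<open>4\<close>.\<close>

lemma four_times_odd:
  assumes q: "q = 4 * m" "odd m" and neg: "\<psi> (- 1) = - 1" shows "m mod 4 = 1"
proof (cases "m = 1")
  case False
  have m1: "m > 1" using q q_pos False by auto
  \<comment> \<open>Since m^2 is congruent to 1 modulo 4, \<open>s n\<close> is congruent to n
    modulo m and to 1 modulo 4.\<close>
  define s where "s = (\<lambda>n. n + m * m * (1 - n))"
  have cop: "coprime 4 m" using q(2) by (simp add: coprime_left_2_iff_odd coprime_power_left_iff[of 2 2, simplified])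
  have sm: "[s n = n] (mod m)" for n by (simp add: s_def cong_iff_dvd_diff)
  have s4: "[s n = 1] (mod 4)" for n
  proof -
    obtain k where "m = 2 * k + 1" using q(2) by (elim oddE)
    then have "s n - 1 = 4 * ((k * k + k) * (1 - n))" by (simp add: s_def algebra_simps)
    then show ?thesis by (simp add: cong_iff_dvd_diff)
  qed
  have crt: "[a = b] (mod q)" if "[a = b] (mod 4)" "[a = b] (mod m)" for a b
    using coprime_cong_mult[OF that cop] q by simp
  have scop: "coprime (s n) q \<longleftrightarrow> coprime n m" for n
  proof -
    have "coprime (s n) 4" using s4[of n] cong_imp_coprime[of 1 "s n" 4] by (simp add: cong_sym)
    moreover have "coprime (s n) m \<longleftrightarrow> coprime n m" using sm[of n] cong_imp_coprime cong_sym by blast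
    ultimately show ?thesis by (simp add: q)
  qed
  have Yprim: "real_primitive m (\<lambda>n. \<psi> (s n))"
  proof
    show "m > 0" using m1 by simp
    show "\<psi> (s (a * b)) = \<psi> (s a) * \<psi> (s b)" for a b
      unfolding mult[symmetric]
    proof (intro chi_cong crt)
      show "[s (a * b) = s a * s b] (mod m)" using cong_trans[OF sm cong_sym[OF cong_mult[OF sm sm]]] .
      have "[s a * s b = 1 * 1] (mod 4)" by (intro cong_mult s4)
      then show "[s (a * b) = s a * s b] (mod 4)" using s4[of "a * b"] by (metis cong_sym cong_trans mult_1)
    qed
    show "\<psi> (s (n + m)) = \<psi> (s n)" for n
    proof (intro chi_cong crt)
      show "[s (n + m) = s n] (mod 4)" using cong_trans[OF s4 cong_sym[OF s4]] .
      have "[s (n + m) = n + m] (mod m)" by (rule sm)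
      also have "[n + m = n] (mod m)" by (simp add: cong_def)
      also have "[n = s n] (mod m)" using sm cong_sym by blast
      finally show "[s (n + m) = s n] (mod m)" .
    qed
    show "coprime n m \<Longrightarrow> \<psi> (s n) = 1 \<or> \<psi> (s n) = - 1" for n using val scop by blast
    show "\<not> coprime n m \<Longrightarrow> \<psi> (s n) = 0" for n using zero scop by blast
    fix d assume d: "d dvd m" "0 < d" "d < m"
    then obtain v where v: "[v = 1] (mod 4 * d)" "coprime v q" "\<psi> v = - 1"
      using prim[of "4 * d"] q by auto
    have "[s v = v] (mod q)"
    proof (rule crt[OF _ sm])
      have "[v = 1] (mod 4)" using v(1) by (rule cong_dvd_modulus) simp
      then show "[s v = v] (mod 4)" using s4[of v] by (metis cong_sym cong_trans)
    qed
    moreover have "[v = 1] (mod d)" using v(1) by (rule cong_dvd_modulus) simp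
    ultimately show "\<exists>u. [u = 1] (mod d) \<and> coprime u m \<and> \<psi> (s u) = - 1"
      using v chi_cong[of "s v" v] q by (intro exI[of _ v]) auto
  qed
  obtain u where u: "[u = 1] (mod m)" "coprime u q" "\<psi> u = - 1" using prim[of m] q m1 by auto
  have "odd u" using u(2) q by auto
  have "\<not> [u = 1] (mod 4)" using crt[of u 1] u chi_cong[of u 1] chi_1 by auto
  then have u4: "u mod 4 = 3" using \<open>odd u\<close> unfolding cong_def by presburger
  \<comment> \<open>The element u, congruent to 1 modulo m and to 3 modulo 4, shows that the
    component at 4 is odd. Hence the component at m is even, and \<open>disc_mod_4\<close> turns
    this into m = 1 modulo 4.\<close>
  have "[s (- 1) = - 1 * u] (mod q)"
  proof (rule crt)
    have "[- 1 * u = - 1 * 1] (mod m)" by (intro cong_mult u) simp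
    then show "[s (- 1) = - 1 * u] (mod m)" using sm[of "- 1"] by (metis cong_sym cong_trans mult.right_neutral)
    have "- u mod 4 = 1" using u4 by presburger
    then have "[- 1 * u = 1] (mod 4)" unfolding cong_def by simp
    then show "[s (- 1) = - 1 * u] (mod 4)" using s4[of "- 1"] by (metis cong_sym cong_trans)
  qed
  then have "\<psi> (s (- 1)) = 1" using chi_cong[of "s (- 1)" "- 1 * u"] mult[of "- 1" u] neg u by simp
  then show ?thesis using real_primitive.disc_mod_4[OF Yprim q(2) m1] by simp
qed simp

text \<open>For odd p dividing q, a value divisible by p^2 would force p^2 to divide q. For p = 2
  and q = 4 m the values are squares plus m, with m congruent to 1 or 2 modulo 4, so none is
  divisible by 4.\<close>

lemma fundamental:
  assumes neg: "\<psi> (- 1) = - 1" shows "fundamental q"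
proof -
  have "q \<noteq> 1" using chi_cong[of "- 1" 1] neg chi_1 by auto
  then have q1: "q > 1" using q_pos by simp
  have mod4: "q mod 4 = 3 \<or> q mod 4 = 0"
  proof (cases "odd q")
    case True
    have "(- q) mod 4 = 1" using disc_mod_4[OF True q1] neg by simp
    then show ?thesis by presburger
  next
    case False
    then show ?thesis using not_2_mod_4 by presburger
  qed
  have "\<not> p ^ 2 dvd fp q x" if p: "prime p" "p dvd q" for p x
  proof
    assume dv: "p ^ 2 dvd fp q x"
    show False
    proof (cases "odd p")
      case True
      have sq: "p ^ 2 dvd (2 * x - q) ^ 2 + q" using dv fp_eq[OF mod4, of x] by (metis dvd_mult)
      have "p dvd (2 * x - q) ^ 2 + q" using sq by (metis dvd_mult_left power2_eq_square)
      then have "p dvd (2 * x - q) ^ 2" using p(2) by (simp add: dvd_add_left_iff)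
      then have "p dvd 2 * x - q" using p(1) prime_dvd_power by blast
      then have "p ^ 2 dvd (2 * x - q) ^ 2" by (rule dvd_power_same)
      then have "p ^ 2 dvd q" using sq by (simp add: dvd_add_right_iff)
      then show False using odd_prime_square_not_dvd p(1) True by blast
    next
      case False
      then have "p = 2" using p(1) using primes_dvd_imp_eq[of 2 p] by simp
      then have "q mod 4 = 0" using mod4 p(2) by presburger
      then obtain m where m: "q = 4 * m" by auto
      have "fp q x = (x - 2 * m) ^ 2 + m"
        using fp_eq[OF mod4, of x] by (simp add: m power2_eq_square algebra_simps)
      then have 4: "4 dvd (x - 2 * m) ^ 2 + m" using dv \<open>p = 2\<close> by simp
      have sq4: "(x - 2 * m) ^ 2 mod 4 = 0 \<or> (x - 2 * m) ^ 2 mod 4 = 1"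
      proof (cases "even (x - 2 * m)")
        case True
        then obtain k where "x - 2 * m = 2 * k" by blast
        then have "(x - 2 * m) ^ 2 = 4 * (k * k)" by (simp add: power2_eq_square)
        then show ?thesis by simp
      next
        case False
        then obtain k where "x - 2 * m = 2 * k + 1" by (elim oddE)
        then have "(x - 2 * m) ^ 2 = 1 + 4 * (k * k + k)" by (simp add: power2_eq_square algebra_simps)
        then have "(x - 2 * m) ^ 2 mod 4 = 1" by (simp only: mod_mult_self2) simp
        then show ?thesis by simp
      qed
      have "m mod 4 = 1 \<or> m mod 4 = 2"
      proof (cases "odd m")
        case True then show ?thesis using four_times_odd[OF m _ neg] by simp
      next
        case False
        moreover have "\<not> 4 dvd m" using not_16_dvd m by auto
        ultimately show ?thesis by presburger
      qed
      then show False using 4 sq4 by presburger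
    qed
  qed
  then show ?thesis using q_pos mod4 by (simp add: fundamental_def)
qed

text \<open>For odd p the roots of \<open>fp q\<close> are square roots of -q after completing the
  square, and \<open>chi_odd_prime\<close> evaluates the Legendre symbol. For p = 2 all values of
  \<open>fp q\<close> have the parity of (q^2 + q)/4, which is compared with
  \<open>chi_2\<close>.\<close>

lemma splitting:
  assumes neg: "\<psi> (- 1) = - 1" and p: "prime p" "\<not> int p dvd q"
  shows "(\<exists>x. int p dvd fp q x) \<longleftrightarrow> \<psi> (int p) = 1"
proof (cases "p = 2")
  case True
  have q1: "q > 1" using q_pos chi_cong[of "- 1" 1] neg chi_1 by (cases "q = 1") auto
  have "odd q" using p True by simp
  then have q4: "q mod 4 = 3" using fundamental[OF neg] by (auto simp: fundamental_def)
  have e: "even (fp q x) \<longleftrightarrow> even ((q ^ 2 + q) div 4)" for x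
    using \<open>odd q\<close> by (simp add: fp_def)
  have "even ((q ^ 2 + q) div 4) \<longleftrightarrow> q mod 8 = 7"
  proof (cases "q mod 8 = 7")
    case True
    then obtain k where "q = 8 * k + 7" by (metis mult_div_mod_eq)
    then have "q ^ 2 + q = 4 * (2 * ((8 * k + 7) * (k + 1)))" by (simp add: power2_eq_square algebra_simps)
    then show ?thesis using True by simp
  next
    case False
    then have "q mod 8 = 3" using q4 by presburger
    then obtain k where "q = 8 * k + 3" by (metis mult_div_mod_eq)
    then have "q ^ 2 + q = 4 * (2 * (8 * (k * k) + 7 * k + 1) + 1)" by (simp add: power2_eq_square algebra_simps)
    then have "(q ^ 2 + q) div 4 = 2 * (8 * (k * k) + 7 * k + 1) + 1" by simp
    then show ?thesis using False by simp
  qed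
  moreover have "(- q) mod 8 = 1 \<longleftrightarrow> q mod 8 = 7" by presburger
  ultimately show ?thesis using chi_2[OF \<open>odd q\<close> q1] e neg True by simp
next
  case False
  then have p2: "p > 2" using prime_ge_2_nat[OF p(1)] by simp
  then have "odd p" using p(1) by (simp add: prime_odd_nat)
  have mod4: "q mod 4 = 3 \<or> q mod 4 = 0" using fundamental[OF neg] by (simp add: fundamental_def)
  have L: "Legendre (- q) (int p) = \<psi> (int p)" using chi_odd_prime[OF p(1) p2 p(2)] neg by simp
  have "Legendre (- q) (int p) = 1 \<longleftrightarrow> QuadRes (int p) (- q)"
    using p(2) by (auto simp: Legendre_def cong_0_iff)
  moreover have "QuadRes (int p) (- q) \<longleftrightarrow> (\<exists>x. int p dvd fp q x)"
  proof
    assume "QuadRes (int p) (- q)"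
    then obtain y where "[y ^ 2 = - q] (mod int p)" by (auto simp: QuadRes_def)
    then have y: "int p dvd y ^ 2 + q" by (simp add: cong_iff_dvd_diff)
    \<comment> \<open>\<open>h\<close> is the inverse of 2 modulo p, so that \<open>x\<close> below
      is (y + q)/2 modulo p.\<close>
    obtain h where h: "int p + 1 = 2 * h" using \<open>odd p\<close> by (metis even_Suc evenE int_ops(7) of_nat_Suc of_nat_numeral add.commute)
    define x where "x = (y + q) * h"
    have "2 * x = (y + q) * (int p + 1)" unfolding h by (simp add: x_def)
    then have "4 * fp q x = (y ^ 2 + q) + int p * ((y + q) * (2 * y + int p * (y + q)))"
      unfolding fp_eq[OF mod4] by (simp add: power2_eq_square algebra_simps)
    then have "int p dvd 4 * fp q x" using y by simp
    moreover have "\<not> int p dvd 4"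
    proof
      assume "int p dvd 4"
      then have "int p dvd 2 ^ 2" by simp
      then have "int p dvd 2" using p(1) prime_dvd_power by (metis prime_nat_int_transfer)
      then show False using p2 zdvd_imp_le by fastforce
    qed
    ultimately have "int p dvd fp q x" using p(1) by (simp add: prime_dvd_mult_iff)
    then show "\<exists>x. int p dvd fp q x" by blast
  next
    assume "\<exists>x. int p dvd fp q x"
    then obtain x where "int p dvd fp q x" by blast
    then have "int p dvd 4 * fp q x" by simp
    then have "[(2 * x - q) ^ 2 = - q] (mod int p)"
      unfolding fp_eq[OF mod4] by (simp add: cong_iff_dvd_diff)
    then show "QuadRes (int p) (- q)" by (auto simp: QuadRes_def)
  qed
  ultimately show ?thesis using L by simp
qed

end

section \<open>Complex-valued real characters\<close>

lemma exists_coprime_lift: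
  fixes n d q :: int
  assumes "coprime n d" "q > 0"
  shows "\<exists>m. [m = n] (mod d) \<and> coprime m q"
proof -
  \<comment> \<open>\<open>t\<close> collects the primes of q that do not divide n. A prime of q
    dividing n divides neither t nor d and hence not n + t d; a prime of q not dividing n divides t
    and again not n + t d.\<close>
  define t where "t = \<Prod>{p \<in> prime_factors q. \<not> p dvd n}"
  have "coprime (n + t * d) q"
  proof (rule ccontr)
    assume "\<not> coprime (n + t * d) q"
    then obtain p where p: "prime p" "p dvd n + t * d" "p dvd q"
      using prime_common_divisor[of "n + t * d" q] assms(2) by blast
    have pf: "p \<in> prime_factors q" using p assms(2) by (simp add: prime_factors_dvd)
    show False
    proof (cases "p dvd n")
      case True
      then have "p dvd t * d" using p(2) by (simp add: dvd_add_right_iff)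
      then have "p dvd t \<or> p dvd d" using p(1) by (simp add: prime_dvd_mult_iff)
      moreover have "\<not> p dvd d" using True assms(1) p(1) by (meson coprime_common_divisor not_prime_unit)
      moreover have "\<not> p dvd t"
      proof
        assume "p dvd t"
        then obtain r where r: "r \<in> prime_factors q" "\<not> r dvd n" "p dvd r"
          unfolding t_def using p(1) by (auto simp: prime_dvd_prod_iff)
        then have "p = r" using p(1) primes_dvd_imp_eq by blast
        then show False using r True by simp
      qed
      ultimately show False by blast
    next
      case False
      then have "p dvd t" unfolding t_def using pf dvd_prodI[of "{p \<in> prime_factors q. \<not> p dvd n}" p "\<lambda>p. p"] by auto
      then show False using p(2) False by (simp add: dvd_add_left_iff)
    qed
  qed
  then show ?thesis by (intro exI[of _ "n + t * d"]) (simp add: cong_def)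
qed

lemma character_cong:
  assumes "dirichlet_character q X" "[a = b] (mod int q)" shows "X a = X b"
proof -
  have per: "X (n + int q) = X n" for n using assms(1) by (simp add: dirichlet_character_def)
  have A: "X (n + int q * int k) = X n" for n k
  proof (induction k)
    case (Suc k)
    then show ?case using per[of "n + int q * int k"] by (simp add: algebra_simps)
  qed auto
  have "int q dvd b - a" using assms(2) by (metis cong_iff_dvd_diff cong_sym)
  then obtain k where "b - a = int q * k" by blast
  then have k: "b = a + int q * k" by simp
  show ?thesis
  proof (cases "k \<ge> 0")
    case True then show ?thesis using A[of a "nat k"] k by simp
  next
    case False then show ?thesis using A[of b "nat (- k)"] k by simp
  qed
qed

text \<open>Otherwise the value at a unit depends only on its residue modulo d, and choosing lifts
  prime to q defines a character modulo d that induces X.\<close>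

lemma primitive_character_kernel:
  assumes X: "primitive_character q X" and d: "d dvd q" "d < q"
  shows "\<exists>u. [u = 1] (mod int d) \<and> coprime u (int q) \<and> X u \<noteq> 1"
proof (rule ccontr)
  assume no: "\<not> ?thesis"
  have dc: "dirichlet_character q X" using X by (simp add: primitive_character_def)
  then have q0: "q > 0" and m: "\<And>m n. X (m * n) = X m * X n"
    and nz: "\<And>n. X n \<noteq> 0 \<longleftrightarrow> coprime n (int q)" by (auto simp: dirichlet_character_def)
  have d0: "d > 0" using d q0 dvd_pos_nat by blast
  have X1: "X 1 = 1" using m[of 1 1] nz[of 1] by simp
  have ind: "X a = X b" if ab: "[a = b] (mod int d)" "coprime a (int q)" "coprime b (int q)" for a b
  proof -
    \<comment> \<open>An inverse of b turns the quotient a/b into a unit congruent to 1 modulo d,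
      where X is trivial by assumption.\<close>
    obtain c where c: "[b * c = 1] (mod int q)" using cong_solve_coprime_int[OF ab(3)] by blast
    then have copc: "coprime c (int q)" by (metis coprime_iff_invertible_int mult.commute)
    have "[a * c = b * c] (mod int d)" using ab(1) by (rule cong_scalar_right)
    moreover have "[b * c = 1] (mod int d)" using c d by (auto intro: cong_dvd_modulus)
    ultimately have "[a * c = 1] (mod int d)" by (rule cong_trans)
    moreover have "coprime (a * c) (int q)" using ab copc by simp
    ultimately have "X (a * c) = 1" using no by blast
    also have "1 = X (b * c)" using character_cong[OF dc c] X1 by simp
    finally show ?thesis using nz[of c] copc by (simp add: m)
  qed
  define lift where "lift = (\<lambda>n. SOME m. [m = n] (mod int d) \<and> coprime m (int q))"
  have lift: "[lift n = n] (mod int d)" "coprime (lift n) (int q)" if "coprime n (int d)" for n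
    using someI_ex[OF exists_coprime_lift[OF that, of "int q"]] q0 unfolding lift_def by auto
  define Y where "Y = (\<lambda>n. if coprime n (int d) then X (lift n) else 0)"
  have "dirichlet_character d Y"
    unfolding dirichlet_character_def
  proof (intro conjI allI)
    show "d > 0" by (rule d0)
    show "Y (a * b) = Y a * Y b" for a b
    proof (cases "coprime a (int d) \<and> coprime b (int d)")
      case True
      then have ab: "coprime (a * b) (int d)" by simp
      have "X (lift (a * b)) = X (lift a * lift b)"
      proof (rule ind)
        have "[lift a * lift b = a * b] (mod int d)" using True by (intro cong_mult lift) auto
        then show "[lift (a * b) = lift a * lift b] (mod int d)" using lift(1)[OF ab] by (metis cong_sym cong_trans)
      qed (use lift ab True in auto)
      then show ?thesis using True by (simp add: Y_def m)
    qed (auto simp: Y_def)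
    show "Y (n + int d) = Y n" for n
    proof (cases "coprime n (int d)")
      case True
      then have c: "coprime (n + int d) (int d)" by (metis coprime_iff_gcd_eq_1 gcd_add1)
      have "X (lift (n + int d)) = X (lift n)"
      proof (rule ind)
        have "[n + int d = n] (mod int d)" by (simp add: cong_def)
        then show "[lift (n + int d) = lift n] (mod int d)"
          using lift(1)[OF c] lift(1)[OF True] by (metis cong_sym cong_trans)
      qed (use lift c True in auto)
      then show ?thesis using True c by (simp add: Y_def)
    next
      case False
      then have "\<not> coprime (n + int d) (int d)" by (metis coprime_iff_gcd_eq_1 gcd_add1)
      then show ?thesis using False by (simp add: Y_def)
    qed
    show "Y n \<noteq> 0 \<longleftrightarrow> coprime n (int d)" for n using lift nz by (simp add: Y_def)
  qed
  moreover have "X n = Y n" if n: "coprime n (int q)" for n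
  proof -
    have c: "coprime n (int d)" using n d by (meson coprime_divisors dvd_refl int_dvd_int_iff)
    show ?thesis unfolding Y_def using ind[of n "lift n"] lift[OF c] c n by (simp add: cong_sym)
  qed
  ultimately show False using X d unfolding primitive_character_def by blast
qed

text \<open>The nonzero values are roots of unity by Euler's theorem, and being real they are 1 or
  -1. Integer values allow the Gauss sum congruences and the counting formulas to be stated over the
  integers.\<close>

theorem real_primitive_of_character:
  assumes X: "primitive_character q X" "real_character X"
  obtains \<psi> where "real_primitive (int q) \<psi>" "\<And>n. X n = of_int (\<psi> n)"
proof -
  have dc: "dirichlet_character q X" using X by (simp add: primitive_character_def)
  then have q0: "q > 0" and m: "\<And>m n. X (m * n) = X m * X n" and per: "\<And>n. X (n + int q) = X n"
    and nz: "\<And>n. X n \<noteq> 0 \<longleftrightarrow> coprime n (int q)" by (auto simp: dirichlet_character_def)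
  have X1: "X 1 = 1" using m[of 1 1] nz[of 1] by simp
  have pow: "X (n ^ k) = X n ^ k" for n k by (induction k) (auto simp: X1 m)
  have v: "X n = 1 \<or> X n = - 1" if cop: "coprime n (int q)" for n
  proof -
    obtain k where k: "k > 0" "[n ^ k = 1] (mod int q)"
    proof -
      define a where "a = nat (n mod int q)"
      have a: "int a = n mod int q" using q0 by (simp add: a_def)
      have "coprime (int a) (int q)" unfolding a using cop q0 by (simp add: coprime_mod_left_iff)
      then have "coprime a q" by simp
      then have "[a ^ totient q = 1] (mod q)" by (rule euler_theorem)
      then have "[int a ^ totient q = 1] (mod int q)" by (metis cong_int_iff of_nat_1 of_nat_power)
      moreover have "[int a ^ totient q = n ^ totient q] (mod int q)" by (rule cong_pow) (simp add: a cong_def)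
      ultimately have "[n ^ totient q = 1] (mod int q)" by (metis cong_sym cong_trans)
      then show ?thesis using that[of "totient q"] q0 by simp
    qed
    have "X n ^ k = 1" using character_cong[OF dc k(2)] X1 pow by simp
    moreover obtain r where r: "X n = of_real r" using X(2) by (auto simp: real_character_def elim: Reals_cases)
    ultimately have "of_real (r ^ k) = (1 :: complex)" by simp
    then have "r ^ k = 1" by (simp only: of_real_eq_1_iff)
    then have "\<bar>r\<bar> ^ k = 1" by (simp flip: power_abs)
    then have "\<bar>r\<bar> = 1" using k(1) power_eq_imp_eq_base[of "\<bar>r\<bar>" k 1] by simp
    then show ?thesis using r by (cases "r \<ge> 0") auto
  qed
  define \<psi> :: "int \<Rightarrow> int" where "\<psi> = (\<lambda>n. if X n = 1 then 1 else if X n = 0 then 0 else - 1)"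
  have X\<psi>: "X n = of_int (\<psi> n)" for n using v[of n] nz[of n] by (auto simp: \<psi>_def)
  have "real_primitive (int q) \<psi>"
  proof
    have "of_int (\<psi> (a * b)) = (of_int (\<psi> a * \<psi> b) :: complex)" for a b
      using X\<psi>[of "a * b"] X\<psi>[of a] X\<psi>[of b] m[of a b] by simp
    then show "\<psi> (a * b) = \<psi> a * \<psi> b" for a b by (simp only: of_int_eq_iff)
    show "\<psi> (n + int q) = \<psi> n" for n by (simp add: \<psi>_def per)
    show "\<psi> n = 1 \<or> \<psi> n = - 1" if "coprime n (int q)" for n
      using v[OF that] by (elim disjE) (simp_all add: \<psi>_def)
    show "\<psi> n = 0" if "\<not> coprime n (int q)" for n
      using nz[of n] that by (simp add: \<psi>_def)
    fix d :: int assume d: "d dvd int q" "0 < d" "d < int q"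
    then have d': "nat d dvd q" "nat d < q" by (simp_all add: nat_dvd_iff nat_less_iff)
    obtain u where u: "[u = 1] (mod int (nat d))" "coprime u (int q)" "X u \<noteq> 1"
      using primitive_character_kernel[OF X(1) d'] by blast
    have "\<psi> u = - 1" using u(3) nz[of u] u(2) by (simp add: \<psi>_def)
    then show "\<exists>u. [u = 1] (mod d) \<and> coprime u (int q) \<and> \<psi> u = - 1"
      using u d by (intro exI[of _ u]) simp
  qed (use q0 in auto)
  then show ?thesis using X\<psi> that by blast
qed

section \<open>Representations of integers by a fundamental discriminant\<close>

text \<open>Equivalently the number of lattices Z k + Z (x - \<omega>) stable under \<omega>, that
  is, of primitive ideals of norm k.\<close>

definition rho :: "int \<Rightarrow> nat \<Rightarrow> nat" where
  "rho q k = card {x \<in> {0..<int k}. int k dvd fp q x}"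

lemma fp_diff: "fp q x - fp q y = (x - y) * (x + y - q)"
  by (simp add: fp_def power2_eq_square algebra_simps)

lemma fp_cong: "[x = y] (mod k) \<Longrightarrow> k dvd fp q x \<longleftrightarrow> k dvd fp q y"
proof -
  assume "[x = y] (mod k)"
  then have "k dvd fp q x - fp q y" unfolding fp_diff cong_iff_dvd_diff by simp
  then show ?thesis by (metis dvd_diff_commute dvd_diff_right_iff diff_add_cancel dvd_add_right_iff)
qed

lemma rho_1 [simp]: "rho q (Suc 0) = 1"
proof -
  have "{x \<in> {0..<int (Suc 0)}. int (Suc 0) dvd fp q x} = {0}" by auto
  then show ?thesis by (simp add: rho_def)
qed

lemma rho_mult:
  assumes "coprime a b" "a > 0" "b > 0"
  shows "rho q (a * b) = rho q a * rho q b"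
proof -
  define S where "S = (\<lambda>k::nat. {x \<in> {0..<int k}. int k dvd fp q x})"
  have cop: "coprime (int a) (int b)" using assms by simp
  have "bij_betw (\<lambda>x. (x mod int a, x mod int b)) (S (a * b)) (S a \<times> S b)"
  proof (rule bij_betwI')
    fix x y assume xy: "x \<in> S (a * b)" "y \<in> S (a * b)"
    show "((x mod int a, x mod int b) = (y mod int a, y mod int b)) = (x = y)"
    proof
      assume "(x mod int a, x mod int b) = (y mod int a, y mod int b)"
      then have "[x = y] (mod int a)" "[x = y] (mod int b)" by (auto simp: cong_def)
      then have "[x = y] (mod int a * int b)" using cop by (rule coprime_cong_mult)
      then show "x = y" using xy by (simp add: S_def cong_def)
    qed simp
  next
    fix x assume x: "x \<in> S (a * b)"
    then have "int a dvd fp q x" "int b dvd fp q x" by (auto simp: S_def intro: dvd_mult_left dvd_mult_right)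
    then show "(x mod int a, x mod int b) \<in> S a \<times> S b"
      using assms fp_cong[of "x mod int a" x "int a" q] fp_cong[of "x mod int b" x "int b" q]
      by (auto simp: S_def)
  next
    fix z assume z: "z \<in> S a \<times> S b"
    obtain y1 y2 where y: "z = (y1, y2)" by (cases z)
    obtain x where x: "[x = y1] (mod int a)" "[x = y2] (mod int b)"
      using binary_chinese_remainder_int[OF cop] by blast
    define w where "w = x mod (int a * int b)"
    have w: "[w = y1] (mod int a)" "[w = y2] (mod int b)"
      using x unfolding w_def cong_def by (simp_all add: mod_mod_cancel)
    have "int a dvd fp q w" "int b dvd fp q w"
      using fp_cong[OF w(1)] fp_cong[OF w(2)] z y by (auto simp: S_def)
    then have "int a * int b dvd fp q w" using cop by (simp add: divides_mult)
    moreover have "0 \<le> w" "w < int a * int b" using assms by (auto simp: w_def)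
    ultimately have "w \<in> S (a * b)" by (simp add: S_def)
    moreover have "z = (w mod int a, w mod int b)" using w z y by (simp add: S_def cong_def)
    ultimately show "\<exists>x\<in>S (a * b). z = (x mod int a, x mod int b)" by blast
  qed
  then have "card (S (a * b)) = card (S a \<times> S b)" by (rule bij_betw_same_card)
  then show ?thesis by (simp add: rho_def S_def card_cartesian_product)
qed

text \<open>If p divided both factors of f(y) - f(x) = (y - x)(y + x - q), it would divide 2 x - q
  and hence q. So the whole power p^k divides one of them.\<close>

lemma fp_prime_cases:
  assumes q: "q mod 4 = 3 \<or> q mod 4 = 0" and p: "prime p" "\<not> p dvd q" and k: "k > 0"
    and xy: "p ^ k dvd fp q x" "p ^ k dvd fp q y"
  shows "[y = x] (mod p ^ k) \<or> [y = q - x] (mod p ^ k)"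
proof -
  have d: "p ^ k dvd (y - x) * (y + x - q)" using xy unfolding fp_diff[symmetric] by simp
  have pf: "p dvd fp q x" using xy(1) k by (metis dvd_power dvd_trans)
  have "\<not> (p dvd y - x \<and> p dvd y + x - q)"
  proof
    assume "p dvd y - x \<and> p dvd y + x - q"
    then have "p dvd (y + x - q) - (y - x)" by (blast intro: dvd_diff)
    then have "p dvd (2 * x - q) ^ 2" by (simp add: dvd_mult2 power2_eq_square)
    moreover have "p dvd (2 * x - q) ^ 2 + q" using pf unfolding fp_eq[OF q, symmetric] by simp
    ultimately show False using p(2) by (simp add: dvd_add_right_iff)
  qed
  then have "coprime (p ^ k) (y - x) \<or> coprime (p ^ k) (y + x - q)"
    using p(1) prime_imp_coprime by (metis coprime_power_left_iff)
  then have "p ^ k dvd y + x - q \<or> p ^ k dvd y - x"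
    using d by (auto simp: coprime_dvd_mult_right_iff coprime_dvd_mult_left_iff)
  then show ?thesis by (auto simp: cong_iff_dvd_diff algebra_simps)
qed

text \<open>Hensel lifting by Newton's step: the derivative 2 y - q is invertible modulo p, because
  its square plus q is 4 f(y) and p does not divide q.\<close>

lemma fp_hensel:
  assumes q: "q mod 4 = 3 \<or> q mod 4 = 0" and p: "prime p" "\<not> p dvd q"
    and ex: "p dvd fp q x"
  shows "\<exists>y. p ^ Suc k dvd fp q y"
proof (induction k)
  case 0 then show ?case using ex by auto
next
  case (Suc k)
  then obtain y where y: "p ^ Suc k dvd fp q y" by blast
  then obtain c where c: "fp q y = p ^ Suc k * c" by blast
  have "\<not> p dvd 2 * y - q"
  proof
    assume "p dvd 2 * y - q"
    then have "p dvd (2 * y - q) ^ 2" by (simp add: dvd_mult2 power2_eq_square)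
    moreover have "p dvd (2 * y - q) ^ 2 + q" using y unfolding fp_eq[OF q, symmetric]
      by (metis dvd_mult dvd_mult_left power_Suc)
    ultimately show False using p(2) by (simp add: dvd_add_right_iff)
  qed
  then have "coprime (2 * y - q) p" using p(1) prime_imp_coprime coprime_commute by blast
  then obtain t where t: "[(2 * y - q) * t = 1] (mod p)" using cong_solve_coprime_int by blast
  then obtain s where s: "(2 * y - q) * t = 1 + p * s"
    unfolding cong_iff_dvd_diff by (metis dvdE add.commute diff_add_cancel)
  have "fp q (y - p ^ Suc k * (c * t)) = fp q y - p ^ Suc k * (c * t) * (2 * y - q - p ^ Suc k * (c * t))"
    using fp_diff[of q "y - p ^ Suc k * (c * t)" y] by (simp add: algebra_simps)
  also have "\<dots> = p ^ Suc k * c * (1 - (2 * y - q) * t) + p ^ Suc k * p ^ Suc k * (c * t) ^ 2"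
    by (simp add: c power2_eq_square algebra_simps)
  also have "\<dots> = p ^ Suc (Suc k) * (p ^ k * (c * t) ^ 2 - c * s)"
    unfolding s by (simp add: algebra_simps)
  finally show ?case by (metis dvd_triv_left)
qed

text \<open>A root x0 comes with the conjugate root q - x0, distinct from it since p does not divide
  2 x0 - q; \<open>fp_prime_cases\<close> excludes further ones.\<close>

lemma rho_unramified:
  assumes q: "q mod 4 = 3 \<or> q mod 4 = 0" and p: "prime p" "\<not> int p dvd q" and k: "k > 0"
  shows "rho q (p ^ k) = (if \<exists>x. int p dvd fp q x then 2 else 0)"
proof (cases "\<exists>x. int p dvd fp q x")
  case False
  then have "\<not> int p ^ k dvd fp q x" for x using k by (metis dvd_power dvd_trans)
  then show ?thesis using False by (simp add: rho_def)
next
  case True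
  have pp: "prime (int p)" using p by simp
  obtain x0 where x0: "int p ^ k dvd fp q x0"
    using fp_hensel[OF q pp p(2), of _ "k - 1"] True k by auto
  define M where "M = int p ^ k"
  have M: "M > 0" using p(1) prime_gt_0_nat by (simp add: M_def)
  have fq: "fp q (q - x0) = fp q x0" by (simp add: fp_def power2_eq_square algebra_simps)
  have d: "M dvd fp q x0" using x0 by (simp add: M_def)
  have "{x \<in> {0..<M}. M dvd fp q x} = {x0 mod M, (q - x0) mod M}" (is "?L = ?R")
  proof (intro subset_antisym subsetI)
    fix x assume "x \<in> ?L"
    then have "[x = x0] (mod M) \<or> [x = q - x0] (mod M)" "0 \<le> x" "x < M"
      using fp_prime_cases[OF q pp p(2) k x0, of x] by (auto simp: M_def)
    then show "x \<in> ?R" by (auto simp: cong_def)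
  next
    fix x assume "x \<in> ?R"
    then show "x \<in> ?L" using M d fq fp_cong[of "x0 mod M" x0 M q] fp_cong[of "(q - x0) mod M" "q - x0" M q]
      by auto
  qed
  moreover have "x0 mod M \<noteq> (q - x0) mod M"
  proof
    assume "x0 mod M = (q - x0) mod M"
    then have "M dvd x0 - (q - x0)" by (metis cong_def cong_iff_dvd_diff)
    moreover have pM: "int p dvd M" using k by (simp add: M_def)
    ultimately have "int p dvd 2 * x0 - q" by (auto intro: dvd_trans simp: algebra_simps)
    then have "int p dvd (2 * x0 - q) ^ 2" by (simp add: dvd_mult2 power2_eq_square)
    moreover have "int p dvd (2 * x0 - q) ^ 2 + q" using d pM unfolding fp_eq[OF q, symmetric]
      by (auto intro: dvd_mult dvd_trans)
    ultimately show False using p(2) by (simp add: dvd_add_right_iff)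
  qed
  ultimately show ?thesis using True by (simp add: rho_def M_def)
qed

text \<open>Modulo a ramified p the polynomial has a double root, which is one residue; a root
  modulo p^2 is excluded by \<open>fundamental\<close>.\<close>

lemma rho_ramified:
  assumes f: "fundamental q" and p: "prime p" "int p dvd q"
  shows "rho q p = 1" "k \<ge> 2 \<Longrightarrow> rho q (p ^ k) = 0"
proof -
  have q: "q mod 4 = 3 \<or> q mod 4 = 0" using f by (simp add: fundamental_def)
  have p0: "p > 0" using p(1) prime_gt_0_nat by blast
  have pp: "prime (int p)" using p by simp
  have "\<exists>r. \<forall>x. int p dvd fp q x \<longleftrightarrow> [x = r] (mod int p)"
  proof (cases "p = 2")
    case True
    then have "even q" using p by simp
    then have "int p dvd fp q x \<longleftrightarrow> [x = (q ^ 2 + q) div 4] (mod int p)" for x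
      unfolding True cong_iff_dvd_diff by (simp add: fp_def)
    then show ?thesis by blast
  next
    case False
    then have "p > 2" using prime_ge_2_nat[OF p(1)] by simp
    then have n2: "\<not> int p dvd 2" using zdvd_imp_le by fastforce
    have n4: "\<not> int p dvd 4" using n2 pp prime_dvd_mult_iff[of "int p" 2 2] by simp
    have "int p dvd fp q x \<longleftrightarrow> [x = 0] (mod int p)" for x
    proof -
      have "int p dvd fp q x \<longleftrightarrow> int p dvd 4 * fp q x"
        using pp n4 by (simp add: prime_dvd_mult_iff)
      also have "\<dots> \<longleftrightarrow> int p dvd (2 * x - q) ^ 2"
        unfolding fp_eq[OF q] using p(2) by (simp add: dvd_add_left_iff)
      also have "\<dots> \<longleftrightarrow> int p dvd 2 * x - q" using pp by (simp add: prime_dvd_power_iff)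
      also have "\<dots> \<longleftrightarrow> int p dvd 2 * x" using p(2) by (metis dvd_diff_left_iff dvd_diff_commute)
      also have "\<dots> \<longleftrightarrow> int p dvd x" using pp n2 by (simp add: prime_dvd_mult_iff)
      finally show ?thesis by (simp add: cong_0_iff)
    qed
    then show ?thesis by blast
  qed
  then obtain r where r: "\<And>x. int p dvd fp q x \<longleftrightarrow> [x = r] (mod int p)" by blast
  have "{x \<in> {0..<int p}. int p dvd fp q x} = {r mod int p}"
    unfolding r using p0 by (auto simp: cong_def)
  then show "rho q p = 1" by (simp add: rho_def)
  show "rho q (p ^ k) = 0" if "k \<ge> 2"
  proof -
    have "\<not> int p ^ k dvd fp q x" for x
    proof
      assume "int p ^ k dvd fp q x"
      then have "int p ^ 2 dvd fp q x" using that le_imp_power_dvd dvd_trans by blast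
      then show False using f pp p(2) by (auto simp: fundamental_def)
    qed
    then show ?thesis by (simp add: rho_def)
  qed
qed

text \<open>Kept general in \<open>e\<close> to serve the square divisors in
  \<open>form_count\<close> (e = 2) and ordinary divisor sums (e = 1).\<close>

lemma bij_betw_power_divisors:
  assumes "coprime m n" "m > 0" "n > 0" "e > 0"
  shows "bij_betw (\<lambda>(g, h). g * h) ({g. g ^ e dvd m} \<times> {h. h ^ e dvd n}) {k::nat. k ^ e dvd m * n}"
proof (rule bij_betwI')
  have dv: "g dvd m" if "g ^ e dvd m" for g m :: nat using that assms(4) by (metis dvd_power dvd_trans)
  fix x y assume "x \<in> {g. g ^ e dvd m} \<times> {h. h ^ e dvd n}" "y \<in> {g. g ^ e dvd m} \<times> {h. h ^ e dvd n}"
  then obtain g h g' h' where x: "x = (g, h)" "y = (g', h')" and "g dvd m" "g' dvd m" "h dvd n" "h' dvd n"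
    using dv by auto
  then have c: "coprime g h'" "coprime g' h" "coprime h g'" "coprime h' g" 
    using assms(1) by (meson coprime_divisors coprime_commute)+
  show "((case x of (g, h) \<Rightarrow> g * h) = (case y of (g, h) \<Rightarrow> g * h)) = (x = y)"
  proof
    assume "(case x of (g, h) \<Rightarrow> g * h) = (case y of (g, h) \<Rightarrow> g * h)"
    then have eq: "g * h = g' * h'" by (simp add: x)
    have "g dvd g' * h'" "g' dvd g * h" "h dvd g' * h'" "h' dvd g * h" using eq by (metis dvd_triv_left dvd_triv_right)+
    then have "g dvd g'" "g' dvd g" "h dvd h'" "h' dvd h"
      using c by (simp_all add: coprime_dvd_mult_left_iff coprime_dvd_mult_right_iff)
    then show "x = y" by (simp add: x dvd_antisym)
  qed simp
next
  fix x assume "x \<in> {g. g ^ e dvd m} \<times> {h. h ^ e dvd n}"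
  then show "(case x of (g, h) \<Rightarrow> g * h) \<in> {k. k ^ e dvd m * n}"
    by (auto simp: power_mult_distrib intro: mult_dvd_mono)
next
  fix k assume k: "k \<in> {k. k ^ e dvd m * n}"
  then have "k dvd m * n" using assms(4) by (metis dvd_power dvd_trans mem_Collect_eq)
  then obtain g h where gh: "k = g * h" "g dvd m" "h dvd n" using division_decomp by blast
  have "g ^ e dvd m * n" "h ^ e dvd m * n" using k gh(1) by (auto simp: power_mult_distrib intro: dvd_mult_left dvd_mult_right)
  moreover have "coprime (g ^ e) n" "coprime (h ^ e) m" using gh assms(1)
    by (meson coprime_divisors coprime_commute coprime_power_left_iff dvd_refl)+
  ultimately have "g ^ e dvd m" "h ^ e dvd n" by (simp_all add: coprime_dvd_mult_left_iff coprime_dvd_mult_right_iff)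
  then show "\<exists>x\<in>{g. g ^ e dvd m} \<times> {h. h ^ e dvd n}. k = (case x of (g, h) \<Rightarrow> g * h)"
    using gh by auto
qed

lemma sum_power_divisors_mult:
  assumes "coprime m n" "m > 0" "n > 0" "e > 0"
  shows "(\<Sum>k | k ^ e dvd m * n. f k) = (\<Sum>g | g ^ e dvd m. \<Sum>h | h ^ e dvd n. f (g * h :: nat))"
  using sum.reindex_bij_betw[OF bij_betw_power_divisors[OF assms], of f]
  by (simp add: sum.cartesian_product case_prod_unfold)

text \<open>The number of all ideals of norm n: g is the content, and n/g^2 the norm of the
  primitive part.\<close>

definition form_count :: "int \<Rightarrow> nat \<Rightarrow> nat" where
  "form_count q n = (\<Sum>g | g ^ 2 dvd n. rho q (n div g ^ 2))"

lemma form_count_mult: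
  assumes "coprime m n" "m > 0" "n > 0"
  shows "form_count q (m * n) = form_count q m * form_count q n"
proof -
  have "form_count q (m * n) = (\<Sum>g | g ^ 2 dvd m. \<Sum>h | h ^ 2 dvd n. rho q ((m * n) div (g * h) ^ 2))"
    unfolding form_count_def using assms by (intro sum_power_divisors_mult) auto
  also have "\<dots> = (\<Sum>g | g ^ 2 dvd m. \<Sum>h | h ^ 2 dvd n. rho q (m div g ^ 2) * rho q (n div h ^ 2))"
  proof (rule sum.cong[OF refl], rule sum.cong[OF refl])
    fix g h assume "g \<in> {g. g ^ 2 dvd m}" "h \<in> {h. h ^ 2 dvd n}"
    then obtain a b where ab: "m = g ^ 2 * a" "n = h ^ 2 * b" by (auto elim!: dvdE)
    then have 0: "g > 0" "h > 0" "a > 0" "b > 0" using assms by auto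
    have "(m * n) div (g * h) ^ 2 = a * b" using 0 ab by (simp add: power_mult_distrib algebra_simps)
    moreover have "coprime a b" using assms(1) ab by simp
    ultimately show "rho q ((m * n) div (g * h) ^ 2) = rho q (m div g ^ 2) * rho q (n div h ^ 2)"
      using 0 ab by (simp add: rho_mult)
  qed
  also have "\<dots> = form_count q m * form_count q n"
    by (simp add: form_count_def sum_product)
  finally show ?thesis .
qed

lemma form_count_prime_power:
  assumes p: "prime p"
  shows "form_count q (p ^ k) = (\<Sum>i\<le>k div 2. rho q (p ^ (k - 2 * i)))"
proof -
  have p1: "p > 1" using p prime_gt_1_nat by blast
  have "{g. g ^ 2 dvd p ^ k} = (\<lambda>i. p ^ i) ` {..k div 2}"
  proof (intro subset_antisym subsetI)
    fix g assume g: "g \<in> {g. g ^ 2 dvd p ^ k}"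
    then have "g dvd p ^ k" by (metis dvd_mult_left mem_Collect_eq power2_eq_square)
    then obtain i where i: "g = p ^ i" using p divides_primepow_nat by blast
    then have "p ^ (i * 2) dvd p ^ k" using g by (simp add: power_mult)
    then have "i * 2 \<le> k" using p1 by (metis power_dvd_imp_le)
    then show "g \<in> (\<lambda>i. p ^ i) ` {..k div 2}" using i by auto
  next
    fix g assume "g \<in> (\<lambda>i. p ^ i) ` {..k div 2}"
    then obtain i where "g = p ^ i" "i \<le> k div 2" by auto
    then show "g \<in> {g. g ^ 2 dvd p ^ k}" by (auto simp: power_mult[symmetric] intro!: le_imp_power_dvd)
  qed
  moreover have "inj_on (\<lambda>i. p ^ i) {..k div 2}" using p1 by (auto intro!: inj_onI simp: power_inject_exp)
  ultimately have "form_count q (p ^ k) = (\<Sum>i\<le>k div 2. rho q (p ^ k div (p ^ i) ^ 2))"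
    unfolding form_count_def by (simp add: sum.reindex)
  also have "\<dots> = (\<Sum>i\<le>k div 2. rho q (p ^ (k - 2 * i)))"
  proof (intro sum.cong refl arg_cong[where f = "rho q"])
    fix i assume "i \<in> {..k div 2}"
    then have "2 * i \<le> k" by auto
    then show "p ^ k div (p ^ i) ^ 2 = p ^ (k - 2 * i)"
      using p1 by (simp add: power_mult[symmetric] mult.commute power_diff)
  qed
  finally show ?thesis .
qed

locale odd_real_primitive = real_primitive +
  assumes neg: "\<psi> (- 1) = - 1"
begin

text \<open>The recursion \<open>S (k + 2) = r (k + 2) + S k\<close> has to match two further terms
  of the geometric sum: they add 2 at a split prime, cancel at an inert one and vanish at a ramified
  one.\<close>

lemma form_count_prime_power':
  assumes p: "prime p"
  shows "int (form_count q (p ^ k)) = (\<Sum>i\<le>k. \<psi> (int p) ^ i)"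
proof -
  have fund: "fundamental q" using fundamental neg by blast
  then have q4: "q mod 4 = 3 \<or> q mod 4 = 0" by (simp add: fundamental_def)
  have pp: "prime (int p)" using p by simp
  define r where "r = (\<lambda>j. int (rho q (p ^ j)))"
  define S where "S = (\<lambda>k. \<Sum>i\<le>k div 2. r (k - 2 * i))"
  have S: "int (form_count q (p ^ k)) = S k" for k
    by (simp add: form_count_prime_power[OF p] S_def r_def)
  have S2: "S (Suc (Suc k)) = r (Suc (Suc k)) + S k" for k
    unfolding S_def by (simp add: sum.atMost_Suc_shift del: sum.atMost_Suc)
  have S0: "S 0 = 1" by (simp add: S_def r_def)
  have S1: "S 1 = r 1" by (simp add: S_def)
  define c where "c = \<psi> (int p)"
  have "S k = (\<Sum>i\<le>k. c ^ i)"
  proof (cases "int p dvd q")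
    case True
    then have "\<not> coprime (int p) q" using pp by (meson coprime_absorb_left not_prime_unit)
    then have c: "c = 0" using zero by (simp add: c_def)
    have "S k = 1"
    proof (induction k rule: induct_nat_012)
      case 1 then show ?case using S1 rho_ramified[OF fund p True] by (simp add: r_def)
    next
      case (ge2 n) then show ?case using S2 rho_ramified(2)[OF fund p True, of "Suc (Suc n)"] by (simp add: r_def)
    qed (simp add: S0)
    moreover have "(\<Sum>i\<le>k. c ^ i) = 1" by (induction k) (auto simp: c)
    ultimately show ?thesis by simp
  next
    case False
    then have cop: "coprime (int p) q" using pp by (simp add: prime_imp_coprime)
    have r: "r j = (if c = 1 then 2 else 0)" if "j > 0" for j
      using rho_unramified[OF q4 p False that] splitting[OF neg p False] by (simp add: r_def c_def)
    show ?thesis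
    proof (induction k rule: induct_nat_012)
      case 1 show ?case using S1 r[of 1] val[OF cop] by (auto simp: c_def)
    next
      case (ge2 n)
      have "S (Suc (Suc n)) = r (Suc (Suc n)) + (\<Sum>i\<le>n. c ^ i)" using S2 ge2 by simp
      then show ?case using r[of "Suc (Suc n)"] val[OF cop] by (auto simp: c_def)
    qed (simp add: S0)
  qed
  then show ?thesis using S by (simp add: c_def)
qed

text \<open>The coefficient identity behind the factorization of the Dedekind zeta function into
  \<zeta>(s) L(s,\<chi>). Both sides are multiplicative, so prime powers suffice.\<close>

theorem form_count_eq:
  "n > 0 \<Longrightarrow> int (form_count q n) = (\<Sum>d | d dvd n. \<psi> (int d))"
proof (induction n rule: less_induct)
  case (less n)
  show ?case
  proof (cases "n = 1")
    case True
    have "{g::nat. g ^ 2 dvd 1} = {1}" "{d::nat. d dvd 1} = {1}" by auto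
    then show ?thesis using True by (simp add: form_count_def chi_1)
  next
    case False
    then obtain p where p: "prime p" "p dvd n" using prime_factor_nat by blast
    have p1: "p > 1" using p prime_gt_1_nat by blast
    obtain m where m: "n = p ^ multiplicity p n * m" "\<not> p dvd m"
      using multiplicity_decompose'[of n p] less.prems p1 by auto
    define k where "k = multiplicity p n"
    have "k > 0" unfolding k_def using p p1 less.prems by (simp add: multiplicity_gt_zero_iff)
    have m0: "m > 0" using m less.prems by (auto intro: Nat.gr0I)
    have "1 < p ^ k" using p1 \<open>k > 0\<close> by (rule one_less_power)
    then have "m < n" using m(1) m0 unfolding k_def[symmetric] by simp
    have cop: "coprime (p ^ k) m" using p m(2) by (simp add: prime_imp_coprime)
    have n: "n = p ^ k * m" using m(1) by (simp add: k_def)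
    have "(\<Sum>d | d dvd n. \<psi> (int d)) = (\<Sum>g | g ^ 1 dvd p ^ k. \<Sum>h | h ^ 1 dvd m. \<psi> (int (g * h)))"
      using sum_power_divisors_mult[OF cop, of 1 "\<lambda>d. \<psi> (int d)"] p1 m0 by (simp add: n)
    also have "\<dots> = (\<Sum>g | g dvd p ^ k. \<psi> (int g)) * (\<Sum>h | h dvd m. \<psi> (int h))"
      by (simp add: sum_product mult)
    also have "{g. g dvd p ^ k} = (\<lambda>i. p ^ i) ` {..k}"
      using p(1) by (auto simp: divides_primepow_nat)
    also have "(\<Sum>g\<in>(\<lambda>i. p ^ i) ` {..k}. \<psi> (int g)) = (\<Sum>i\<le>k. \<psi> (int p) ^ i)"
      using p1 by (subst sum.reindex) (auto intro!: inj_onI simp: power_inject_exp chi_power)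
    also have "\<dots> = int (form_count q (p ^ k))" using form_count_prime_power'[OF p(1)] by simp
    also have "(\<Sum>h | h dvd m. \<psi> (int h)) = int (form_count q m)"
      using less.IH[OF \<open>m < n\<close> m0] by simp
    finally show ?thesis using form_count_mult[OF cop, of q] m0 p1 by (simp add: n)
  qed
qed

end

section \<open>Ideal classes of an imaginary quadratic field and reduced forms\<close>

text \<open>The hypotheses say that (m + n \<omega>)/d has integral trace and norm, and the
  conclusion that it lies in Z[\<omega>]. This is maximality of the order; one prime of d is
  stripped at a time.\<close>

lemma fundamental_lattice:
  assumes "fundamental q" "d > 0" "d dvd 2 * m + n * q" "d ^ 2 dvd m ^ 2 + m * n * q + n ^ 2 * ((q ^ 2 + q) div 4)"
  shows "d dvd m \<and> d dvd n"
  using assms(2-)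
proof (induction "nat d" arbitrary: d m n rule: less_induct)
  case less
  define c where "c = (q ^ 2 + q) div 4"
  show ?case
  proof (cases "d = 1")
    case False
    then obtain p where p: "prime p" "p dvd d" using prime_divisor_exists[of d] less.prems(1) by auto
    then obtain d' where d': "d = p * d'" by blast
    have p1: "p > 1" using p prime_gt_1_int by blast
    have d'0: "d' > 0" using d' less.prems(1) p1 by (simp add: zero_less_mult_iff)
    have T: "p dvd 2 * m + n * q" using less.prems(2) p(2) dvd_trans by blast
    have "p ^ 2 dvd d ^ 2" using p(2) by (rule dvd_power_same)
    then have N: "p ^ 2 dvd m ^ 2 + m * n * q + n ^ 2 * c" using less.prems(3) dvd_trans unfolding c_def by blast
    have pn: "p dvd n"
    proof (rule ccontr)
      assume "\<not> p dvd n"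
      then have "coprime n (p ^ 2)" using p(1) prime_imp_coprime coprime_commute by auto
      then obtain n' where "[n * n' = 1] (mod p ^ 2)" using cong_solve_coprime_int by blast
      then obtain j where j: "n * n' = 1 + p ^ 2 * j"
        unfolding cong_iff_dvd_diff by (metis dvdE add.commute diff_add_cancel)
      \<comment> \<open>With n invertible modulo p^2, dividing by n turns the norm into a value of
        \<open>fp\<close> divisible by p^2 and the trace into 2 x - q. Then p divides q, which
        \<open>fundamental\<close> excludes.\<close>
      define x where "x = - m * n'"
      have "fp q x = n' ^ 2 * (m ^ 2 + m * n * q + n ^ 2 * c) - m * n' * q * (n * n' - 1) - c * ((n * n') ^ 2 - 1)"
        by (simp add: fp_def x_def c_def power2_eq_square algebra_simps)
      also have "\<dots> = n' ^ 2 * (m ^ 2 + m * n * q + n ^ 2 * c) - p ^ 2 * (m * n' * q * j) - p ^ 2 * (c * (2 * j + p ^ 2 * j ^ 2))"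
        unfolding j by (simp add: power2_eq_square algebra_simps)
      finally have f: "p ^ 2 dvd fp q x" using N by (simp add: dvd_diff)
      have "2 * x - q = - n' * (2 * m + n * q) + q * (n * n' - 1)" by (simp add: x_def algebra_simps)
      also have "\<dots> = - n' * (2 * m + n * q) + p * (q * p * j)" unfolding j by (simp add: power2_eq_square)
      finally have "p dvd 2 * x - q" using T by (metis dvd_add dvd_mult dvd_triv_left)
      then have "p dvd (2 * x - q) ^ 2" by (simp add: dvd_mult2 power2_eq_square)
      moreover have "p dvd (2 * x - q) ^ 2 + q"
        using f assms(1) fp_eq[of q x] unfolding fundamental_def by (metis dvd_mult dvd_mult_left power2_eq_square)
      ultimately have "p dvd q" by (simp add: dvd_add_right_iff)
      then show False using f assms(1) p(1) unfolding fundamental_def by blast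
    qed
    then obtain n1 where n1: "n = p * n1" by blast
    have "p dvd m ^ 2 + p * (m * n1 * q + n1 * n * c)"
      using N unfolding n1 by (metis (no_types, lifting) dvd_mult_left power2_eq_square distrib_left mult.assoc mult.left_commute add.assoc)
    then have "p dvd m ^ 2" by (simp add: dvd_add_left_iff)
    then have "p dvd m" using p(1) prime_dvd_power by blast
    then obtain m1 where m1: "m = p * m1" by blast
    have "p * d' dvd p * (2 * m1 + n1 * q)" using less.prems(2) by (simp add: d' m1 n1 algebra_simps)
    then have 1: "d' dvd 2 * m1 + n1 * q" using p1 by simp
    have "p ^ 2 * d' ^ 2 dvd p ^ 2 * (m1 ^ 2 + m1 * n1 * q + n1 ^ 2 * c)"
      using less.prems(3) by (simp add: d' m1 n1 c_def power2_eq_square algebra_simps)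
    then have 2: "d' ^ 2 dvd m1 ^ 2 + m1 * n1 * q + n1 ^ 2 * c" using p1 by simp
    have "nat d' < nat d" using d' d'0 p1 by simp
    from less.hyps[OF this d'0 1 2[unfolded c_def]] show ?thesis by (simp add: d' m1 n1)
  qed simp
qed

text \<open>The bound on q excludes the discriminants -3 and -4, whose fields have units besides 1
  and -1.\<close>

locale imag_quadratic =
  fixes q :: nat
  assumes fund: "fundamental (int q)" and q4: "q > 4"
begin

definition s :: real where "s = sqrt (real q)"
definition \<omega> :: complex where "\<omega> = Complex (real q / 2) (s / 2)"
definition c :: int where "c = (int q ^ 2 + int q) div 4"
definition el :: "int \<Rightarrow> int \<Rightarrow> complex" where "el m n = of_int m + of_int n * \<omega>"
definition Nm :: "int \<Rightarrow> int \<Rightarrow> int" where "Nm m n = m ^ 2 + m * n * int q + n ^ 2 * c"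

abbreviation K :: "complex set" where "K \<equiv> imag_quadratic_field q"
abbreviation ZK :: "complex set" where "ZK \<equiv> integers_of K"

section \<open>Arithmetic of the field and its ring of integers\<close>

lemma s2: "s > 2"
proof -
  have "sqrt 4 < s" unfolding s_def using q4 by (subst real_sqrt_less_iff) simp
  then show ?thesis by simp
qed

lemma s_sq: "s * s = real q" by (simp add: s_def)

lemma q_mod: "int q mod 4 = 3 \<or> int q mod 4 = 0" using fund by (simp add: fundamental_def)

lemma c4: "4 * c = int q ^ 2 + int q"
  using fp_eq[OF q_mod, of 0] by (simp add: c_def fp_def)

lemma c4r: "real_of_int c = (real q ^ 2 + real q) / 4"
proof -
  have "real_of_int (4 * c) = real_of_int (int q ^ 2 + int q)" unfolding c4 ..
  then show ?thesis by simp
qed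

lemma Re_el: "Re (el m n) = of_int m + of_int n * real q / 2" by (simp add: el_def \<omega>_def)
lemma Im_el: "Im (el m n) = of_int n * s / 2" by (simp add: el_def \<omega>_def)

lemma el_eq_iff: "el m n = el m' n' \<longleftrightarrow> m = m' \<and> n = n'"
  using s2 by (auto simp: complex_eq_iff Re_el Im_el)

lemma omega_sq: "\<omega> * \<omega> = of_nat q * \<omega> - of_int c"
  by (simp add: complex_eq_iff \<omega>_def c4r power2_eq_square s_sq field_simps)

lemma el_add: "el m n + el m' n' = el (m + m') (n + n')" by (simp add: el_def algebra_simps)
lemma el_minus: "- el m n = el (- m) (- n)" by (simp add: el_def)
lemma el_mult: "el m n * el m' n' = el (m * m' - n * n' * c) (m * n' + n * m' + n * n' * int q)"
proof -
  have "el m n * el m' n' = of_int (m * m') + of_int (m * n' + n * m') * \<omega> + of_int (n * n') * (\<omega> * \<omega>)"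
    by (simp add: el_def algebra_simps)
  then show ?thesis unfolding omega_sq by (simp add: el_def algebra_simps)
qed
lemma el_cnj: "cnj (el m n) = el (m + n * int q) (- n)"
  by (simp add: complex_eq_iff Re_el Im_el)
lemma el_of_int: "of_int m = el m 0" by (simp add: el_def)
lemma el_omega: "\<omega> = el 0 1" by (simp add: el_def)
lemma el_0: "el 0 0 = 0" by (simp add: el_def)
lemma el_1: "el 1 0 = 1" by (simp add: el_def)

lemma el_norm: "el m n * cnj (el m n) = of_int (Nm m n)"
  by (simp add: el_cnj el_mult el_of_int el_eq_iff Nm_def power2_eq_square algebra_simps)

lemma el_cmod: "(cmod (el m n))\<^sup>2 = of_int (Nm m n)"
proof -
  have "complex_of_real ((cmod (el m n))\<^sup>2) = complex_of_real (of_int (Nm m n))"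
    using complex_norm_square[of "el m n"] el_norm[of m n] by simp
  then show ?thesis by (simp only: of_real_eq_iff)
qed

lemma Nm_pos: "el m n \<noteq> 0 \<Longrightarrow> Nm m n > 0"
  using el_cmod[of m n] by (metis norm_eq_zero of_int_0_less_iff zero_less_power2)

lemma K_iff: "z \<in> K \<longleftrightarrow> (\<exists>d m n. d > 0 \<and> of_int d * z = el m n)"
proof
  have cs: "csqrt (- of_nat q) = 2 * \<omega> - of_nat q"
    by (simp add: complex_eq_iff \<omega>_def s_def)
  {
    assume "z \<in> K"
    then obtain a b where z: "z = of_rat a + of_rat b * csqrt (- of_nat q)" by (auto simp: imag_quadratic_field_def)
    obtain a1 a2 where a: "a = of_int a1 / of_int a2" "a2 > 0" 
      using quotient_of_denom_pos quotient_of_div by (metis surj_pair)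
    obtain b1 b2 where b: "b = of_int b1 / of_int b2" "b2 > 0" 
      using quotient_of_denom_pos quotient_of_div by (metis surj_pair)
    have a': "of_rat a = (of_int a1 / of_int a2 :: complex)" and b': "of_rat b = (of_int b1 / of_int b2 :: complex)"
      using a b by (simp_all add: of_rat_divide)
    have "of_int (a2 * b2) * z = el (a1 * b2 - b1 * a2 * int q) (2 * b1 * a2)"
      unfolding z cs el_def a' b' using a(2) b(2) by (simp add: field_simps)
    moreover have "a2 * b2 > 0" using a(2) b(2) by simp
    ultimately show "\<exists>d m n. d > 0 \<and> of_int d * z = el m n" by blast
  }
  {
    assume "\<exists>d m n. d > 0 \<and> of_int d * z = el m n"
    then obtain d m n where d: "d > 0" "of_int d * z = el m n" by blast
    then have "z = (of_int m + of_int n * \<omega>) / of_int d" unfolding el_def by (simp add: field_simps)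
    also have "\<dots> = of_rat ((2 * of_int m + of_int n * of_nat q) / (2 * of_int d)) + of_rat (of_int n / (2 * of_int d)) * csqrt (- of_nat q)"
      unfolding cs using d by (simp add: of_rat_divide of_rat_add of_rat_mult field_simps)
    finally show "z \<in> K" unfolding imag_quadratic_field_def by blast
  }
qed

lemma K_el: "el m n \<in> K" using K_iff by (metis of_int_1 mult_1 zero_less_one)

lemma K_mult: "x \<in> K \<Longrightarrow> y \<in> K \<Longrightarrow> x * y \<in> K"
proof -
  assume "x \<in> K" "y \<in> K"
  then obtain d m n d' m' n' where 1: "d > 0" "of_int d * x = el m n" "d' > 0" "of_int d' * y = el m' n'"
    unfolding K_iff by blast
  have "of_int (d * d') * (x * y) = (of_int d * x) * (of_int d' * y)" by simp
  then show "x * y \<in> K" unfolding K_iff 1(2,4) el_mult using 1 mult_pos_pos by blast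
qed

lemma K_inverse: "x \<in> K \<Longrightarrow> inverse x \<in> K"
proof (cases "x = 0")
  case True then show ?thesis using K_el[of 0 0] by (simp add: el_0)
next
  case False
  assume "x \<in> K"
  then obtain d m n where 1: "d > 0" "of_int d * x = el m n" unfolding K_iff by blast
  have nz: "el m n \<noteq> 0" using 1 False by (metis mult_eq_0_iff of_int_eq_0_iff less_irrefl)
  have "of_int (Nm m n) * inverse x = of_int d * cnj (el m n)"
    unfolding el_norm[symmetric] using 1(2)[symmetric] False by simp
  also have "\<dots> = el (d * (m + n * int q)) (- d * n)" by (simp add: el_cnj el_of_int el_mult)
  finally show ?thesis unfolding K_iff using Nm_pos[OF nz] by blast
qed

lemma el_algebraic_int: "algebraic_int (el m n)"
proof (rule algebraic_int.intros[of "[: of_int (Nm m n), - of_int (2 * m + n * int q), 1 :]"])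
  show "poly [: of_int (Nm m n), - of_int (2 * m + n * int q), 1 :] (el m n) = 0"
    by (simp add: el_of_int el_mult el_add el_minus Nm_def power2_eq_square algebra_simps el_0[symmetric] el_eq_iff
        del: of_int_mult of_int_add of_int_minus of_int_power)
qed (auto simp: Polynomial.coeff_pCons split: nat.splits)

text \<open>All powers of x share the denominator \<open>D\<close>, so all powers of its norm share
  \<open>D ^ 2\<close>, and \<open>rat_bounded_denominators\<close> makes the norm an integer. The
  same for x + 1 gives the trace, and \<open>fundamental_lattice\<close> applies.\<close>

lemma algebraic_int_el:
  assumes x: "x \<in> K" "algebraic_int x" shows "\<exists>m n. x = el m n"
proof -
  define R where "R = range (\<lambda>(m, n). el m n)"
  have R_el: "el m n \<in> R" for m n unfolding R_def by (metis case_prod_conv rangeI)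
  have RE: "\<exists>m n. y = el m n" if "y \<in> R" for y using that by (auto simp: R_def)
  have R_add: "y + z \<in> R" if "y \<in> R" "z \<in> R" for y z using RE[OF that(1)] RE[OF that(2)] el_add R_el by metis
  have R_int: "of_int k * y \<in> R" if "y \<in> R" for y k using RE[OF that] el_of_int el_mult R_el by metis
  have R_0: "0 \<in> R" using R_el[of 0 0] by (simp add: el_0)
  have R_sum: "sum f I \<in> R" if "\<And>i. i \<in> I \<Longrightarrow> f i \<in> R" for f and I :: "nat set"
    using that by (induction I rule: infinite_finite_induct) (auto intro: R_0 R_add)
  obtain p where p: "lead_coeff p = 1" "\<And>i. Polynomial.coeff p i \<in> \<int>" "poly p x = 0"
    using x(2) by (auto elim: algebraic_int.cases)
  obtain d m n where d: "d > 0" "of_int d * x = el m n" using x(1) K_iff by blast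
  define g where "g = Polynomial.degree p"
  \<comment> \<open>\<open>D\<close> clears the denominators of the powers below the degree
    \<open>g\<close>; the monic equation of x carries the bound to the higher powers.\<close>
  define D where "D = d ^ g"
  have D: "D > 0" using d by (simp add: D_def)
  have pw: "of_int (d ^ k) * x ^ k \<in> R" for k
  proof (induction k)
    case 0 then show ?case using R_el[of 1 0] by (simp add: el_1)
  next
    case (Suc k)
    have "of_int (d ^ Suc k) * x ^ Suc k = (of_int d * x) * (of_int (d ^ k) * x ^ k)" by simp
    then show ?case using RE[OF Suc] d(2) el_mult R_el by metis
  qed
  have Dx: "of_int D * x ^ k \<in> R" for k
  proof (induction k rule: less_induct)
    case (less k)
    show ?case
    proof (cases "k < g")
      case True
      have "D = d ^ (g - k) * d ^ k" using True unfolding D_def by (simp add: power_add[symmetric])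
      then have "of_int D * x ^ k = of_int (d ^ (g - k)) * (of_int (d ^ k) * x ^ k)" by simp
      then show ?thesis using R_int[OF pw[of k], of "d ^ (g - k)"] by metis
    next
      case False
      have "0 = (\<Sum>i\<le>g. Polynomial.coeff p i * x ^ i)" using p(3) by (simp add: poly_altdef g_def)
      also have "\<dots> = x ^ g + (\<Sum>i<g. Polynomial.coeff p i * x ^ i)"
        using p(1) by (simp add: lessThan_Suc_atMost[symmetric] g_def)
      finally have "x ^ g = - (\<Sum>i<g. Polynomial.coeff p i * x ^ i)" by (simp add: eq_neg_iff_add_eq_0)
      moreover have "x ^ k = x ^ (k - g) * x ^ g" using False power_add[of x "k - g" g] by simp
      ultimately have "of_int D * x ^ k = of_int D * x ^ (k - g) * - (\<Sum>i<g. Polynomial.coeff p i * x ^ i)"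
        by (simp only: mult.assoc)
      also have "\<dots> = (\<Sum>i<g. - Polynomial.coeff p i * (of_int D * x ^ (k - g + i)))"
        by (simp add: sum_distrib_left sum_negf power_add algebra_simps)
      also have "\<dots> \<in> R"
      proof (rule R_sum)
        fix i assume i: "i \<in> {..<g}"
        then have "k - g + i < k" using False by auto
        moreover obtain z where "Polynomial.coeff p i = of_int z" using p(2)[of i] by (elim Ints_cases)
        ultimately show "- Polynomial.coeff p i * (of_int D * x ^ (k - g + i)) \<in> R"
          using R_int[OF less.IH[of "k - g + i"], of "- z"] by simp
      qed
      finally show ?thesis .
    qed
  qed
  \<comment> \<open>The norm of x + 1 is the norm of x plus the trace plus 1, so the trace is
    reached from norms alone.\<close>
  have Dx1: "of_int D * (x + 1) ^ k \<in> R" for k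
  proof -
    have "of_int D * (x + 1) ^ k = (\<Sum>i\<le>k. of_int (int (k choose i)) * (of_int D * x ^ i))"
      unfolding binomial_ring[of x 1 k] by (simp add: sum_distrib_left mult.left_commute)
    also have "\<dots> \<in> R" by (rule R_sum) (rule R_int[OF Dx])
    finally show ?thesis .
  qed
  have key: "d ^ 2 dvd Nm m' n'" if y: "of_int d * y = el m' n'" "\<And>k. of_int D * y ^ k \<in> R" for y m' n'
  proof -
    have "(of_int (Nm m' n') / of_int (d ^ 2) :: rat) \<in> \<int>"
    proof (rule rat_bounded_denominators)
      show "D ^ 2 > 0" using D by simp
      fix k
      obtain a b where ab: "of_int D * y ^ k = el a b" using RE[OF y(2)[of k]] by blast
      have "(of_int (d ^ k) * (of_int D * y ^ k)) = of_int D * (of_int d * y) ^ k"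
        by (simp add: power_mult_distrib)
      then have "of_int (d ^ k) * el a b = of_int D * el m' n' ^ k" unfolding ab y(1) .
      then have "(of_int (d ^ k) * el a b) * cnj (of_int (d ^ k) * el a b) =
          (of_int D * el m' n' ^ k) * cnj (of_int D * el m' n' ^ k)" by simp
      moreover have nn: "(of_int j * w) * cnj (of_int j * w) = of_int (j ^ 2) * (w * cnj w)" for j w
        by (simp add: power2_eq_square)
      moreover have "el m' n' ^ k * cnj (el m' n' ^ k) = of_int (Nm m' n' ^ k)"
        by (simp add: power_mult_distrib[symmetric] el_norm)
      ultimately have "of_int ((d ^ k) ^ 2 * Nm a b) = (of_int (D ^ 2 * Nm m' n' ^ k) :: complex)"
        unfolding nn el_norm by (simp only: of_int_mult)
      then have e: "(d ^ k) ^ 2 * Nm a b = D ^ 2 * Nm m' n' ^ k" by (simp only: of_int_eq_iff)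
      have "of_int (D ^ 2) * (of_int (Nm m' n') / of_int (d ^ 2)) ^ k = (of_int (D ^ 2 * Nm m' n' ^ k) / of_int ((d ^ 2) ^ k) :: rat)"
        by (simp add: power_divide)
      also have "D ^ 2 * Nm m' n' ^ k = (d ^ 2) ^ k * Nm a b"
        unfolding e[symmetric] by (simp add: power_mult[symmetric] mult.commute)
      also have "of_int ((d ^ 2) ^ k * Nm a b) / of_int ((d ^ 2) ^ k) = (of_int (Nm a b) :: rat)"
        using d(1) by simp
      finally show "of_int (D ^ 2) * (of_int (Nm m' n') / of_int (d ^ 2) :: rat) ^ k \<in> \<int>" by simp
    qed
    then obtain z where "(of_int (Nm m' n') / of_int (d ^ 2) :: rat) = of_int z" by (elim Ints_cases)
    then have "(of_int (Nm m' n') :: rat) = of_int (d ^ 2 * z)" using d(1) by (simp add: field_simps)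
    then have "Nm m' n' = d ^ 2 * z" by (simp only: of_int_eq_iff)
    then show ?thesis by simp
  qed
  have N: "d ^ 2 dvd Nm m n" using key[OF d(2) Dx] .
  have "of_int d * (x + 1) = el (m + d) n" using d(2) by (simp add: el_def algebra_simps)
  then have "d ^ 2 dvd Nm (m + d) n" using key[OF _ Dx1] by blast
  moreover have "Nm (m + d) n = Nm m n + d * (2 * m + n * int q) + d ^ 2"
    by (simp add: Nm_def power2_eq_square algebra_simps)
  ultimately have "d ^ 2 dvd d * (2 * m + n * int q)" using N
    by (metis dvd_add_left_iff dvd_add_right_iff dvd_refl)
  then have T: "d dvd 2 * m + n * int q" using d(1) by (simp add: power2_eq_square)
  have "d dvd m \<and> d dvd n"
    by (rule fundamental_lattice[OF fund d(1) T]) (use N in \<open>simp add: Nm_def c_def\<close>)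
  then obtain a b where "m = d * a" "n = d * b" by blast
  then have "of_int d * x = of_int d * el a b" using d(2) by (simp add: el_def algebra_simps)
  then show ?thesis using d(1) by auto
qed

lemma ZK_iff: "x \<in> ZK \<longleftrightarrow> (\<exists>m n. x = el m n)"
  unfolding integers_of_def using algebraic_int_el el_algebraic_int K_el by blast

lemma ZK_el: "el m n \<in> ZK" using ZK_iff by blast
lemma ZK_mult: "x \<in> ZK \<Longrightarrow> y \<in> ZK \<Longrightarrow> x * y \<in> ZK" unfolding ZK_iff using el_mult by metis
lemma ZK_add: "x \<in> ZK \<Longrightarrow> y \<in> ZK \<Longrightarrow> x + y \<in> ZK" unfolding ZK_iff using el_add by metis
lemma ZK_cnj: "x \<in> ZK \<Longrightarrow> cnj x \<in> ZK" unfolding ZK_iff using el_cnj by metis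
lemma ZK_uminus: "x \<in> ZK \<Longrightarrow> - x \<in> ZK" unfolding ZK_iff using el_minus by metis
lemma ZK_0: "0 \<in> ZK" using ZK_el[of 0 0] by (simp add: el_0)
lemma ZK_1: "1 \<in> ZK" using ZK_el[of 1 0] by (simp add: el_1)
lemma ZK_int: "of_int k \<in> ZK" using ZK_el[of k 0] by (simp add: el_of_int)
lemma ZK_omega: "\<omega> \<in> ZK" using ZK_el[of 0 1] by (simp add: el_omega)
lemma ring_ZK: "ring (complex_ring ZK)"
proof -
  have "abelian_group (complex_ring ZK)"
    by (rule abelian_groupI) (auto simp: complex_ring_def ZK_add ZK_0 intro: bexI[OF _ ZK_uminus])
  then show ?thesis
    by (rule ringI) (auto intro!: monoidI simp: complex_ring_def ZK_mult ZK_1 algebra_simps)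
qed

section \<open>Fractional ideals and ideal classes\<close>

definition frac :: "complex set \<Rightarrow> bool" where
  "frac I \<longleftrightarrow> I \<subseteq> K \<and> 0 \<in> I \<and> (\<exists>x\<in>I. x \<noteq> 0) \<and> (\<forall>x\<in>I. \<forall>y\<in>I. x + y \<in> I) \<and> (\<forall>r\<in>ZK. \<forall>x\<in>I. r * x \<in> I) \<and>
     (\<exists>d\<in>ZK - {0}. \<forall>x\<in>I. d * x \<in> ZK)"

lemma fractional_ideal_iff: "fractional_ideal K I \<longleftrightarrow> frac I"
proof
  assume "fractional_ideal K I"
  then obtain d where I: "I \<subseteq> K" "I \<noteq> {0}" and d: "d \<in> ZK" "d \<noteq> 0" and id: "ideal ((*) d ` I) (complex_ring ZK)"
    unfolding fractional_ideal_def by blast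
  interpret ideal "(*) d ` I" "complex_ring ZK" by (rule id)
  have mem: "x \<in> I" if "d * x \<in> (*) d ` I" for x using d that by auto
  have 0: "0 \<in> I" using additive_subgroup.zero_closed[OF additive_subgroup_axioms] mem[of 0] by (simp add: complex_ring_def)
  moreover have "\<exists>x\<in>I. x \<noteq> 0" using I(2) 0 by blast
  moreover have "x + y \<in> I" if "x \<in> I" "y \<in> I" for x y
  proof (rule mem)
    have "d * x \<in> (*) d ` I" "d * y \<in> (*) d ` I" using that by auto
    from additive_subgroup.a_closed[OF additive_subgroup_axioms this]
    show "d * (x + y) \<in> (*) d ` I" by (simp add: complex_ring_def distrib_left)
  qed
  moreover have "r * x \<in> I" if "r \<in> ZK" "x \<in> I" for r x
  proof (rule mem)
    have "d * x \<in> (*) d ` I" "r \<in> carrier (complex_ring ZK)" using that by (auto simp: complex_ring_def)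
    from I_l_closed[OF this]
    show "d * (r * x) \<in> (*) d ` I" by (simp add: complex_ring_def mult.left_commute)
  qed
  moreover have "d * x \<in> ZK" if "x \<in> I" for x
    using additive_subgroup.a_subset[OF additive_subgroup_axioms] that by (auto simp: complex_ring_def)
  ultimately show "frac I" unfolding frac_def using I d by blast
next
  assume f: "frac I"
  then obtain d where d: "d \<in> ZK" "d \<noteq> 0" and dI: "\<And>x. x \<in> I \<Longrightarrow> d * x \<in> ZK" unfolding frac_def by blast
  have neg: "- x \<in> I" if "x \<in> I" for x
  proof -
    have "of_int (- 1) * x \<in> I" using f that ZK_int unfolding frac_def by blast
    then show ?thesis by simp
  qed
  have "ideal ((*) d ` I) (complex_ring ZK)"
  proof (rule idealI[OF ring_ZK])
    show "subgroup ((*) d ` I) (add_monoid (complex_ring ZK))"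
    proof (rule group.subgroupI)
      show grp: "Group.group (add_monoid (complex_ring ZK))"
        by (rule abelian_group.a_group[OF ring.is_abelian_group[OF ring_ZK]])
      fix a assume a: "a \<in> (*) d ` I"
      then obtain x where x: "x \<in> I" "a = d * x" by blast
      have "inv\<^bsub>add_monoid (complex_ring ZK)\<^esub> a = - a"
      proof (rule group.inv_equality[OF grp])
        show "- a \<in> carrier (add_monoid (complex_ring ZK))"
          using ZK_uminus[OF dI[OF x(1)]] x(2) by (simp add: complex_ring_def)
        show "a \<in> carrier (add_monoid (complex_ring ZK))"
          using dI[OF x(1)] x(2) by (simp add: complex_ring_def)
      qed (simp add: complex_ring_def)
      then show "inv\<^bsub>add_monoid (complex_ring ZK)\<^esub> a \<in> (*) d ` I"
        using neg[OF x(1)] x(2) by (auto intro!: image_eqI[of _ _ "- x"])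
    next
      fix a b assume "a \<in> (*) d ` I" "b \<in> (*) d ` I"
      then obtain x y where "x \<in> I" "y \<in> I" "a = d * x" "b = d * y" by blast
      moreover have "x + y \<in> I" if "x \<in> I" "y \<in> I" for x y using f that by (simp add: frac_def)
      ultimately show "a \<otimes>\<^bsub>add_monoid (complex_ring ZK)\<^esub> b \<in> (*) d ` I"
        by (auto simp: complex_ring_def distrib_left[symmetric])
    qed (use dI f in \<open>auto simp: complex_ring_def frac_def\<close>)
  next
    fix a x assume "a \<in> (*) d ` I" "x \<in> carrier (complex_ring ZK)"
    then obtain y where y: "y \<in> I" "a = d * y" "x \<in> ZK" by (auto simp: complex_ring_def)
    then have "x * y \<in> I" using f by (simp add: frac_def)
    then show "x \<otimes>\<^bsub>complex_ring ZK\<^esub> a \<in> (*) d ` I" "a \<otimes>\<^bsub>complex_ring ZK\<^esub> x \<in> (*) d ` I"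
      using y by (auto simp: complex_ring_def intro!: image_eqI[of _ _ "x * y"])
  qed
  moreover have "I \<noteq> {0}" using f by (auto simp: frac_def)
  ultimately show "fractional_ideal K I"
    unfolding fractional_ideal_def using f d by (auto simp: frac_def)
qed

definition cls :: "complex set \<Rightarrow> complex set set" where "cls I = {(*) z ` I | z. z \<in> K - {0}}"

lemma principal_prod:
  assumes f: "frac I" shows "ideal_prod (complex_ring K) ((*) z ` ZK) I = (*) z ` I"
proof (intro subset_antisym subsetI)
  fix x assume "x \<in> ideal_prod (complex_ring K) ((*) z ` ZK) I"
  then show "x \<in> (*) z ` I"
  proof (induction rule: ideal_prod.induct)
    case (prod i j)
    then obtain r where "r \<in> ZK" "i = z * r" by blast
    moreover have "r * j \<in> I" if "r \<in> ZK" for r using that f prod by (simp add: frac_def)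
    ultimately show ?case by (auto simp: complex_ring_def mult.assoc)
  next
    case (sum s1 s2)
    then obtain a b where "a \<in> I" "b \<in> I" "s1 = z * a" "s2 = z * b" by blast
    moreover have "a + b \<in> I" if "a \<in> I" "b \<in> I" for a b using that f by (simp add: frac_def)
    ultimately show ?case by (auto simp: complex_ring_def distrib_left[symmetric])
  qed
next
  fix x assume "x \<in> (*) z ` I"
  then obtain y where y: "y \<in> I" "x = z * y" by blast
  have "z * 1 \<in> (*) z ` ZK" using ZK_1 by blast
  from ideal_prod.prod[OF this y(1), of "complex_ring K"] y(2)
  show "x \<in> ideal_prod (complex_ring K) ((*) z ` ZK) I" by (simp add: complex_ring_def)
qed

text \<open>\<open>Coset.order\<close> is the size of the carrier, the set of right cosets of
  \<open>principal_ideals\<close>; by \<open>principal_prod\<close> the coset of \<open>I\<close> is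
  the set \<open>cls I\<close> of its scalings.\<close>

lemma class_number_eq: "class_number K = card (cls ` Collect frac)"
proof -
  have coset: "principal_ideals K #>\<^bsub>ideal_group K\<^esub> I = cls I" if "frac I" for I
  proof -
    have "principal_ideals K #>\<^bsub>ideal_group K\<^esub> I = (\<Union>h\<in>principal_ideals K. {ideal_prod (complex_ring K) h I})"
      by (simp add: r_coset_def ideal_group_def)
    also have "\<dots> = {ideal_prod (complex_ring K) ((*) z ` ZK) I | z. z \<in> K - {0}}"
      unfolding principal_ideals_def by blast
    also have "\<dots> = cls I" unfolding cls_def principal_prod[OF that] ..
    finally show ?thesis .
  qed
  have "carrier (class_group K) = (\<Union>I\<in>Collect frac. {principal_ideals K #>\<^bsub>ideal_group K\<^esub> I})"
    by (simp add: class_group_def FactGroup_def RCOSETS_def ideal_group_def fractional_ideal_iff)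
  also have "\<dots> = cls ` Collect frac" using coset by (simp add: UNION_singleton_eq_range)
  finally show ?thesis by (simp add: class_number_def Coset.order_def)
qed

end

section \<open>Lattices in the upper half-plane, reduction and primitive representations\<close>

context imag_quadratic
begin

abbreviation f :: "int \<Rightarrow> int" where "f \<equiv> fp (int q)"
text \<open>\<open>lat (tau a x)\<close> is the ideal Z a + Z (\<omega> - x) divided by a, so that 1
  becomes a basis vector.\<close>

definition tau :: "int \<Rightarrow> int \<Rightarrow> complex" where "tau a x = (\<omega> - of_int x) / of_int a"
definition lat :: "complex \<Rightarrow> complex set" where "lat \<sigma> = {of_int m + of_int n * \<sigma> | m n. True}"
text \<open>The norm form of \<open>lat (tau a x)\<close>, of discriminant -q: its value is a times
  the squared modulus of m + n \<open>tau a x\<close>, see \<open>cmod_lat\<close>.\<close>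

definition Q :: "int \<Rightarrow> int \<Rightarrow> int \<Rightarrow> int \<Rightarrow> int" where
  "Q a x m n = a * m ^ 2 + (int q - 2 * x) * m * n + (f x div a) * n ^ 2"

lemma Im_tau: "Im (tau a x) = s / (2 * of_int a)"
proof -
  have "tau a x = (\<omega> - of_int x) / complex_of_real (of_int a)" by (simp add: tau_def)
  then show ?thesis unfolding Im_divide_of_real by (simp add: \<omega>_def)
qed

lemma Re_tau: "Re (tau a x) = (real q - 2 * of_int x) / (2 * of_int a)"
proof -
  have "tau a x = (\<omega> - of_int x) / complex_of_real (of_int a)" by (simp add: tau_def)
  then show ?thesis unfolding Re_divide_of_real by (simp add: \<omega>_def diff_divide_distrib)
qed

lemma lat_eqI:
  assumes "Im \<sigma> \<noteq> 0" "of_int m + of_int n * \<sigma> = of_int m' + of_int n' * \<sigma>"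
  shows "m = m'" "n = n'"
proof -
  have "of_int n * Im \<sigma> = of_int n' * Im \<sigma>" using arg_cong[OF assms(2), of Im] by simp
  then show n: "n = n'" using assms(1) by simp
  then show "m = m'" using assms(2) by simp
qed

lemma lat_shift: "lat (\<sigma> + of_int k) = lat \<sigma>"
proof -
  have "lat (\<sigma> + of_int k) \<subseteq> lat \<sigma>" for \<sigma> k
  proof
    fix z assume "z \<in> lat (\<sigma> + of_int k)"
    then obtain m n where "z = of_int m + of_int n * (\<sigma> + of_int k)" by (auto simp: lat_def)
    then have "z = of_int (m + n * k) + of_int n * \<sigma>" by (simp add: algebra_simps)
    then show "z \<in> lat \<sigma>" unfolding lat_def by blast
  qed
  from this[of \<sigma> k] this[of "\<sigma> + of_int k" "- k"] show ?thesis by auto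
qed

lemma tau_mod: "k > 0 \<Longrightarrow> lat (tau k (e mod k)) = lat (tau k e)"
proof -
  assume k: "k > 0"
  have "e = e div k * k + e mod k" by simp
  then have "(of_int e :: complex) = of_int (e div k) * of_int k + of_int (e mod k)" by (metis of_int_add of_int_mult)
  then have "tau k (e mod k) = tau k e + of_int (e div k)" using k by (simp add: tau_def field_simps)
  then show ?thesis by (simp add: lat_shift)
qed

lemma f_eq: "f e = e ^ 2 - int q * e + c" by (simp add: fp_def c_def)

lemma omega_mult: "\<omega> * (\<omega> - of_int e) = of_int (int q - e) * (\<omega> - of_int e) - of_int (f e)"
proof -
  have "\<omega> * (\<omega> - of_int e) = \<omega> * \<omega> - of_int e * \<omega>" by (simp add: algebra_simps)
  then show ?thesis unfolding omega_sq by (simp add: f_eq power2_eq_square algebra_simps)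
qed

text \<open>Writing \<omega> = e + k \<sigma> exhibits \<sigma> as (\<omega> - e)/k; comparing
  coefficients in \<omega> \<sigma> then gives the divisibility of \<open>f e\<close> by k.\<close>

lemma lat_stable:
  assumes \<sigma>: "Im \<sigma> > 0" and st: "\<omega> \<in> lat \<sigma>" "\<omega> * \<sigma> \<in> lat \<sigma>"
  obtains k e where "k > 0" "k dvd f e" "\<sigma> = tau k e"
proof -
  obtain e k where ek: "\<omega> = of_int e + of_int k * \<sigma>" using st(1) by (auto simp: lat_def)
  have "s / 2 = of_int k * Im \<sigma>" using arg_cong[OF ek, of Im] by (simp add: \<omega>_def)
  then have "of_int k * Im \<sigma> > 0" using s2 by simp
  then have k: "k > 0" using \<sigma> by (simp add: zero_less_mult_iff)
  have we: "\<omega> - of_int e = of_int k * \<sigma>" using ek by simp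
  obtain m n where mn: "\<omega> * \<sigma> = of_int m + of_int n * \<sigma>" using st(2) by (auto simp: lat_def)
  have "of_int k * (\<omega> * \<sigma>) = of_int (int q - e) * (of_int k * \<sigma>) - of_int (f e)"
    using omega_mult[of e] unfolding we by (simp add: algebra_simps)
  then have "of_int (k * m) + of_int (k * n) * \<sigma> = of_int (- f e) + of_int ((int q - e) * k) * \<sigma>"
    unfolding mn by (simp add: algebra_simps)
  then have "k * m = - f e" using lat_eqI(1) \<sigma> by (metis less_irrefl)
  then have "k dvd f e" by (metis dvd_minus_iff dvd_triv_left)
  moreover have "\<sigma> = tau k e" using we k by (simp add: tau_def field_simps)
  ultimately show ?thesis using k that by blast
qed

lemma frac_lat:
  assumes a: "a > 0" "a dvd f x" shows "frac (lat (tau a x))"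
proof -
  define t where "t = tau a x"
  have at: "of_int a * t = \<omega> - of_int x" using a by (simp add: t_def tau_def)
  have az: "of_int a * (of_int m + of_int n * t) = el (a * m - n * x) n" for m n
  proof -
    have "of_int a * (of_int m + of_int n * t) = of_int (a * m) + of_int n * (of_int a * t)" by (simp add: algebra_simps)
    then show ?thesis unfolding at by (simp add: el_def algebra_simps)
  qed
  obtain b where b: "f x = a * b" using a(2) by blast
  have "of_int a * (\<omega> * t) = of_int a * (of_int (int q - x) * t - of_int b)"
    using omega_mult[of x] unfolding at[symmetric] b by (simp add: algebra_simps)
  then have wt: "\<omega> * t = of_int (int q - x) * t - of_int b" using a(1) by simp
  have w: "\<omega> = of_int x + of_int a * t" unfolding at by simp
  have I: "of_int m + of_int n * t \<in> lat t" for m n unfolding lat_def by blast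
  have E: "\<exists>m n. z = of_int m + of_int n * t" if "z \<in> lat t" for z using that by (auto simp: lat_def)
  have add: "y + z \<in> lat t" if yz: "y \<in> lat t" "z \<in> lat t" for y z
  proof -
    obtain m n m' n' where "y = of_int m + of_int n * t" "z = of_int m' + of_int n' * t" using E yz by meson
    then have "y + z = of_int (m + m') + of_int (n + n') * t" by (simp add: algebra_simps)
    then show ?thesis using I by metis
  qed
  have mul: "r * z \<in> lat t" if rz: "r \<in> ZK" "z \<in> lat t" for r z
  proof -
    obtain m n where z: "z = of_int m + of_int n * t" using E rz by meson
    obtain u v where r: "r = el u v" using rz ZK_iff by blast
    have wz: "\<omega> * z = of_int (m * x - n * b) + of_int (m * a + n * (int q - x)) * t"
    proof -
      have "\<omega> * z = of_int m * \<omega> + of_int n * (\<omega> * t)" unfolding z by (simp add: algebra_simps)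
      also have "\<dots> = of_int m * (of_int x + of_int a * t) + of_int n * (of_int (int q - x) * t - of_int b)"
        unfolding wt w[symmetric] ..
      finally show ?thesis by (simp add: algebra_simps)
    qed
    have "r * z = of_int u * z + of_int v * (\<omega> * z)" by (simp add: r el_def algebra_simps)
    also have "\<dots> = of_int (u * m + v * (m * x - n * b)) + of_int (u * n + v * (m * a + n * (int q - x))) * t"
      unfolding wz by (simp add: z algebra_simps)
    finally show ?thesis using I by metis
  qed
  have "lat t \<subseteq> K"
  proof
    fix z assume "z \<in> lat t"
    then obtain m n where "z = of_int m + of_int n * t" using E by blast
    then show "z \<in> K" using az a(1) unfolding K_iff by metis
  qed
  moreover have "0 \<in> lat t" "1 \<in> lat t" using I[of 0 0] I[of 1 0] by auto
  moreover have "\<exists>d\<in>ZK - {0}. \<forall>z\<in>lat t. d * z \<in> ZK"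
  proof (intro bexI ballI)
    fix z assume "z \<in> lat t"
    then obtain m n where "z = of_int m + of_int n * t" using E by blast
    then show "of_int a * z \<in> ZK" using az ZK_el by metis
  qed (use a ZK_int in auto)
  moreover have "\<exists>z\<in>lat t. z \<noteq> 0" using I[of 1 0] by (intro bexI[of _ 1]) auto
  ultimately show ?thesis unfolding t_def[symmetric] frac_def using add mul by blast
qed

lemma cmod_lat:
  assumes a: "a > 0" "a dvd f x"
  shows "of_int a * (cmod (of_int m + of_int n * tau a x))\<^sup>2 = of_int (Q a x m n)"
proof -
  obtain b where b: "f x = a * b" using a(2) by blast
  have "of_int a * (of_int m + of_int n * tau a x) = el (a * m - n * x) n"
    using a(1) by (simp add: tau_def el_def field_simps)
  moreover define X where "X = cmod (of_int m + of_int n * tau a x)"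
  moreover have "cmod (of_int a * (of_int m + of_int n * tau a x)) = of_int a * X"
    using a(1) by (simp add: norm_mult X_def)
  ultimately have "(of_int a * X)\<^sup>2 = of_int (Nm (a * m - n * x) n)"
    using el_cmod[of "a * m - n * x" n] by simp
  moreover have "Nm (a * m - n * x) n = a * (a * m ^ 2 + (int q - 2 * x) * m * n) + f x * n ^ 2"
    by (simp add: Nm_def fp_def c_def power2_eq_square algebra_simps)
  then have "Nm (a * m - n * x) n = a * Q a x m n" using a(1) unfolding b by (simp add: Q_def b algebra_simps)
  ultimately have "of_int a * (of_int a * X\<^sup>2) = of_int a * of_int (Q a x m n)"
    by (simp add: power2_eq_square mult_ac)
  then show ?thesis using a(1) by (simp add: X_def)
qed

text \<open>Gauss reduction through minimal vectors. Dividing by a shortest vector v makes 1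
  shortest; t is taken with least positive imaginary part and real part at most 1/2 in absolute
  value. Then \<open>cmod t \<ge> 1\<close> says that the outer coefficients satisfy a <= c.\<close>

lemma frac_reduced:
  assumes fr: "frac I"
  obtains z a x where "z \<in> K" "z \<noteq> 0" "a > 0" "a dvd f x" "(*) z ` I = lat (tau a x)"
    "\<bar>int q - 2 * x\<bar> \<le> a" "a * a \<le> f x"
proof -
  obtain d where d: "d \<in> ZK" "d \<noteq> 0" and dI: "\<And>y. y \<in> I \<Longrightarrow> d * y \<in> ZK" using fr unfolding frac_def by blast
  have IK: "I \<subseteq> K" and I_add: "\<And>y z. y \<in> I \<Longrightarrow> z \<in> I \<Longrightarrow> y + z \<in> I"
    and I_mult: "\<And>r y. r \<in> ZK \<Longrightarrow> y \<in> I \<Longrightarrow> r * y \<in> I" and I_ne: "\<exists>y\<in>I. y \<noteq> 0"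
    using fr unfolding frac_def by blast+
  \<comment> \<open>The norm after clearing denominators by \<open>d\<close> is a natural number, so
    a least nonzero value exists.\<close>
  define N where "N = (\<lambda>y. nat \<lfloor>(cmod (d * y))\<^sup>2\<rfloor>)"
  have N: "real (N y) = (cmod (d * y))\<^sup>2" if yI: "y \<in> I" for y
  proof -
    obtain m n where "d * y = el m n" using dI[OF yI] ZK_iff by blast
    then have "(cmod (d * y))\<^sup>2 = of_int (Nm m n)" using el_cmod by simp
    moreover then have "Nm m n \<ge> 0" by (metis of_int_0_le_iff zero_le_power2)
    ultimately show ?thesis by (simp add: N_def)
  qed
  obtain v where v: "v \<in> I" "v \<noteq> 0" and vmin: "\<And>y. y \<in> I \<Longrightarrow> y \<noteq> 0 \<Longrightarrow> N v \<le> N y"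
    using ex_has_least_nat[of "\<lambda>y. y \<in> I \<and> y \<noteq> 0" _ N] I_ne by metis
  have vmin': "cmod v \<le> cmod y" if "y \<in> I" "y \<noteq> 0" for y
  proof -
    have "(cmod (d * v))\<^sup>2 \<le> (cmod (d * y))\<^sup>2" using vmin[OF that] N v(1) that(1) by (metis of_nat_le_iff)
    then have "cmod (d * v) \<le> cmod (d * y)" by (rule power2_le_imp_le) simp
    then show ?thesis using d(2) by (simp add: norm_mult)
  qed
  define J where "J = (*) (inverse v) ` I"
  have JI: "y \<in> J \<longleftrightarrow> v * y \<in> I" for y
    unfolding J_def using v(2) by (auto simp: image_iff field_simps)
  have J_add: "y + z \<in> J" if "y \<in> J" "z \<in> J" for y z using I_add that by (simp add: JI distrib_left)
  have J_mult: "r * y \<in> J" if "r \<in> ZK" "y \<in> J" for r y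
    using I_mult[of r "v * y"] that by (simp add: JI mult.left_commute)
  have J1: "1 \<in> J" using v(1) by (simp add: JI)
  have J_min: "cmod y \<ge> 1" if "y \<in> J" "y \<noteq> 0" for y
    using vmin'[of "v * y"] that v(2) by (simp add: JI norm_mult)
  have Jint: "of_int k \<in> J" for k using J_mult[OF ZK_int J1, of k] by simp
  have J_comb: "y - of_int k * z \<in> J" if "y \<in> J" "z \<in> J" for y z k
    using J_add[OF that(1) J_mult[OF ZK_int that(2), of "- k"]] by simp
  \<comment> \<open>Subtracting the nearest integer leaves an element of modulus below 1, which is 0
    because 1 is shortest.\<close>
  have Jreal: "\<exists>k. y = of_int k" if "y \<in> J" "Im y = 0" for y
  proof -
    define k where "k = round (Re y)"
    have yJ: "y - of_int k \<in> J" using J_comb[OF that(1) J1, of k] by simp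
    have "y - of_int k = of_real (Re y - of_int k)" using that(2) by (simp add: complex_eq_iff)
    then have "cmod (y - of_int k) = \<bar>Re y - of_int k\<bar>" by (metis norm_of_real)
    also have "\<dots> < 1" using of_int_round_abs_le[of "Re y"] by (simp add: k_def abs_minus_commute)
    finally have "y - of_int k = 0" using J_min[OF yJ] by fastforce
    then show ?thesis by auto
  qed
  obtain m0 n0 where mn0: "d * v = el m0 n0" using dI[OF v(1)] ZK_iff by blast
  \<comment> \<open>Multiplication by \<open>M\<close> carries J into the ring of integers. The
    imaginary parts of J are therefore multiples of s/(2 M), and a least positive one
    exists.\<close>
  define M where "M = Nm m0 n0"
  have M0: "M > 0" unfolding M_def by (rule Nm_pos) (use mn0 d(2) v(2) in auto)
  have MJ: "of_int M * y \<in> ZK" if yJ: "y \<in> J" for y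
  proof -
    have yI: "v * y \<in> I" using yJ by (simp add: JI)
    have "of_int M * y = (d * v) * cnj (el m0 n0) * y" unfolding mn0 M_def el_norm ..
    also have "\<dots> = cnj (el m0 n0) * (d * (v * y))" by (simp only: mult_ac)
    also have "\<dots> \<in> ZK" by (rule ZK_mult[OF ZK_cnj[OF ZK_el] dI[OF yI]])
    finally show ?thesis .
  qed
  have ImJ: "\<exists>n. of_int M * Im y = of_int n * s / 2" if yJ: "y \<in> J" for y
  proof -
    obtain m n where "of_int M * y = el m n" using iffD1[OF ZK_iff MJ[OF yJ]] by blast
    from arg_cong[OF this, of Im] show ?thesis unfolding Im_el by auto
  qed
  define g where "g = (\<lambda>y. nat \<lfloor>of_int M * Im y * 2 / s\<rfloor>)"
  have g: "of_int M * Im y = of_nat (g y) * s / 2" if yJ: "y \<in> J" "Im y > 0" for y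
  proof -
    obtain n where n: "of_int M * Im y = of_int n * s / 2" using ImJ[OF yJ(1)] by blast
    have "of_int M * Im y > 0" using M0 yJ(2) by simp
    then have "n > 0" unfolding n using s2 by (simp add: zero_less_mult_iff)
    moreover have "of_int M * Im y * 2 / s = of_int n" using n s2 by (simp add: field_simps)
    ultimately have "of_nat (g y) = (of_int n :: real)" by (simp add: g_def)
    then show ?thesis using n by simp
  qed
  have wJ: "\<omega> \<in> J" "Im \<omega> > 0" using J_mult[OF ZK_omega J1] s2 by (auto simp: \<omega>_def)
  then obtain t0 where t0: "t0 \<in> J" "Im t0 > 0" and tmin: "\<And>y. y \<in> J \<Longrightarrow> Im y > 0 \<Longrightarrow> g t0 \<le> g y"
    using ex_has_least_nat[of "\<lambda>y. y \<in> J \<and> Im y > 0" \<omega> g] by metis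
  define t where "t = t0 - of_int (round (Re t0))"
  have t: "t \<in> J" "Im t > 0" using J_comb[OF t0(1) J1, of "round (Re t0)"] t0(2) by (auto simp: t_def)
  have Re_t: "\<bar>Re t\<bar> \<le> 1 / 2" using of_int_round_abs_le[of "Re t0"] by (simp add: t_def abs_minus_commute)
  have Jmin_Im: "Im y \<ge> Im t" if "y \<in> J" "Im y > 0" for y
  proof -
    have "of_nat (g t0) * s / 2 \<le> of_nat (g y) * s / 2" using tmin[OF that] s2 by simp
    then have "of_int M * Im t0 \<le> of_int M * Im y" using g[OF t0] g[OF that] by linarith
    then show ?thesis using M0 by (simp add: t_def)
  qed
  have J_lat: "J = lat t"
  proof (intro subset_antisym subsetI)
    fix y assume y: "y \<in> J"
    define k where "k = \<lfloor>Im y / Im t\<rfloor>"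
    define r where "r = y - of_int k * t"
    have rJ: "r \<in> J" unfolding r_def by (rule J_comb[OF y t(1)])
    have "of_int k \<le> Im y / Im t" "Im y / Im t < of_int k + 1" unfolding k_def by linarith+
    then have "of_int k * Im t \<le> Im y" "Im y < (of_int k + 1) * Im t"
      using t(2) by (simp_all add: pos_le_divide_eq pos_divide_less_eq)
    moreover have "Im r = Im y - of_int k * Im t" by (simp add: r_def)
    ultimately have "0 \<le> Im r" "Im r < Im t" by (simp_all add: algebra_simps)
    then have "Im r = 0" using Jmin_Im[OF rJ] by linarith
    then obtain j where "r = of_int j" using Jreal[OF rJ] by blast
    then have "y = of_int j + of_int k * t" by (simp add: r_def algebra_simps)
    then show "y \<in> lat t" unfolding lat_def by blast
  next
    fix y assume "y \<in> lat t"
    then obtain m n where "y = of_int m + of_int n * t" by (auto simp: lat_def)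
    then show "y \<in> J" using J_add[OF Jint J_mult[OF ZK_int t(1)]] by simp
  qed
  obtain a x where ax: "a > 0" "a dvd f x" "t = tau a x"
    using lat_stable[OF t(2)] wJ(1) J_mult[OF ZK_omega t(1)] unfolding J_lat by blast
  have "\<bar>(real q - 2 * of_int x) / (2 * of_int a)\<bar> \<le> 1 / 2" using Re_t unfolding ax(3) Re_tau .
  then have "\<bar>real q - 2 * of_int x\<bar> \<le> of_int a" using ax(1) by (simp add: abs_divide field_simps)
  then have "of_int \<bar>int q - 2 * x\<bar> \<le> (of_int a :: real)" by simp
  then have red1: "\<bar>int q - 2 * x\<bar> \<le> a" by (simp only: of_int_le_iff)
  have "cmod t \<ge> 1" using J_min[OF t(1)] t(2) by fastforce
  then have "of_int a * 1 \<le> of_int a * (cmod t)\<^sup>2" using ax(1) by (simp add: one_le_power)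
  also have "\<dots> = of_int (Q a x 0 1)" using cmod_lat[OF ax(1,2), of 0 1] by (simp add: ax(3))
  finally have "a \<le> Q a x 0 1" by simp
  then have "a \<le> f x div a" by (simp add: Q_def)
  then have "a * a \<le> a * (f x div a)" using ax(1) by simp
  then have red2: "a * a \<le> f x" using ax(2) by simp
  have "inverse v \<in> K" "inverse v \<noteq> 0" using K_inverse v IK by auto
  then show ?thesis using that ax red1 red2 J_lat unfolding J_def by blast
qed

lemma cls_self: "I \<in> cls I"
proof -
  have "1 \<in> K - {0}" using K_el[of 1 0] by (simp add: el_1)
  moreover have "I = (*) 1 ` I" by simp
  ultimately show ?thesis unfolding cls_def by blast
qed

lemma cls_scale:
  assumes "z \<in> K" "z \<noteq> 0" shows "cls ((*) z ` I) = cls I"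
proof -
  have sub: "cls ((*) z ` I) \<subseteq> cls I" if "z \<in> K" "z \<noteq> 0" for z I
  proof
    fix J assume "J \<in> cls ((*) z ` I)"
    then obtain w where w: "w \<in> K" "w \<noteq> 0" "J = (*) w ` ((*) z ` I)" by (auto simp: cls_def)
    then have "J = (*) (w * z) ` I" by (simp add: image_image mult.assoc)
    moreover have "w * z \<in> K - {0}" using w that K_mult by simp
    ultimately show "J \<in> cls I" unfolding cls_def by blast
  qed
  have "cls I \<subseteq> cls ((*) z ` I)"
  proof -
    have "(*) (inverse z) ` ((*) z ` I) = (\<lambda>y. y) ` I"
      unfolding image_image using assms(2) by (intro image_cong) auto
    then have "(*) (inverse z) ` ((*) z ` I) = I" by simp
    then show ?thesis using sub[of "inverse z" "(*) z ` I"] assms K_inverse[OF assms(1)] by simp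
  qed
  then show ?thesis using sub[OF assms] by blast
qed

lemma cls_eqD: "cls I = cls J \<Longrightarrow> \<exists>z\<in>K - {0}. J = (*) z ` I"
proof -
  assume "cls I = cls J"
  then have "J \<in> cls I" using cls_self[of J] by simp
  then show ?thesis unfolding cls_def by blast
qed

text \<open>A coprime pair extends to a basis of determinant 1. Dividing by v makes 1 a basis vector
  again, and comparing imaginary parts identifies the new leading coefficient as
  \<open>Q a x m n\<close>. Thus a primitive representation of k yields a root of \<open>f\<close>
  modulo k.\<close>

lemma rescaled_lattice:
  assumes a: "a > 0" "a dvd f x" and cop: "coprime m n"
  defines "v \<equiv> of_int m + of_int n * tau a x"
  obtains y where "v \<noteq> 0" "Q a x m n > 0" "0 \<le> y" "y < Q a x m n" "Q a x m n dvd f y"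
    "(*) (inverse v) ` lat (tau a x) = lat (tau (Q a x m n) y)"
proof -
  define t where "t = tau a x"
  have Imt: "Im t > 0" using a(1) s2 by (simp add: t_def Im_tau)
  have v: "v = of_int m + of_int n * t" by (simp add: v_def t_def)
  have v0: "v \<noteq> 0"
  proof
    assume "v = 0"
    then have "of_int m + of_int n * t = of_int 0 + of_int 0 * t" by (simp add: v)
    then have "m = 0" "n = 0" using lat_eqI[of t m n 0 0] Imt by auto
    then show False using cop by simp
  qed
  obtain u w where uw: "u * m + w * n = 1" using bezout_int[of m n] cop by auto
  \<comment> \<open>The signs make the determinant of the pair (v, v') equal to u m + w n =
    1.\<close>
  define v' where "v' = of_int (- w) + of_int u * t"
  define \<sigma> where "\<sigma> = v' / v"
  have "Im (v' * cnj v) = of_int (u * m + w * n) * Im t" by (simp add: v'_def v algebra_simps)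
  then have "Im (v' * cnj v) = Im t" unfolding uw by simp
  then have Im\<sigma>: "Im \<sigma> = Im t / (cmod v)\<^sup>2"
    by (simp add: \<sigma>_def complex_div_cnj[of v' v] Im_divide_of_real)
  then have Im\<sigma>0: "Im \<sigma> > 0" using Imt v0 by simp
  have img: "(*) (inverse v) ` lat t = lat \<sigma>"
  proof (intro subset_antisym subsetI)
    fix z assume "z \<in> (*) (inverse v) ` lat t"
    then obtain p r where z: "z = inverse v * (of_int p + of_int r * t)" by (auto simp: lat_def)
    have "of_int (u * p + w * r) * v + of_int (m * r - n * p) * v' =
        of_int ((u * m + w * n) * p) + of_int ((u * m + w * n) * r) * t"
      by (simp add: v v'_def algebra_simps)
    then have "of_int p + of_int r * t = of_int (u * p + w * r) * v + of_int (m * r - n * p) * v'"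
      unfolding uw by simp
    then have "z = of_int (u * p + w * r) + of_int (m * r - n * p) * \<sigma>"
      unfolding z \<sigma>_def using v0 by (simp add: field_simps)
    then show "z \<in> lat \<sigma>" unfolding lat_def by blast
  next
    fix z assume "z \<in> lat \<sigma>"
    then obtain i j where "z = of_int i + of_int j * \<sigma>" by (auto simp: lat_def)
    then have "z = inverse v * (of_int i * v + of_int j * v')" using v0 by (simp add: \<sigma>_def field_simps)
    also have "of_int i * v + of_int j * v' = of_int (i * m - j * w) + of_int (i * n + j * u) * t"
      by (simp add: v v'_def algebra_simps)
    finally have z: "z = inverse v * (of_int (i * m - j * w) + of_int (i * n + j * u) * t)" .
    then show "z \<in> (*) (inverse v) ` lat t" unfolding lat_def by blast
  qed
  have st: "r * z \<in> lat \<sigma>" if "z \<in> lat \<sigma>" "r \<in> ZK" for r z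
  proof -
    obtain y where y: "y \<in> lat t" "z = inverse v * y" using \<open>z \<in> lat \<sigma>\<close> unfolding img[symmetric] by blast
    have "r * y \<in> lat t" using frac_lat[OF a] y(1) that(2) unfolding frac_def t_def by blast
    moreover have "r * z = inverse v * (r * y)" by (simp add: y(2))
    ultimately show ?thesis unfolding img[symmetric] by blast
  qed
  have "of_int 1 + of_int 0 * \<sigma> \<in> lat \<sigma>" "of_int 0 + of_int 1 * \<sigma> \<in> lat \<sigma>" unfolding lat_def by blast+
  then have "1 \<in> lat \<sigma>" "\<sigma> \<in> lat \<sigma>" by simp_all
  then have "\<omega> \<in> lat \<sigma>" "\<omega> * \<sigma> \<in> lat \<sigma>" using st[of 1 \<omega>] st[of \<sigma> \<omega>] ZK_omega by simp_all
  then obtain k e where ke: "k > 0" "k dvd f e" "\<sigma> = tau k e" using lat_stable[OF Im\<sigma>0] by blast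
  have "s / (2 * of_int k) = s / (2 * of_int a) / (cmod v)\<^sup>2"
    using Im\<sigma> unfolding ke(3) t_def Im_tau .
  then have "of_int k = of_int a * (cmod v)\<^sup>2" using s2 v0 a(1) ke(1) by (simp add: field_simps)
  then have "of_int k = (of_int (Q a x m n) :: real)" using cmod_lat[OF a, of m n] by (simp add: v_def)
  then have k: "k = Q a x m n" by simp
  have "[e mod k = e] (mod k)" by (simp add: cong_def)
  then have "k dvd f (e mod k)" using ke(2) fp_cong by blast
  then show ?thesis
    using that[of "e mod k"] v0 ke(1) img tau_mod[OF ke(1), of e] unfolding k[symmetric] ke(3) t_def by simp
qed

text \<open>Each generator lies in the other lattice. The imaginary parts make k and k' divide each
  other, and the real parts then fix y modulo k.\<close>

lemma lat_tau_eqD: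
  assumes "lat (tau k y) = lat (tau k' y')" "k > 0" "k' > 0"
  shows "k = k'" "[y = y'] (mod k)"
proof -
  have A: "\<exists>m n. k' = n * k \<and> y = y' - m * k \<and> n > 0"
    if eq: "lat (tau k y) = lat (tau k' y')" and pos: "k > 0" "k' > 0" for k k' y y'
  proof -
    have "of_int 0 + of_int 1 * tau k y \<in> lat (tau k y)" unfolding lat_def by blast
    then have "tau k y \<in> lat (tau k' y')" unfolding eq by simp
    then obtain m n where mn: "tau k y = of_int m + of_int n * tau k' y'" by (auto simp: lat_def)
    have "s / (2 * of_int k) = of_int n * (s / (2 * of_int k'))" using arg_cong[OF mn, of Im] by (simp add: Im_tau)
    then have "of_int k' = (of_int (n * k) :: real)" using s2 pos by (simp add: field_simps)
    then have k': "k' = n * k" by (simp only: of_int_eq_iff)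
    then have n: "n > 0" using pos by (metis zero_less_mult_pos2)
    have "(real q - 2 * of_int y) / (2 * of_int k) = of_int m + of_int n * ((real q - 2 * of_int y') / (2 * of_int k'))"
      using arg_cong[OF mn, of Re] by (simp add: Re_tau)
    also have "of_int n * ((real q - 2 * of_int y') / (2 * of_int k')) = (real q - 2 * of_int y') / (2 * of_int k)"
      unfolding k' using n by simp
    finally have "real q - 2 * of_int y = 2 * of_int (m * k) + (real q - 2 * of_int y')"
      using pos(1) by (simp add: field_simps)
    then have "of_int y = (of_int (y' - m * k) :: real)" by simp
    then have "y = y' - m * k" by (simp only: of_int_eq_iff)
    then show ?thesis using k' n by blast
  qed
  obtain m n where 1: "k' = n * k" "y = y' - m * k" "n > 0" using A[OF assms] by blast
  obtain n' where 2: "k = n' * k'" "n' > 0" using A[OF assms(1)[symmetric] assms(3,2)] by blast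
  show kk: "k = k'" using 1(1) 2(1) assms(2,3) by (metis dvd_triv_right zdvd_antisym_nonneg less_imp_le)
  show "[y = y'] (mod k)" using 1(2) by (simp add: cong_iff_dvd_diff)
qed

text \<open>u acts on the lattice by an integer matrix, so its characteristic polynomial makes u an
  algebraic integer. As s > 2, modulus 1 leaves no room for a nonzero coefficient of
  \<omega>.\<close>

lemma lattice_units:
  assumes u: "u \<in> K" "cmod u = 1" and im: "Im \<sigma> \<noteq> 0" and eq: "(*) u ` lat \<sigma> = lat \<sigma>"
  shows "u = 1 \<or> u = - 1"
proof -
  have "of_int 1 + of_int 0 * \<sigma> \<in> lat \<sigma>" "of_int 0 + of_int 1 * \<sigma> \<in> lat \<sigma>" unfolding lat_def by blast+
  then have "1 \<in> lat \<sigma>" "\<sigma> \<in> lat \<sigma>" by simp_all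
  then have "u * 1 \<in> (*) u ` lat \<sigma>" "u * \<sigma> \<in> (*) u ` lat \<sigma>" by (blast intro: imageI)+
  then have "u \<in> lat \<sigma>" "u * \<sigma> \<in> lat \<sigma>" unfolding eq by simp_all
  then obtain a b c' d where ab: "u = of_int a + of_int b * \<sigma>" and cd: "u * \<sigma> = of_int c' + of_int d * \<sigma>"
    by (auto simp: lat_def)
  have "algebraic_int u"
  proof (rule algebraic_int.intros[of "[: of_int (a * d - b * c'), - of_int (a + d), 1 :]"])
    have "u * u - of_int (a + d) * u + of_int (a * d - b * c') =
        (of_int b * (u * \<sigma> - of_int c' - of_int d * \<sigma>)) + (u - of_int a - of_int b * \<sigma>) * (u - of_int d)"
      by (simp add: algebra_simps)
    also have "\<dots> = 0" using ab cd by simp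
    finally show "poly [: of_int (a * d - b * c'), - of_int (a + d), 1 :] u = 0"
      by (simp add: algebra_simps)
  qed (auto simp: Polynomial.coeff_pCons split: nat.splits)
  then obtain m n where mn: "u = el m n" using algebraic_int_el u(1) by blast
  have "\<bar>of_int n * s / 2\<bar> \<le> 1" using abs_Im_le_cmod[of u] u(2) by (simp add: mn Im_el)
  then have "\<bar>of_int n\<bar> * s \<le> 2" using s2 by (simp add: abs_mult)
  have "n = 0"
  proof (rule ccontr)
    assume "n \<noteq> 0"
    then have "1 \<le> \<bar>real_of_int n\<bar>" by linarith
    then have "1 * s \<le> \<bar>of_int n\<bar> * s" using s2 by (intro mult_right_mono) auto
    then show False using \<open>\<bar>of_int n\<bar> * s \<le> 2\<close> s2 by linarith
  qed
  then have um: "u = of_int m" by (simp add: mn el_def)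
  then have "\<bar>of_int m\<bar> = (1::real)" using u(2) by simp
  then have "m = 1 \<or> m = - 1" by linarith
  then show ?thesis using um by auto
qed

definition is_transversal :: "(int \<times> int) set \<Rightarrow> bool" where
  "is_transversal T \<longleftrightarrow> finite T \<and> card T = class_number K \<and>
     (\<forall>(a, x) \<in> T. a > 0 \<and> a dvd f x \<and> \<bar>int q - 2 * x\<bar> \<le> a \<and> a * a \<le> f x) \<and>
     inj_on (\<lambda>(a, x). cls (lat (tau a x))) T \<and> (\<lambda>(a, x). cls (lat (tau a x))) ` T = cls ` Collect frac"

lemma transversalD:
  assumes "is_transversal T"
  shows "finite T" "card T = class_number K"
    "\<And>a x. (a, x) \<in> T \<Longrightarrow> a > 0 \<and> a dvd f x \<and> \<bar>int q - 2 * x\<bar> \<le> a \<and> a * a \<le> f x"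
    "inj_on (\<lambda>(a, x). cls (lat (tau a x))) T"
    "(\<lambda>(a, x). cls (lat (tau a x))) ` T = cls ` Collect frac"
proof -
  note D = assms[unfolded is_transversal_def]
  show "finite T" using D by (elim conjE)
  show "card T = class_number K" using D by (elim conjE)
  show "inj_on (\<lambda>(a, x). cls (lat (tau a x))) T" using D by (elim conjE)
  show "(\<lambda>(a, x). cls (lat (tau a x))) ` T = cls ` Collect frac" using D by (elim conjE)
  fix a x assume ax: "(a, x) \<in> T"
  have "\<forall>(a, x) \<in> T. a > 0 \<and> a dvd f x \<and> \<bar>int q - 2 * x\<bar> \<le> a \<and> a * a \<le> f x" using D by (elim conjE)
  from bspec[OF this ax] show "a > 0 \<and> a dvd f x \<and> \<bar>int q - 2 * x\<bar> \<le> a \<and> a * a \<le> f x" by simp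
qed

text \<open>The reduced pairs are finite in number, since 3 a^2 <= q, and meet every class. Pairs on
  the boundary, such as \<open>\<bar>int q - 2 * x\<bar> = a\<close>, may share a class, so a subset
  on which the class map is injective is selected.\<close>

lemma transversal_exists: "\<exists>T. is_transversal T"
proof -
  define R where "R = (\<lambda>(a, x). a > 0 \<and> a dvd f x \<and> \<bar>int q - 2 * x\<bar> \<le> a \<and> a * a \<le> f x)"
  define h where "h = (\<lambda>(a, x). cls (lat (tau a x)))"
  have fin: "finite (Collect R)"
  proof (rule finite_subset)
    show "Collect R \<subseteq> {0..int q} \<times> {- int q..int q}"
    proof
      fix z assume "z \<in> Collect R"
      then obtain a x where z: "z = (a, x)" "a > 0" "\<bar>int q - 2 * x\<bar> \<le> a" "a * a \<le> f x" by (auto simp: R_def)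
      have "4 * (a * a) \<le> (int q - 2 * x) ^ 2 + int q" using fp_eq[OF q_mod, of x] z(4) by (simp add: power2_commute)
      moreover have "(int q - 2 * x) ^ 2 \<le> a * a"
        using z(2,3) by (metis abs_le_square_iff abs_of_pos power2_eq_square)
      ultimately have "3 * (a * a) \<le> int q" by simp
      moreover have "a * 1 \<le> a * a" using z(2) by (intro mult_left_mono) auto
      ultimately have "a \<le> int q" using z(2) by linarith
      then show "z \<in> {0..int q} \<times> {- int q..int q}" using z by auto
    qed
  qed simp
  have im: "h ` Collect R = cls ` Collect frac"
  proof (intro subset_antisym subsetI)
    fix C assume "C \<in> h ` Collect R"
    then show "C \<in> cls ` Collect frac" using frac_lat by (auto simp: h_def R_def)
  next
    fix C assume "C \<in> cls ` Collect frac"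
    then obtain I where I: "frac I" "C = cls I" by blast
    obtain z a x where "z \<in> K" "z \<noteq> 0" "a > 0" "a dvd f x" "(*) z ` I = lat (tau a x)"
        "\<bar>int q - 2 * x\<bar> \<le> a" "a * a \<le> f x" using frac_reduced[OF I(1)] by metis
    then have "R (a, x)" "h (a, x) = C" using cls_scale[of z I] I(2) by (auto simp: R_def h_def)
    then show "C \<in> h ` Collect R" by blast
  qed
  have "\<exists>T\<subseteq>Collect R. inj_on h T \<and> h ` Collect R = h ` T"
    using subset_image_inj[of "h ` Collect R" h "Collect R"] by blast
  then obtain T where T: "T \<subseteq> Collect R" "inj_on h T" "h ` T = h ` Collect R" by (metis (full_types))
  have "is_transversal T"
    unfolding is_transversal_def class_number_eq im[symmetric] T(3)[symmetric] h_def[symmetric]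
    using T(1,2) finite_subset[OF T(1) fin] card_image[OF T(2)] by (auto simp: R_def)
  then show ?thesis by blast
qed

text \<open>A root y of \<open>f\<close> modulo k gives a lattice in the class of exactly one
  representative; it arises from two primitive representations there, v and -v.\<close>

lemma transversal_count:
  assumes T: "is_transversal T" and k: "k > 0"
  shows "card {((a, x), m, n). (a, x) \<in> T \<and> coprime m n \<and> Q a x m n = int k} = 2 * rho (int q) k"
proof -
  define A where "A = {((a, x), m, n). (a, x) \<in> T \<and> coprime m n \<and> Q a x m n = int k}"
  define B where "B = {y \<in> {0..<int k}. int k dvd f y}"
  define V where "V = (\<lambda>((a, x), m, n). of_int m + of_int n * tau a x)"
  define Lt where "Lt = (\<lambda>((a, x), m::int, n::int). lat (tau a x))"
  define P where "P = (\<lambda>y t. t \<in> A \<and> (*) (inverse (V t)) ` Lt t = lat (tau (int k) y))"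
  have TA: "a > 0" "a dvd f x" if ax: "(a, x) \<in> T" for a x
    using transversalD(3)[OF T ax] by simp_all
  have V0: "V t \<noteq> 0" if tA: "t \<in> A" for t
  proof -
    obtain a x m n where t: "t = ((a, x), m, n)" "(a, x) \<in> T" "coprime m n" using tA unfolding A_def by blast
    have "of_int m + of_int n * tau a x \<noteq> 0" using rescaled_lattice[OF TA[OF t(2)] t(3)] by blast
    then show ?thesis by (simp add: V_def t(1))
  qed
  have ex1: "\<exists>y\<in>B. P y t" if tA: "t \<in> A" for t
  proof -
    obtain a x m n where t: "t = ((a, x), m, n)" "(a, x) \<in> T" "coprime m n" "Q a x m n = int k" using tA unfolding A_def by blast
    have Vt: "V t = of_int m + of_int n * tau a x" by (simp add: V_def t(1))
    note R = rescaled_lattice[OF TA[OF t(2)] t(3), unfolded t(4), folded Vt]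
    obtain y where y: "0 \<le> y" "y < int k" "int k dvd f y"
      "(*) (inverse (V t)) ` lat (tau a x) = lat (tau (int k) y)"
      by (rule R)
    have "Lt t = lat (tau a x)" by (simp add: Lt_def t(1))
    then have "P y t" using tA y(4) by (simp add: P_def)
    then show ?thesis using y by (intro bexI[of _ y]) (simp_all add: B_def)
  qed
  \<comment> \<open>The scaled representative contains 1, so 1 = z v for a vector v of the
    representative. A common factor g of the coordinates of v would put 1/g into
    \<open>lat (tau (int k) y)\<close>, which forces g to be a unit.\<close>
  have ex2: "\<exists>t. P y t" if y: "y \<in> B" for y
  proof -
    have yk: "int k dvd f y" using y by (simp add: B_def)
    have k0: "int k > 0" using k by simp
    have "cls (lat (tau (int k) y)) \<in> cls ` Collect frac" using frac_lat[OF k0 yk] by blast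
    then obtain a x where ax: "(a, x) \<in> T" "cls (lat (tau a x)) = cls (lat (tau (int k) y))"
      unfolding transversalD(5)[OF T, symmetric] by (force simp: image_iff)
    obtain z where z: "z \<in> K" "z \<noteq> 0" "lat (tau (int k) y) = (*) z ` lat (tau a x)"
      using cls_eqD[OF ax(2)] by blast
    have "of_int 1 + of_int 0 * tau (int k) y \<in> lat (tau (int k) y)" unfolding lat_def by blast
    then have "1 \<in> (*) z ` lat (tau a x)" unfolding z(3) by simp
    then obtain m n where mn: "1 = z * (of_int m + of_int n * tau a x)" by (auto simp: lat_def)
    define v where "v = of_int m + of_int n * tau a x"
    have v: "z = inverse v" using mn z(2) by (simp add: v_def inverse_unique mult.commute)
    have cop: "coprime m n"
    proof (rule coprimeI)
      fix g assume g: "g dvd m" "g dvd n"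
      then obtain m' n' where mn': "m = g * m'" "n = g * n'" by blast
      have "g \<noteq> 0" using mn mn' by auto
      have "of_int m' + of_int n' * tau a x \<in> lat (tau a x)" unfolding lat_def by blast
      then have "z * (of_int m' + of_int n' * tau a x) \<in> lat (tau (int k) y)" unfolding z(3) by blast
      moreover have "of_int g * (z * (of_int m' + of_int n' * tau a x)) = 1"
        unfolding mn mn' by (simp add: algebra_simps)
      ultimately obtain i j where ij: "of_int g * (of_int i + of_int j * tau (int k) y) = 1" by (auto simp: lat_def)
      then have "of_int (g * i) + of_int (g * j) * tau (int k) y = of_int 1 + of_int 0 * tau (int k) y"
        by (simp add: algebra_simps)
      moreover have "Im (tau (int k) y) \<noteq> 0" using s2 k0 by (simp add: Im_tau)
      ultimately have "g * i = 1" using lat_eqI(1) by blast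
      then show "is_unit g" by (metis dvd_triv_left)
    qed
    obtain y' where y': "Q a x m n > 0" "(*) (inverse v) ` lat (tau a x) = lat (tau (Q a x m n) y')"
      using rescaled_lattice[OF TA[OF ax(1)] cop] unfolding v_def by blast
    have "lat (tau (int k) y) = lat (tau (Q a x m n) y')" using z(3) y'(2) v by simp
    then have "Q a x m n = int k" using lat_tau_eqD(1)[OF _ k0 y'(1)] by metis
    then have "P y ((a, x), m, n)" using ax(1) cop z(3) v by (simp add: P_def A_def V_def Lt_def v_def)
    then show ?thesis by blast
  qed
  have uniq_y: "y = y'" if "P y t" "P y' t" "y \<in> B" "y' \<in> B" for y y' t
    using that lat_tau_eqD(2)[of "int k" y "int k" y'] k by (auto simp: P_def B_def cong_def)
  have cmodV: "of_int (fst (fst t)) * (cmod (V t))\<^sup>2 = real k" if "t \<in> A" for t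
    using that cmod_lat TA by (fastforce simp: A_def V_def)
  \<comment> \<open>Two representations with the same root belong to the same representative and
    differ by a number of modulus 1 that preserves its lattice, hence by a sign.\<close>
  have fiber: "fst t' = fst t \<and> (snd t' = snd t \<or> snd t' = (- fst (snd t), - snd (snd t)))"
    if P: "P y t" "P y t'" for y t t'
  proof -
    obtain a x m n where t: "t = ((a, x), m, n)" "(a, x) \<in> T" using P(1) by (auto simp: P_def A_def)
    obtain a' x' m' n' where t': "t' = ((a', x'), m', n')" "(a', x') \<in> T" using P(2) by (auto simp: P_def A_def)
    have tA: "t \<in> A" "t' \<in> A" using P by (auto simp: P_def)
    have VK: "V t \<in> K" "V t' \<in> K"
      using frac_lat[OF TA[OF t(2)]] frac_lat[OF TA[OF t'(2)]] unfolding frac_def t(1) t'(1) V_def lat_def by auto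
    have eq: "(*) (inverse (V t)) ` lat (tau a x) = (*) (inverse (V t')) ` lat (tau a' x')"
      using P by (simp add: P_def Lt_def t t')
    have "cls (lat (tau a x)) = cls (lat (tau a' x'))"
      using cls_scale[of "inverse (V t)" "lat (tau a x)"] cls_scale[of "inverse (V t')" "lat (tau a' x')"]
        eq VK V0[OF tA(1)] V0[OF tA(2)] K_inverse by simp
    then have same: "(a, x) = (a', x')"
      using inj_onD[OF transversalD(4)[OF T] _ t(2) t'(2)] by simp
    define u where "u = V t' * inverse (V t)"
    have "(*) (V t') ` ((*) (inverse (V t)) ` lat (tau a x)) = (*) (V t') ` ((*) (inverse (V t')) ` lat (tau a x))"
      using eq same by simp
    then have "(*) u ` lat (tau a x) = lat (tau a x)"
      using V0[OF tA(2)] by (simp add: image_image u_def flip: mult.assoc)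
    moreover have "cmod u = 1"
    proof -
      have "(cmod (V t'))\<^sup>2 = (cmod (V t))\<^sup>2"
      proof -
        have "of_int a * (cmod (V t'))\<^sup>2 = real k" using cmodV[OF tA(2)] same unfolding t'(1) by simp
        moreover have "of_int a * (cmod (V t))\<^sup>2 = real k" using cmodV[OF tA(1)] unfolding t(1) by simp
        ultimately have "of_int a * (cmod (V t'))\<^sup>2 = of_int a * (cmod (V t))\<^sup>2" by linarith
        then show ?thesis using TA(1)[OF t(2)] by simp
      qed
      then have "cmod (V t') = cmod (V t)" by (metis norm_ge_zero power2_eq_iff_nonneg)
      then show ?thesis using V0[OF tA(1)] by (simp add: u_def norm_mult norm_inverse)
    qed
    moreover have "u \<in> K" unfolding u_def by (intro K_mult K_inverse VK)
    moreover have Im0: "Im (tau a x) \<noteq> 0" using s2 TA(1)[OF t(2)] by (simp add: Im_tau)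
    ultimately have "u = 1 \<or> u = - 1" using lattice_units by blast
    then have "u * V t = V t \<or> u * V t = - V t" by auto
    moreover have "u * V t = V t'" using V0[OF tA(1)] by (simp add: u_def)
    ultimately have "V t' = V t \<or> V t' = - V t" by simp
    then have "of_int m' + of_int n' * tau a x = of_int m + of_int n * tau a x \<or>
        of_int m' + of_int n' * tau a x = of_int (- m) + of_int (- n) * tau a x"
      using same by (auto simp: V_def t t')
    then have "(m' = m \<and> n' = n) \<or> (m' = - m \<and> n' = - n)" using lat_eqI[OF Im0] by blast
    then show ?thesis using same by (auto simp: t t')
  qed
  define g where "g = (\<lambda>y. SOME t. P y t)"
  have g: "P y (g y)" if "y \<in> B" for y unfolding g_def by (rule someI_ex[OF ex2[OF that]])
  define h where "h = (\<lambda>(y, \<epsilon>::int). (fst (g y), \<epsilon> * fst (snd (g y)), \<epsilon> * snd (snd (g y))))"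
  have gA: "h (y, \<epsilon>) \<in> A \<and> P y (h (y, \<epsilon>))" if "y \<in> B" "\<epsilon> = 1 \<or> \<epsilon> = - 1" for y \<epsilon>
  proof -
    obtain a x m n where t: "g y = ((a, x), m, n)" by (metis surj_pair)
    have Pg: "P y ((a, x), m, n)" using g[OF that(1)] t by simp
    have "V ((a, x), - m, - n) = - V ((a, x), m, n)" by (simp add: V_def)
    moreover have "(*) (- z) ` lat \<sigma> = (*) z ` lat \<sigma>" for z \<sigma>
    proof -
      have neg: "- w \<in> lat \<sigma>" if w: "w \<in> lat \<sigma>" for w
      proof -
        obtain i j where "w = of_int i + of_int j * \<sigma>" using w by (auto simp: lat_def)
        then have "- w = of_int (- i) + of_int (- j) * \<sigma>" by simp
        then show ?thesis unfolding lat_def by blast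
      qed
      show ?thesis
      proof (intro subset_antisym subsetI)
        fix w assume "w \<in> (*) (- z) ` lat \<sigma>"
        then obtain r where "r \<in> lat \<sigma>" "w = z * (- r)" by auto
        then show "w \<in> (*) z ` lat \<sigma>" using neg by blast
      next
        fix w assume "w \<in> (*) z ` lat \<sigma>"
        then obtain r where "r \<in> lat \<sigma>" "w = (- z) * (- r)" by auto
        then show "w \<in> (*) (- z) ` lat \<sigma>" using neg by blast
      qed
    qed
    ultimately have "P y ((a, x), - m, - n)" using Pg by (auto simp: P_def A_def Lt_def Q_def)
    moreover have "h (y, \<epsilon>) = ((a, x), m, n) \<or> h (y, \<epsilon>) = ((a, x), - m, - n)" using that(2) by (auto simp: h_def t)
    ultimately have "P y (h (y, \<epsilon>))" using Pg by metis
    then show ?thesis by (simp add: P_def)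
  qed
  have "bij_betw h (B \<times> {1, - 1}) A"
  proof (rule bij_betwI')
    fix u v :: "int \<times> int" assume uv: "u \<in> B \<times> {1, - 1}" "v \<in> B \<times> {1, - 1}"
    obtain y \<epsilon> y' \<epsilon>' where u: "u = (y, \<epsilon>)" "v = (y', \<epsilon>')" by (metis surj_pair)
    have B: "y \<in> B" "y' \<in> B" "\<epsilon> = 1 \<or> \<epsilon> = - 1" "\<epsilon>' = 1 \<or> \<epsilon>' = - 1" using uv u by auto
    show "(h u = h v) = (u = v)"
    proof
      assume eq: "h u = h v"
      have "y = y'" using uniq_y[of y "h u" y'] gA[OF B(1,3)] gA[OF B(2,4)] B eq u by auto
      moreover have "g y \<in> A" using g[OF B(1)] by (simp add: P_def)
      then have "snd (g y) \<noteq> (0, 0)" by (auto simp: A_def)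
      ultimately show "u = v" using eq B(3,4) by (auto simp: h_def u prod_eq_iff)
    qed simp
  next
    fix u :: "int \<times> int" assume "u \<in> B \<times> {1, - 1}"
    then show "h u \<in> A" using gA by auto
  next
    fix t assume t: "t \<in> A"
    obtain y where y: "y \<in> B" "P y t" using ex1[OF t] by blast
    have "fst t = fst (g y) \<and> (snd t = snd (g y) \<or> snd t = (- fst (snd (g y)), - snd (snd (g y))))"
      using fiber[OF g[OF y(1)] y(2)] .
    then have "t = h (y, 1) \<or> t = h (y, - 1)" by (auto simp: h_def prod_eq_iff)
    then show "\<exists>u\<in>B \<times> {1, - 1}. t = h u" using y(1) by blast
  qed
  then have "card (B \<times> {1, - 1 :: int}) = card A" by (rule bij_betw_same_card)
  then show ?thesis by (simp add: A_def B_def rho_def card_cartesian_product)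
qed

end

section \<open>Dirichlet series and the Riemann zeta function\<close>

lemma holomorphic_series:
  fixes f :: "nat \<Rightarrow> complex \<Rightarrow> complex"
  assumes S: "open S" and f: "\<And>n. f n holomorphic_on S"
    and M: "\<And>x. x \<in> S \<Longrightarrow> \<exists>d>0. \<exists>M. cball x d \<subseteq> S \<and> summable M \<and> (\<forall>n. \<forall>y\<in>cball x d. norm (f n y) \<le> M n)"
  shows "(\<lambda>s. \<Sum>n. f n s) holomorphic_on S" "\<And>s. s \<in> S \<Longrightarrow> summable (\<lambda>n. f n s)"
proof -
  show "(\<lambda>s. \<Sum>n. f n s) holomorphic_on S"
  proof (rule holomorphic_uniform_sequence[OF S])
    show "(\<lambda>s. \<Sum>i<n. f i s) holomorphic_on S" for n by (intro holomorphic_intros f)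
    fix x assume "x \<in> S"
    then obtain d M where d: "d > 0" "cball x d \<subseteq> S" "summable M" "\<And>n y. y \<in> cball x d \<Longrightarrow> norm (f n y) \<le> M n"
      using M by meson
    have "uniform_limit (cball x d) (\<lambda>n s. \<Sum>i<n. f i s) (\<lambda>s. \<Sum>i. f i s) sequentially"
      by (rule Weierstrass_m_test) (use d in auto)
    then show "\<exists>d>0. cball x d \<subseteq> S \<and> uniform_limit (cball x d) (\<lambda>n s. \<Sum>i<n. f i s) (\<lambda>s. \<Sum>i. f i s) sequentially"
      using d by blast
  qed
  show "summable (\<lambda>n. f n s)" if sS: "s \<in> S" for s
  proof -
    obtain d M where d: "d > 0" "summable M" "\<And>n y. y \<in> cball s d \<Longrightarrow> norm (f n y) \<le> M n"
      using M[OF sS] by meson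
    show ?thesis by (rule summable_comparison_test'[OF d(2), of 0]) (use d in auto)
  qed
qed

lemma norm_of_nat_powr: "n > 0 \<Longrightarrow> norm ((of_nat n :: complex) powr s) = real n powr Re s"
  by (simp add: norm_powr_real_powr)

lemma powr_has_field_derivative:
  assumes "Re t > 0"
  shows "((\<lambda>t. c * t powr a) has_field_derivative c * a * t powr (a - 1)) (at t within S)"
proof -
  have "t \<notin> \<real>\<^sub>\<le>\<^sub>0" using assms by (auto simp: complex_nonpos_Reals_iff)
  then have "((\<lambda>t. c * t powr a) has_field_derivative c * (a * t powr (a - 1))) (at t within S)"
    by (intro DERIV_cmult has_field_derivative_at_within[OF has_field_derivative_powr])
  then show ?thesis by (simp add: mult.assoc)
qed

text \<open>Taylor's formula on the segment from n to n + 1. The hypothesis on \<open>Re a\<close>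
  makes the exponent of the derivative of order J + 1 nonpositive, so this derivative is largest at
  n; the factorial in the remainder is estimated by 1.\<close>

lemma powr_Taylor:
  assumes n: "n > 0" and a: "Re a \<le> real J + 1"
  shows "norm (of_nat (Suc n) powr a - (\<Sum>j\<le>J. (a gchoose j) * of_nat n powr (a - of_nat j)))
       \<le> norm (\<Prod>l\<le>J. a - of_nat l) * real n powr (Re a - real J - 1)"
proof -
  define g where "g = (\<lambda>i t. (\<Prod>l<i. a - of_nat l) * t powr (a - of_nat i))"
  define B where "B = norm (\<Prod>l\<le>J. a - of_nat l) * real n powr (Re a - real J - 1)"
  define S where "S = closed_segment (of_nat n :: complex) (of_nat (Suc n))"
  have S: "\<exists>r. t = of_real r \<and> r \<ge> real n" if tS: "t \<in> S" for t
  proof -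
    obtain u where "0 \<le> u" "t = (1 - u) *\<^sub>R of_nat n + u *\<^sub>R of_nat (Suc n)"
      using tS unfolding S_def closed_segment_def by blast
    then show ?thesis by (intro exI[of _ "real n + u"]) (auto simp: scaleR_conv_of_real algebra_simps)
  qed
  have 1: "(g i has_field_derivative g (Suc i) t) (at t within S)" if "t \<in> S" for i t
  proof -
    have "Re t > 0" using S[OF that] n by auto
    from powr_has_field_derivative[OF this, of "\<Prod>l<i. a - of_nat l" "a - of_nat i" S]
    show ?thesis by (simp add: g_def algebra_simps)
  qed
  have 2: "norm (g (Suc J) t) \<le> B" if tS: "t \<in> S" for t
  proof -
    obtain r where r: "t = of_real r" "r \<ge> real n" using S[OF tS] by blast
    have "norm (t powr (a - of_nat (Suc J))) = r powr (Re a - real J - 1)"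
      using r n by (simp add: norm_powr_real_powr algebra_simps)
    also have "\<dots> \<le> real n powr (Re a - real J - 1)"
      using r n a by (intro powr_mono2') auto
    finally show ?thesis unfolding g_def B_def norm_mult lessThan_Suc_atMost
      by (intro mult_left_mono) auto
  qed
  have "norm (g 0 (of_nat (Suc n)) - (\<Sum>i\<le>J. g i (of_nat n) * (of_nat (Suc n) - of_nat n) ^ i / fact i))
      \<le> B * norm (of_nat (Suc n) - of_nat n :: complex) ^ Suc J / fact J"
  proof (rule complex_Taylor[where S = S and B = B])
    show "convex S" "complex_of_nat n \<in> S" "complex_of_nat (Suc n) \<in> S" by (simp_all add: S_def del: of_nat_Suc)
  qed (use 1 2 in auto)
  moreover have "g i (of_nat n) * (of_nat (Suc n) - of_nat n) ^ i / fact i = (a gchoose i) * of_nat n powr (a - of_nat i)" for i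
    by (simp add: g_def gbinomial_prod_rev atLeast0LessThan)
  moreover have "B * norm (of_nat (Suc n) - of_nat n :: complex) ^ Suc J / fact J \<le> B"
  proof -
    have "B \<ge> 0" by (simp add: B_def)
    moreover have "fact J \<ge> (1::real)" by (rule fact_ge_1)
    ultimately have "B * 1 \<le> B * fact J" by (intro mult_left_mono)
    then show ?thesis by (simp add: divide_le_eq)
  qed
  ultimately show ?thesis unfolding B_def g_def by simp
qed

section \<open>Continuation of the zeta function\<close>

lemma summable_powr:
  assumes "e < - 1" shows "summable (\<lambda>n. real (Suc n) powr e)"
  using assms summable_real_powr_iff[of e] summable_Suc_iff[of "\<lambda>n. real n powr e"] by simp

lemma powr_summable_complex:
  assumes "Re s > 1" shows "summable (\<lambda>n. norm ((of_nat (Suc n) :: complex) powr (- s)))"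
  using summable_powr[of "- Re s"] assms by (simp add: norm_of_nat_powr del: of_nat_Suc)

lemma halfplane_cball:
  assumes "Re x > c"
  shows "\<exists>d>0. cball x d \<subseteq> {s. Re s > c} \<and> (\<forall>y\<in>cball x d. Re y \<ge> c + d)"
proof -
  define d where "d = (Re x - c) / 2"
  have "d > 0" using assms by (simp add: d_def)
  moreover have "Re y \<ge> c + d" if "y \<in> cball x d" for y
  proof -
    have "\<bar>Re (x - y)\<bar> \<le> d" using abs_Re_le_cmod[of "x - y"] that by (simp add: dist_norm)
    moreover have "d + d = Re x - c" unfolding d_def by (rule field_sum_of_halves)
    ultimately show ?thesis by simp
  qed
  moreover have "cball x d \<subseteq> {s. Re s > c}"
  proof
    fix y assume "y \<in> cball x d"
    then have "Re y \<ge> c + d" by fact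
    then show "y \<in> {s. Re s > c}" using \<open>d > 0\<close> by simp
  qed
  ultimately show ?thesis by blast
qed

lemma open_halfplane: "open {s. Re s > c}"
  by (rule open_halfspace_Re_gt)

lemma connected_halfplane: "connected {s. Re s > c}"
  by (intro convex_connected convex_halfspace_Re_gt)

text \<open>The Taylor remainder of (n + 2)^(1 - s) around n + 1. It has order n^(-Re s - J), so
  that the sum over n converges for Re s > 1 - J.\<close>

definition zrem :: "nat \<Rightarrow> nat \<Rightarrow> complex \<Rightarrow> complex" where
  "zrem J n s = of_nat (Suc (Suc n)) powr (1 - s) -
     (\<Sum>j\<le>J. ((1 - s) gchoose j) * of_nat (Suc n) powr (1 - s - of_nat j))"

lemma gbinomial_holomorphic [holomorphic_intros]:
  "f holomorphic_on S \<Longrightarrow> (\<lambda>s. f s gchoose j) holomorphic_on S"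
  unfolding gbinomial_prod_rev by (intro holomorphic_intros) auto

lemma zrem_holomorphic:
  "(\<lambda>s. \<Sum>n. zrem J n s) holomorphic_on {s. Re s > 1 - real J}" (is ?A)
  "Re s > 1 - real J \<Longrightarrow> summable (\<lambda>n. zrem J n s)"
proof -
  have B: "\<exists>d>0. \<exists>M. cball x d \<subseteq> {s. Re s > 1 - real J} \<and> summable M \<and> (\<forall>n. \<forall>y\<in>cball x d. norm (zrem J n y) \<le> M n)"
    if x: "x \<in> {s. Re s > 1 - real J}" for x
  proof -
    have "Re x > 1 - real J" using x by simp
    then obtain d where d: "d > 0" "cball x d \<subseteq> {s. Re s > 1 - real J}"
      "\<forall>y\<in>cball x d. Re y \<ge> 1 - real J + d" using halfplane_cball by blast
    have "continuous_on (cball x d) (\<lambda>s. \<Prod>l\<le>J. (1 - s) - of_nat l)" by (intro continuous_intros)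
    then have "compact ((\<lambda>s. \<Prod>l\<le>J. (1 - s) - of_nat l) ` cball x d)" by (rule compact_continuous_image) simp
    then have "bounded ((\<lambda>s. \<Prod>l\<le>J. (1 - s) - of_nat l) ` cball x d)" by (rule compact_imp_bounded)
    then obtain C where "\<forall>z\<in>(\<lambda>s. \<Prod>l\<le>J. (1 - s) - of_nat l) ` cball x d. norm z \<le> C" unfolding bounded_iff ..
    then have C: "norm (\<Prod>l\<le>J. (1 - s) - of_nat l) \<le> C" if "s \<in> cball x d" for s using that by (rule bspec[OF _ imageI])
    have C0: "C \<ge> 0" using order_trans[OF norm_ge_zero C[of x]] d(1) by simp
    have "norm (zrem J n y) \<le> C * real (Suc n) powr (- 1 - d)" if y: "y \<in> cball x d" for n y
    proof -
      have R: "Re y \<ge> 1 - real J + d" using bspec[OF d(3) y] .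
      have "norm (zrem J n y) \<le> norm (\<Prod>l\<le>J. (1 - y) - of_nat l) * real (Suc n) powr (Re (1 - y) - real J - 1)"
        unfolding zrem_def using R d(1) by (intro powr_Taylor) auto
      also have "\<dots> \<le> C * real (Suc n) powr (- 1 - d)"
        using C[OF y] C0 R by (intro mult_mono powr_mono) auto
      finally show ?thesis .
    qed
    moreover have "summable (\<lambda>n. C * real (Suc n) powr (- 1 - d))"
      using d(1) by (intro summable_mult summable_powr) simp
    ultimately show ?thesis using d(1,2) by blast
  qed
  have hol: "zrem J n holomorphic_on {s. Re s > 1 - real J}" for n
    unfolding zrem_def by (intro holomorphic_intros)
  show ?A using holomorphic_series(1)[OF open_halfplane hol B] by blast
  show "Re s > 1 - real J \<Longrightarrow> summable (\<lambda>n. zrem J n s)"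
    using holomorphic_series(2)[OF open_halfplane hol B] by blast
qed

lemma zeta_series_holomorphic:
  "(\<lambda>s. \<Sum>n. of_nat (Suc n) powr (- s)) holomorphic_on {s :: complex. Re s > 1}"
proof (rule holomorphic_series(1)[OF open_halfplane])
  show "(\<lambda>s. of_nat (Suc n) powr (- s)) holomorphic_on {s :: complex. Re s > 1}" for n
    by (intro holomorphic_intros)
  fix x :: complex assume "x \<in> {s. Re s > 1}"
  then have "Re x > 1" by simp
  then obtain d where d: "d > 0" "cball x d \<subseteq> {s. Re s > 1}" "\<forall>y\<in>cball x d. Re y \<ge> 1 + d"
    using halfplane_cball by blast
  have "norm (of_nat (Suc n) powr (- y)) \<le> real (Suc n) powr (- 1 - d)" if "y \<in> cball x d" for n and y :: complex
    unfolding norm_of_nat_powr[OF zero_less_Suc] using bspec[OF d(3) that] by (intro powr_mono) auto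
  then show "\<exists>d>0. \<exists>M. cball x d \<subseteq> {s. Re s > 1} \<and> summable M \<and>
      (\<forall>n. \<forall>y\<in>cball x d. norm (of_nat (Suc n) powr (- y)) \<le> M n)"
    using d(1,2) summable_powr[of "- 1 - d"] by (intro exI[of _ d] conjI exI[of _ "\<lambda>n. real (Suc n) powr (- 1 - d)"]) auto
qed

lemma powr_tendsto_0:
  assumes "Re a < 0" shows "(\<lambda>n. (of_nat (Suc n) :: complex) powr a) \<longlonglongrightarrow> 0"
proof (rule tendsto_norm_zero_cancel)
  have "(\<lambda>n. real n powr Re a) \<longlonglongrightarrow> 0"
    using assms by (intro tendsto_neg_powr filterlim_real_sequentially)
  then have "(\<lambda>n. real (Suc n) powr Re a) \<longlonglongrightarrow> 0" by (rule LIMSEQ_Suc)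
  then show "(\<lambda>n. norm ((of_nat (Suc n) :: complex) powr a)) \<longlonglongrightarrow> 0"
    by (simp add: norm_of_nat_powr del: of_nat_Suc)
qed

text \<open>
  Summing the Taylor expansion of \<open>(n+1)\<^bsup>1-s\<^esup> - n\<^bsup>1-s\<^esup>\<close> over \<open>n\<close> expresses \<open>(s-1)\<zeta>(s)\<close> through the
  values \<open>(s+i-1)\<zeta>(s+i)\<close> with \<open>i \<ge> 1\<close> and a remainder that converges further to the left.
\<close>

lemma zeta_recursion:
  assumes s: "Re s > 1"
  defines "Z \<equiv> \<lambda>s. (s - 1) * (\<Sum>n. of_nat (Suc n) powr (- s))"
  shows "Z s = 1 - (\<Sum>i\<in>{1..J}. ((1 - s) gchoose i) / of_nat (Suc i) * Z (s + of_nat i)) + (\<Sum>n. zrem (Suc J) n s)"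
proof -
  define t where "t = (\<lambda>s. \<Sum>n. (of_nat (Suc n) :: complex) powr (- s))"
  have sm: "(\<lambda>n. (of_nat (Suc n) :: complex) powr (- (s + of_nat i))) sums t (s + of_nat i)" for i
  proof -
    have "Re (s + of_nat i) > 1" using s by (simp add: add_strict_increasing)
    then show ?thesis unfolding t_def by (intro summable_sums summable_norm_cancel[OF powr_summable_complex])
  qed
  have rem: "(\<lambda>n. zrem (Suc J) n s) sums (\<Sum>n. zrem (Suc J) n s)"
    using s by (intro summable_sums zrem_holomorphic(2)) auto
  have "(\<lambda>n. of_nat (Suc (Suc n)) powr (1 - s) - of_nat (Suc n) powr (1 - s)) sums (0 - of_nat (Suc 0) powr (1 - s))"
    by (rule telescope_sums) (use s powr_tendsto_0[of "1 - s"] in simp)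
  then have tel: "(\<lambda>n. of_nat (Suc (Suc n)) powr (1 - s) - of_nat (Suc n) powr (1 - s)) sums (- 1)" by simp
  have eq: "of_nat (Suc (Suc n)) powr (1 - s) - of_nat (Suc n) powr (1 - s) =
      zrem (Suc J) n s + (\<Sum>i\<le>J. ((1 - s) gchoose Suc i) * of_nat (Suc n) powr (- (s + of_nat i)))" for n
    unfolding zrem_def by (subst sum.atMost_Suc_shift) (simp add: algebra_simps)
  have "(\<lambda>n. zrem (Suc J) n s + (\<Sum>i\<le>J. ((1 - s) gchoose Suc i) * of_nat (Suc n) powr (- (s + of_nat i)))) sums
      ((\<Sum>n. zrem (Suc J) n s) + (\<Sum>i\<le>J. ((1 - s) gchoose Suc i) * t (s + of_nat i)))"
    by (intro sums_add rem sums_sum sums_mult sm)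
  then have main: "- 1 = (\<Sum>n. zrem (Suc J) n s) + (\<Sum>i\<le>J. ((1 - s) gchoose Suc i) * t (s + of_nat i))"
    using tel unfolding eq by (rule sums_unique2[rotated])
  have term_eq: "((1 - s) gchoose Suc i) * t (s + of_nat i) = - (((1 - s) gchoose i) / of_nat (Suc i) * Z (s + of_nat i))" for i
  proof -
    have "of_nat (Suc i) * ((1 - s) gchoose Suc i) = (1 - s - of_nat i) * ((1 - s) gchoose i)"
      using gbinomial_mult_1[of "1 - s" i] by (simp add: algebra_simps)
    then have "(1 - s) gchoose Suc i = (1 - s - of_nat i) * ((1 - s) gchoose i) / of_nat (Suc i)"
      by (simp add: field_simps del: of_nat_Suc)
    moreover have "Z (s + of_nat i) = - ((1 - s - of_nat i) * t (s + of_nat i))"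
      unfolding Z_def t_def by (simp add: algebra_simps)
    ultimately show ?thesis by (simp add: mult_ac del: of_nat_Suc)
  qed
  have Z_eq: "(\<Sum>i\<le>J. - (((1 - s) gchoose i) / of_nat (Suc i) * Z (s + of_nat i))) =
      - Z s - (\<Sum>i\<in>{1..J}. ((1 - s) gchoose i) / of_nat (Suc i) * Z (s + of_nat i))"
  proof -
    have "{..J} = insert 0 {1..J}" by auto
    then show ?thesis by (simp add: sum_negf)
  qed
  have solve: "z = 1 - R + r" if "- 1 = r + (- z - R)" for z R r :: complex
  proof -
    have "z = 1 - R + r + ((- 1) - (r + (- z - R)))" by (simp add: algebra_simps)
    then show ?thesis unfolding that[symmetric] by simp
  qed
  show ?thesis by (rule solve[OF main[unfolded term_eq Z_eq]])
qed

text \<open>Each use of \<open>zeta_recursion\<close> gains a strip of width 1: the shifts s + i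
  with i >= 1 lie where the continuation is already known. The factor s - 1 removes the pole and
  keeps every strip connected and free of exceptions.\<close>

lemma zeta_strip_continuation:
  "\<exists>Z. Z holomorphic_on {s. Re s > 1 - real m} \<and>
     (\<forall>s. Re s > 1 \<longrightarrow> Z s = (s - 1) * (\<Sum>n. of_nat (Suc n) powr (- s)))"
proof (induction m)
  case 0
  show ?case using zeta_series_holomorphic
    by (intro exI[of _ "\<lambda>s. (s - 1) * (\<Sum>n. of_nat (Suc n) powr (- s))"]) (auto intro!: holomorphic_intros)
next
  case (Suc m)
  then obtain Z where Z: "Z holomorphic_on {s. Re s > 1 - real m}"
    "\<And>s. Re s > 1 \<Longrightarrow> Z s = (s - 1) * (\<Sum>n. of_nat (Suc n) powr (- s))" by blast
  define Y where "Y = (\<lambda>s. 1 - (\<Sum>i\<in>{1..m}. ((1 - s) gchoose i) / of_nat (Suc i) * Z (s + of_nat i)) + (\<Sum>n. zrem (Suc m) n s))"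
  have "Y holomorphic_on {s. Re s > 1 - real (Suc m)}"
    unfolding Y_def
  proof (intro holomorphic_intros zrem_holomorphic)
    fix i assume i: "i \<in> {1..m}"
    have "Z \<circ> (\<lambda>s. s + of_nat i) holomorphic_on {s. Re s > 1 - real (Suc m)}"
    proof (rule holomorphic_on_compose_gen[OF _ Z(1)])
      show "(\<lambda>s. s + of_nat i) ` {s. Re s > 1 - real (Suc m)} \<subseteq> {s. Re s > 1 - real m}" using i by auto
    qed (intro holomorphic_intros)
    then show "(\<lambda>s. Z (s + of_nat i)) holomorphic_on {s. Re s > 1 - real (Suc m)}" by (simp add: o_def)
  qed (simp_all add: of_nat_neq_0 del: of_nat_Suc)
  moreover have "Y s = (s - 1) * (\<Sum>n. of_nat (Suc n) powr (- s))" if s: "Re s > 1" for s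
  proof -
    have "Z (s + of_nat i) = (s + of_nat i - 1) * (\<Sum>n. of_nat (Suc n) powr (- (s + of_nat i)))" for i
      using s by (intro Z(2)) (simp add: add_strict_increasing)
    then show ?thesis unfolding Y_def using zeta_recursion[OF s, of m] by simp
  qed
  ultimately show ?case by blast
qed

text \<open>The choice in the definition of \<open>zeta\<close> is meaningful only through this
  existence. The strip continuations agree by the identity theorem and glue to an entire function,
  which is divided by s - 1 at the end.\<close>

theorem zeta_continuation:
  "\<exists>f. f holomorphic_on (- {1}) \<and> (\<forall>s. Re s > 1 \<longrightarrow> (\<lambda>n. of_nat (Suc n) powr (- s)) sums f s)"
proof -
  have "\<forall>m. \<exists>Z. Z holomorphic_on {s. Re s > 1 - real m} \<and>
     (\<forall>s. Re s > 1 \<longrightarrow> Z s = (s - 1) * (\<Sum>n. of_nat (Suc n) powr (- s)))"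
    by (intro allI zeta_strip_continuation)
  from choice[OF this] obtain Z where ZZ: "\<forall>m. Z m holomorphic_on {s. Re s > 1 - real m} \<and>
     (\<forall>s. Re s > 1 \<longrightarrow> Z m s = (s - 1) * (\<Sum>n. of_nat (Suc n) powr (- s)))" ..
  have Z: "Z m holomorphic_on {s. Re s > 1 - real m}"
    "Re s > 1 \<Longrightarrow> Z m s = (s - 1) * (\<Sum>n. of_nat (Suc n) powr (- s))" for m s
    using ZZ by simp_all
  have agree: "Z m s = Z m' s" if le: "m \<le> m'" and s: "Re s > 1 - real m" for m m' s
  proof (rule analytic_continuation_open[of "{s. Re s > 1}" "{s. Re s > 1 - real m}" "Z m" "Z m'"])
    show "open {s. Re s > 1}" by (rule open_halfplane)
    show "open {s. Re s > 1 - real m}" by (rule open_halfplane)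
    show "connected {s. Re s > 1 - real m}" by (rule connected_halfplane)
    show "Z m' holomorphic_on {s. Re s > 1 - real m}"
      by (rule holomorphic_on_subset[OF Z(1)[of m']]) (use le in auto)
    show "Z m holomorphic_on {s. Re s > 1 - real m}" by (rule Z(1))
    have "2 \<in> {s. Re s > 1}" by simp
    then show "{s. Re s > 1} \<noteq> {}" by blast
    show "Z m z = Z m' z" if "z \<in> {s. Re s > 1}" for z using Z(2) that by simp
  qed (use s in auto)
  define k where "k = (\<lambda>s. nat \<lceil>1 - Re s\<rceil> + 1)"
  have k: "Re s > 1 - real (k s)" for s
    unfolding k_def using real_nat_ceiling_ge[of "1 - Re s"] by linarith
  define Y where "Y = (\<lambda>s. Z (k s) s)"
  have Y: "Y s = Z m s" if "Re s > 1 - real m" for s m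
    unfolding Y_def using agree[of m "k s" s] agree[of "k s" m s] k[of s] that by (metis nat_le_linear)
  have "Y holomorphic_on UNIV"
  proof -
    have "Y field_differentiable at s" for s
    proof -
      have "Y holomorphic_on {z. Re z > 1 - real (k s)}"
        by (rule holomorphic_transform[OF Z(1)[of "k s"]]) (use Y in auto)
      then show ?thesis by (rule holomorphic_on_imp_differentiable_at[OF _ open_halfplane]) (use k in simp)
    qed
    then show ?thesis by (simp add: holomorphic_on_def field_differentiable_at_within)
  qed
  then have "Y holomorphic_on - {1}" by (rule holomorphic_on_subset) auto
  then have "(\<lambda>s. Y s / (s - 1)) holomorphic_on (- {1})" by (intro holomorphic_intros) auto
  moreover have "(\<lambda>n. of_nat (Suc n) powr (- s)) sums (Y s / (s - 1))" if s: "Re s > 1" for s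
  proof -
    have "Y s = (s - 1) * (\<Sum>n. of_nat (Suc n) powr (- s))" using Y[of 0 s] Z(2)[OF s] s by simp
    moreover have "s \<noteq> 1" using s by auto
    ultimately have "Y s / (s - 1) = (\<Sum>n. of_nat (Suc n) powr (- s))" by simp
    then show ?thesis using summable_sums[OF summable_norm_cancel[OF powr_summable_complex[OF s]]] by simp
  qed
  ultimately show ?thesis by blast
qed

lemma zeta_holomorphic: "zeta holomorphic_on (- {1})"
  and zeta_sums: "Re s > 1 \<Longrightarrow> (\<lambda>n. of_nat (Suc n) powr (- s)) sums zeta s"
proof -
  have "zeta holomorphic_on (- {1}) \<and> (\<forall>s. Re s > 1 \<longrightarrow> (\<lambda>n. of_nat (Suc n) powr (- s)) sums zeta s)"
    unfolding zeta_def by (rule someI_ex[OF zeta_continuation])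
  then show "zeta holomorphic_on (- {1})"
    "Re s > 1 \<Longrightarrow> (\<lambda>n. of_nat (Suc n) powr (- s)) sums zeta s" by simp_all
qed

text \<open>Sieving by the primes below \<open>P\<close> multiplies the series by nonzero Euler factors, while the
  sieved series tends to its first term \<open>1\<close>.\<close>

lemma zeta_nonzero:
  assumes w: "Re w > 1" shows "zeta w \<noteq> 0"
proof
  assume z0: "zeta w = 0"
  define g where "g = (\<lambda>A n. if n \<in> A then (of_nat n :: complex) powr (- w) else 0)"
  define S where "S = (\<lambda>P. {n::nat. n > 0 \<and> (\<forall>p<P. prime p \<longrightarrow> \<not> p dvd n)})"
  have sm: "summable (\<lambda>n. norm (g A n))" for A
  proof (rule summable_comparison_test')
    show "summable (\<lambda>n. real n powr (- Re w))" using w by (simp add: summable_real_powr_iff)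
    show "norm (norm (g A n)) \<le> real n powr (- Re w)" if "n \<ge> 1" for n
      using that by (simp add: g_def norm_of_nat_powr)
  qed
  have hs: "((\<lambda>n. of_nat n powr (- w)) has_sum (\<Sum>n. g A n)) A" if "0 \<notin> A" for A
  proof -
    have "(g A has_sum (\<Sum>n. g A n)) UNIV"
      by (rule norm_summable_imp_has_sum[OF sm summable_sums[OF summable_norm_cancel[OF sm]]])
    moreover have "(g A has_sum (\<Sum>n. g A n)) UNIV \<longleftrightarrow> ((\<lambda>n. of_nat n powr (- w)) has_sum (\<Sum>n. g A n)) A"
      by (rule has_sum_cong_neutral) (auto simp: g_def)
    ultimately show ?thesis by simp
  qed
  have 0: "(\<Sum>n. g (S P) n) = 0" for P
  proof (induction P)
    case 0
    have "g (S 0) n = (if n = 0 then 0 else of_nat n powr (- w))" for n by (simp add: g_def S_def)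
    then have "g (S 0) 0 = 0" "(\<lambda>n. g (S 0) (Suc n)) sums zeta w" using zeta_sums[OF w] by simp_all
    then show ?case using z0 by (metis sums_Suc_iff sums_unique add.right_neutral)
  next
    case (Suc P)
    show ?case
    proof (cases "prime P")
      case False
      then have "S (Suc P) = S P" by (auto simp: S_def less_Suc_eq)
      then show ?thesis using Suc by simp
    next
      case True
      have P0: "P > 0" using True prime_gt_0_nat by blast
      have cop: "\<not> p dvd P" if "prime p" "p < P" for p using that True primes_dvd_imp_eq by blast
      have split: "S P = S (Suc P) \<union> (*) P ` S P" "S (Suc P) \<inter> (*) P ` S P = {}"
      proof -
        show "S (Suc P) \<inter> (*) P ` S P = {}" using True by (auto simp: S_def)
        show "S P = S (Suc P) \<union> (*) P ` S P"
        proof (intro subset_antisym subsetI)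
          fix n assume n: "n \<in> S P"
          show "n \<in> S (Suc P) \<union> (*) P ` S P"
          proof (cases "P dvd n")
            case True
            then obtain m where "n = P * m" by blast
            then have "m \<in> S P" using n by (auto simp: S_def)
            then show ?thesis using \<open>n = P * m\<close> by blast
          next
            case False
            then show ?thesis using n by (auto simp: S_def less_Suc_eq)
          qed
        next
          fix n assume "n \<in> S (Suc P) \<union> (*) P ` S P"
          then show "n \<in> S P" using P0 cop by (auto simp: S_def prime_dvd_mult_iff)
        qed
      qed
      have "((\<lambda>n. of_nat P powr (- w) * of_nat n powr (- w)) has_sum (of_nat P powr (- w) * (\<Sum>n. g (S P) n))) (S P)"
        by (intro has_sum_cmult_right hs) (simp add: S_def)
      also have "(\<lambda>n. of_nat P powr (- w) * of_nat n powr (- w)) = (\<lambda>n. of_nat n powr (- w)) \<circ> (*) P"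
      proof
        fix n
        show "of_nat P powr (- w) * of_nat n powr (- w) = ((\<lambda>n. (of_nat n :: complex) powr (- w)) \<circ> (*) P) n"
          using powr_times_real[of "of_nat P" "of_nat n" "- w"] by simp
      qed
      finally have "((\<lambda>n. of_nat n powr (- w)) \<circ> (*) P has_sum (of_nat P powr (- w) * (\<Sum>n. g (S P) n))) (S P)" .
      moreover have "inj_on ((*) P) (S P)" using P0 by (auto intro: inj_onI)
      ultimately have h2: "((\<lambda>n. of_nat n powr (- w)) has_sum (of_nat P powr (- w) * (\<Sum>n. g (S P) n))) ((*) P ` S P)"
        by (simp only: has_sum_reindex)
      have h1: "((\<lambda>n. of_nat n powr (- w)) has_sum (\<Sum>n. g (S (Suc P)) n)) (S (Suc P))"
        by (rule hs) (simp add: S_def)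
      have "((\<lambda>n. of_nat n powr (- w)) has_sum ((\<Sum>n. g (S (Suc P)) n) + of_nat P powr (- w) * (\<Sum>n. g (S P) n))) (S P)"
        using has_sum_Un_disjoint[OF h1 h2 split(2)] split(1) by simp
      moreover have "((\<lambda>n. of_nat n powr (- w)) has_sum (\<Sum>n. g (S P) n)) (S P)" by (rule hs) (simp add: S_def)
      ultimately have "(\<Sum>n. g (S (Suc P)) n) + of_nat P powr (- w) * (\<Sum>n. g (S P) n) = (\<Sum>n. g (S P) n)"
        using has_sum_unique by blast
      then show ?thesis using Suc by simp
    qed
  qed
  obtain N where N: "(\<Sum>n. norm (g UNIV (n + Suc N))) < 1"
  proof -
    have "(\<lambda>N. \<Sum>n. norm (g UNIV (n + N))) \<longlonglongrightarrow> 0" by (rule suminf_exist_split2[OF sm])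
    then have "eventually (\<lambda>N. (\<Sum>n. norm (g UNIV (n + N))) < 1) sequentially" by (rule order_tendstoD) simp
    then obtain M where "\<And>N. N \<ge> M \<Longrightarrow> (\<Sum>n. norm (g UNIV (n + N))) < 1" unfolding eventually_sequentially by blast
    from this[of "Suc M"] show ?thesis using that[of M] by simp
  qed
  have in1: "1 \<in> S (Suc N)" by (auto simp: S_def)
  have notin: "n \<notin> S (Suc N)" if n1: "n \<noteq> 1" and nN: "n \<le> N" for n
  proof
    assume n: "n \<in> S (Suc N)"
    then have "n > 0" by (simp add: S_def)
    obtain p where p: "prime p" "p dvd n" using prime_factor_nat[OF n1] by blast
    then have "p \<le> n" using \<open>n > 0\<close> by (simp add: dvd_imp_le)
    then show False using n p nN by (simp add: S_def)
  qed
  have N1: "g (S (Suc N)) n = (if n = 1 then 1 else 0)" if "n < Suc N" for n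
    using that in1 notin[of n] by (auto simp: g_def)
  show False
  proof (cases "N = 0")
    \<comment> \<open>For N = 0 the tail includes the term 1 at n = 1 and is therefore at least
      1.\<close>
    case True
    have "(\<Sum>n. norm (g UNIV (n + 1))) \<ge> norm (g UNIV (0 + 1))"
      using sum_le_suminf[OF summable_ignore_initial_segment[OF sm[of UNIV], of 1], of "{0}"] by simp
    then show False using N True by (simp add: g_def)
  next
    case False
    have "0 = (\<Sum>n. g (S (Suc N)) (n + Suc N)) + (\<Sum>n<Suc N. g (S (Suc N)) n)"
      using suminf_split_initial_segment[OF summable_norm_cancel[OF sm[of "S (Suc N)"]], of "Suc N"] 0[of "Suc N"] by simp
    also have "(\<Sum>n<Suc N. g (S (Suc N)) n) = (\<Sum>n<Suc N. if n = 1 then 1 else 0)"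
      by (intro sum.cong refl N1) auto
    also have "\<dots> = 1" using False by simp
    finally have "(\<Sum>n. g (S (Suc N)) (n + Suc N)) = - 1" by (simp add: eq_neg_iff_add_eq_0)
    moreover have "norm (\<Sum>n. g (S (Suc N)) (n + Suc N)) \<le> (\<Sum>n. norm (g (S (Suc N)) (n + Suc N)))"
      by (rule summable_norm[OF summable_ignore_initial_segment[OF sm]])
    moreover have "\<dots> \<le> (\<Sum>n. norm (g UNIV (n + Suc N)))"
      by (rule suminf_le[OF _ summable_ignore_initial_segment[OF sm] summable_ignore_initial_segment[OF sm]]) (simp add: g_def)
    ultimately show False using N by simp
  qed
qed

text \<open>Summation by parts, with the differences of k^(-s) bounded by |s| k^(-Re s - 1) through
  \<open>powr_Taylor\<close> for J = 0. The case \<alpha> = 1/2 + \<delta> serves the lattice point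
  errors, the case \<alpha> = 0 the L-function.\<close>

lemma Dirichlet_series_Abel:
  fixes c :: "nat \<Rightarrow> complex"
  assumes S: "\<And>N. N \<ge> 1 \<Longrightarrow> norm (\<Sum>k<N. c (Suc k)) \<le> C * real N powr \<alpha>" and \<alpha>: "\<alpha> \<ge> 0" and C: "C \<ge> 0"
  defines "F \<equiv> \<lambda>s. \<Sum>k. c (Suc k) * of_nat (Suc k) powr (- s)"
  shows "F holomorphic_on {s. Re s > \<alpha>}"
    "\<And>s. Re s > \<alpha> \<Longrightarrow> (\<lambda>k. c (Suc k) * of_nat (Suc k) powr (- s)) sums F s"
    "\<And>s. Re s > \<alpha> \<Longrightarrow> norm (F s) \<le> C * norm s * (\<Sum>k. real (Suc k) powr (\<alpha> - Re s - 1))"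
proof -
  define T where "T = (\<lambda>N. \<Sum>k<N. c (Suc k))"
  define f where "f = (\<lambda>k s. T (Suc k) * (of_nat (Suc k) powr (- s) - of_nat (Suc (Suc k)) powr (- s)))"
  have fb: "norm (f k s) \<le> C * norm s * real (Suc k) powr (\<alpha> - Re s - 1)" if s: "Re s > \<alpha>" for k s
  proof -
    have "norm (of_nat (Suc (Suc k)) powr (- s) - (\<Sum>j\<le>0. ((- s) gchoose j) * of_nat (Suc k) powr (- s - of_nat j)))
        \<le> norm (\<Prod>l\<le>0. - s - of_nat l) * real (Suc k) powr (Re (- s) - real 0 - 1)"
      by (rule powr_Taylor) (use s \<alpha> in auto)
    then have "norm (of_nat (Suc k) powr (- s) - of_nat (Suc (Suc k)) powr (- s)) \<le> norm s * real (Suc k) powr (- Re s - 1)"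
      by (simp add: norm_minus_commute)
    moreover have "norm (T (Suc k)) \<le> C * real (Suc k) powr \<alpha>" unfolding T_def by (rule S) simp
    ultimately have "norm (f k s) \<le> (C * real (Suc k) powr \<alpha>) * (norm s * real (Suc k) powr (- Re s - 1))"
      unfolding f_def norm_mult using C by (intro mult_mono) auto
    also have "\<dots> = C * norm s * (real (Suc k) powr \<alpha> * real (Suc k) powr (- Re s - 1))" by simp
    also have "real (Suc k) powr \<alpha> * real (Suc k) powr (- Re s - 1) = real (Suc k) powr (\<alpha> - Re s - 1)"
      by (simp add: powr_add[symmetric] algebra_simps del: of_nat_Suc)
    finally show ?thesis .
  qed
  have M: "\<exists>d>0. \<exists>M. cball x d \<subseteq> {s. Re s > \<alpha>} \<and> summable M \<and> (\<forall>n. \<forall>y\<in>cball x d. norm (f n y) \<le> M n)"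
    if x: "x \<in> {s. Re s > \<alpha>}" for x
  proof -
    have "Re x > \<alpha>" using x by simp
    then obtain d where d: "d > 0" "cball x d \<subseteq> {s. Re s > \<alpha>}" "\<forall>y\<in>cball x d. Re y \<ge> \<alpha> + d"
      using halfplane_cball by blast
    have "norm (f k y) \<le> C * (norm x + d) * real (Suc k) powr (- d - 1)" if y: "y \<in> cball x d" for k y
    proof -
      have "norm y \<le> norm x + d" using y norm_triangle_sub[of y x] by (simp add: dist_norm norm_minus_commute)
      moreover have "norm (f k y) \<le> C * norm y * real (Suc k) powr (\<alpha> - Re y - 1)"
        using d(1) bspec[OF d(3) y] by (intro fb) simp
      moreover have "real (Suc k) powr (\<alpha> - Re y - 1) \<le> real (Suc k) powr (- d - 1)"
        using bspec[OF d(3) y] by (intro powr_mono) auto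
      ultimately show ?thesis using C
        by (meson mult_left_mono mult_mono norm_ge_zero order_trans powr_ge_zero mult_nonneg_nonneg add_nonneg_nonneg less_imp_le d(1))
    qed
    moreover have "summable (\<lambda>k. C * (norm x + d) * real (Suc k) powr (- d - 1))"
      using d(1) by (intro summable_mult summable_powr) simp
    ultimately show ?thesis using d(1,2) by blast
  qed
  have fh: "f n holomorphic_on {s. Re s > \<alpha>}" for n unfolding f_def by (intro holomorphic_intros)
  have fs: "summable (\<lambda>k. f k s)" if "Re s > \<alpha>" for s
    using holomorphic_series(2)[OF open_halfplane fh M] that by blast
  have abel: "(\<Sum>k<N. c (Suc k) * of_nat (Suc k) powr (- s)) = (\<Sum>k<N. f k s) + T N * of_nat (Suc N) powr (- s)" for N s
    by (induction N) (auto simp: T_def f_def algebra_simps)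
  have T0: "(\<lambda>N. T N * of_nat (Suc N) powr (- s)) \<longlonglongrightarrow> 0" if s: "Re s > \<alpha>" for s
  proof (rule Lim_null_comparison)
    show "eventually (\<lambda>N. norm (T N * of_nat (Suc N) powr (- s)) \<le> C * real (Suc N) powr (\<alpha> - Re s)) sequentially"
      using eventually_ge_at_top[of 1]
    proof eventually_elim
      case (elim N)
      have "norm (T N) \<le> C * real N powr \<alpha>" unfolding T_def by (rule S[OF elim])
      also have "\<dots> \<le> C * real (Suc N) powr \<alpha>" using C \<alpha> by (intro mult_left_mono powr_mono2) auto
      finally have "norm (T N * of_nat (Suc N) powr (- s)) \<le> C * real (Suc N) powr \<alpha> * real (Suc N) powr (- Re s)"
        unfolding norm_mult norm_of_nat_powr[OF zero_less_Suc] uminus_complex.sel by (intro mult_right_mono) auto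
      also have "\<dots> = C * (real (Suc N) powr \<alpha> * real (Suc N) powr (- Re s))" by simp
      also have "real (Suc N) powr \<alpha> * real (Suc N) powr (- Re s) = real (Suc N) powr (\<alpha> - Re s)"
        by (simp add: powr_add[symmetric] del: of_nat_Suc)
      finally show ?case .
    qed
    have "(\<lambda>N. real N powr (\<alpha> - Re s)) \<longlonglongrightarrow> 0" using s by (intro tendsto_neg_powr filterlim_real_sequentially) auto
    then have "(\<lambda>N. C * real (Suc N) powr (\<alpha> - Re s)) \<longlonglongrightarrow> C * 0"
      by (rule tendsto_mult_left[OF LIMSEQ_Suc])
    then show "(\<lambda>N. C * real (Suc N) powr (\<alpha> - Re s)) \<longlonglongrightarrow> 0" by simp
  qed
  have lim: "(\<lambda>k. c (Suc k) * of_nat (Suc k) powr (- s)) sums (\<Sum>k. f k s)" if s: "Re s > \<alpha>" for s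
  proof -
    have "(\<lambda>N. (\<Sum>k<N. f k s) + T N * of_nat (Suc N) powr (- s)) \<longlonglongrightarrow> (\<Sum>k. f k s) + 0"
      by (intro tendsto_add T0[OF s] summable_LIMSEQ[OF fs[OF s]])
    then show ?thesis unfolding sums_def abel by simp
  qed
  have Ff: "F s = (\<Sum>k. f k s)" if s: "Re s > \<alpha>" for s
    unfolding F_def by (rule sums_unique[OF lim[OF s], symmetric])
  show sums: "(\<lambda>k. c (Suc k) * of_nat (Suc k) powr (- s)) sums F s" if s: "Re s > \<alpha>" for s
    unfolding Ff[OF s] by (rule lim[OF s])
  show "F holomorphic_on {s. Re s > \<alpha>}"
    by (rule holomorphic_transform[OF holomorphic_series(1)[OF open_halfplane fh M]]) (use Ff in auto)
  show "norm (F s) \<le> C * norm s * (\<Sum>k. real (Suc k) powr (\<alpha> - Re s - 1))" if s: "Re s > \<alpha>" for s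
  proof -
    have sm: "summable (\<lambda>k. C * norm s * real (Suc k) powr (\<alpha> - Re s - 1))"
      using s by (intro summable_mult summable_powr) simp
    have "norm (F s) \<le> (\<Sum>k. C * norm s * real (Suc k) powr (\<alpha> - Re s - 1))"
      unfolding Ff[OF s] by (rule norm_suminf_le[OF fb[OF s] sm])
    then show ?thesis using s by (simp add: suminf_mult summable_powr del: of_nat_Suc)
  qed
qed

section \<open>Lattice points in ellipses\<close>

text \<open>The area \<pi>/4. Truncation by \<open>max 0\<close> extends the integrand by 0, so that
  Riemann sums may run past 1.\<close>

definition quarter_disc :: real where "quarter_disc = integral {0..1} (\<lambda>u. sqrt (max 0 (1 - u\<^sup>2)))"

lemma quarter_disc_bounds: "0 \<le> quarter_disc" "quarter_disc \<le> 1"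
proof -
  have int: "(\<lambda>u::real. sqrt (max 0 (1 - u\<^sup>2))) integrable_on {0..1}"
    by (intro integrable_continuous_interval continuous_intros)
  show "0 \<le> quarter_disc" unfolding quarter_disc_def by (rule integral_nonneg[OF int]) auto
  have "quarter_disc \<le> integral {0..1} (\<lambda>u::real. 1)"
    unfolding quarter_disc_def by (rule integral_le[OF int]) auto
  then show "quarter_disc \<le> 1" by simp
qed

text \<open>The integrand decreases, so the integral lies between the sums over right and left end
  points of mesh 1/t. These differ by 1/t, which becomes t after scaling by t^2.\<close>

lemma sum_sqrt_quarter_disc:
  assumes t: "t \<ge> 1" and N: "N = nat \<lfloor>t\<rfloor>"
  shows "\<bar>(\<Sum>n\<in>{1..N}. sqrt (t\<^sup>2 - (real n)\<^sup>2)) - quarter_disc * t\<^sup>2\<bar> \<le> t"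
proof -
  define h where "h = (\<lambda>u::real. sqrt (max 0 (1 - u\<^sup>2)))"
  have int: "h integrable_on {a..b}" for a b
    unfolding h_def by (intro integrable_continuous_interval continuous_intros)
  have anti: "h v \<le> h u" if "0 \<le> u" "u \<le> v" for u v
    using power_mono[OF that(2,1), of 2] by (auto simp: h_def)
  have t0: "t > 0" using t by simp
  have Nt: "real N \<le> t" "t < real N + 1" using t unfolding N by linarith+
  have step: "h (real (Suc n) / t) / t \<le> integral {real n / t..real (Suc n) / t} h"
    "integral {real n / t..real (Suc n) / t} h \<le> h (real n / t) / t" for n
  proof -
    have le: "real n / t \<le> real (Suc n) / t" using t0 by (simp add: divide_right_mono)
    have "integral {real n / t..real (Suc n) / t} (\<lambda>u. h (real (Suc n) / t)) \<le> integral {real n / t..real (Suc n) / t} h"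
      by (rule integral_le[OF _ int]) (use t0 in \<open>auto intro!: anti simp: order_trans[of 0 "real n / t"]\<close>)
    then show "h (real (Suc n) / t) / t \<le> integral {real n / t..real (Suc n) / t} h"
      using le by (simp add: diff_divide_distrib[symmetric])
    have "integral {real n / t..real (Suc n) / t} h \<le> integral {real n / t..real (Suc n) / t} (\<lambda>u. h (real n / t))"
      by (rule integral_le[OF int]) (use t0 in \<open>auto intro!: anti\<close>)
    then show "integral {real n / t..real (Suc n) / t} h \<le> h (real n / t) / t"
      using le by (simp add: diff_divide_distrib[symmetric])
  qed
  have split: "integral {0..real M / t} h = (\<Sum>n<M. integral {real n / t..real (Suc n) / t} h)" for M
  proof (induction M)
    case (Suc M)
    have "integral {0..real M / t} h + integral {real M / t..real (Suc M) / t} h = integral {0..real (Suc M) / t} h"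
      by (rule Henstock_Kurzweil_Integration.integral_combine[OF _ _ int]) (use t0 in \<open>auto intro!: divide_right_mono\<close>)
    then show ?case using Suc by simp
  qed simp
  have "integral {0..1} h + integral {1..real (Suc N) / t} h = integral {0..real (Suc N) / t} h"
    by (rule Henstock_Kurzweil_Integration.integral_combine[OF _ _ int]) (use t0 Nt in auto)
  moreover have "integral {1..real (Suc N) / t} h = integral {1..real (Suc N) / t} (\<lambda>u. 0)"
  proof (rule integral_cong)
    fix u assume "u \<in> {1..real (Suc N) / t}"
    then have "1 \<le> u\<^sup>2" by (simp add: one_le_power)
    then show "h u = 0" by (simp add: h_def)
  qed
  ultimately have qd: "quarter_disc = (\<Sum>n<Suc N. integral {real n / t..real (Suc n) / t} h)"
    using split[of "Suc N"] by (simp add: quarter_disc_def h_def)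
  have th: "t * h (real n / t) = sqrt (t\<^sup>2 - (real n)\<^sup>2)" if "n \<le> N" for n
  proof -
    have n: "(real n)\<^sup>2 \<le> t\<^sup>2" using that Nt by (intro power_mono) auto
    have "t * h (real n / t) = sqrt (t\<^sup>2) * sqrt (1 - (real n / t)\<^sup>2)"
      using n t0 by (simp add: h_def power_divide)
    also have "\<dots> = sqrt (t\<^sup>2 * (1 - (real n / t)\<^sup>2))" by (simp only: real_sqrt_mult)
    also have "t\<^sup>2 * (1 - (real n / t)\<^sup>2) = t\<^sup>2 - (real n)\<^sup>2" using t0 by (simp add: power_divide field_simps)
    finally show ?thesis .
  qed
  define G where "G = (\<Sum>n\<in>{1..N}. sqrt (t\<^sup>2 - (real n)\<^sup>2))"
  have G: "G = t * (\<Sum>n\<in>{1..N}. h (real n / t))"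
    unfolding G_def sum_distrib_left by (intro sum.cong refl th[symmetric]) auto
  have hN: "h (real (Suc N) / t) = 0"
  proof -
    have "1 \<le> real (Suc N) / t" using t0 Nt by simp
    then have "1 \<le> (real (Suc N) / t)\<^sup>2" by (rule one_le_power)
    then show ?thesis by (simp add: h_def)
  qed
  have "(\<Sum>n<Suc N. h (real (Suc n) / t) / t) \<le> quarter_disc" unfolding qd by (intro sum_mono step)
  moreover have "(\<Sum>n<Suc N. h (real (Suc n) / t)) = (\<Sum>n\<in>{1..Suc N}. h (real n / t))"
    by (rule sum.reindex_bij_witness[of _ "\<lambda>n. n - 1" Suc]) auto
  then have "(\<Sum>n<Suc N. h (real (Suc n) / t)) = (\<Sum>n\<in>{1..N}. h (real n / t))" using hN by simp
  ultimately have "(\<Sum>n\<in>{1..N}. h (real n / t)) / t \<le> quarter_disc"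
    by (simp only: sum_divide_distrib[symmetric])
  then have "(\<Sum>n\<in>{1..N}. h (real n / t)) \<le> quarter_disc * t" using t0 by (simp add: pos_divide_le_eq)
  then have "t * (\<Sum>n\<in>{1..N}. h (real n / t)) \<le> t * (quarter_disc * t)" using t0 by (intro mult_left_mono) auto
  then have up: "G \<le> quarter_disc * t\<^sup>2" unfolding G by (simp add: power2_eq_square mult_ac)
  have "quarter_disc \<le> (\<Sum>n<Suc N. h (real n / t) / t)" unfolding qd by (intro sum_mono step)
  also have "\<dots> = (\<Sum>n<Suc N. h (real n / t)) / t" by (simp only: sum_divide_distrib)
  also have "{..<Suc N} = insert 0 {1..N}" by auto
  also have "(\<Sum>n\<in>insert 0 {1..N}. h (real n / t)) = 1 + (\<Sum>n\<in>{1..N}. h (real n / t))" by (simp add: h_def)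
  finally have "quarter_disc * t \<le> 1 + (\<Sum>n\<in>{1..N}. h (real n / t))" using t0 by (simp add: pos_le_divide_eq)
  then have "t * (quarter_disc * t) \<le> t * (1 + (\<Sum>n\<in>{1..N}. h (real n / t)))" using t0 by (intro mult_left_mono) auto
  then have "quarter_disc * t\<^sup>2 \<le> t + G" unfolding G by (simp add: power2_eq_square algebra_simps)
  then show ?thesis using up t0 unfolding G_def[symmetric] by linarith
qed

lemma integers_in_interval:
  assumes w: "w \<ge> 0"
  shows "finite {m::int. (of_int m + \<theta>)\<^sup>2 \<le> w\<^sup>2}" "\<bar>real (card {m::int. (of_int m + \<theta>)\<^sup>2 \<le> w\<^sup>2}) - 2 * w\<bar> \<le> 1"
proof -
  have "{m::int. (of_int m + \<theta>)\<^sup>2 \<le> w\<^sup>2} = {\<lceil>- w - \<theta>\<rceil>..\<lfloor>w - \<theta>\<rfloor>}"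
  proof (intro Set.set_eqI)
    fix m :: int
    have "(of_int m + \<theta>)\<^sup>2 \<le> w\<^sup>2 \<longleftrightarrow> \<bar>of_int m + \<theta>\<bar> \<le> w" using w by (simp add: abs_le_square_iff[symmetric])
    also have "\<dots> \<longleftrightarrow> - w - \<theta> \<le> of_int m \<and> of_int m \<le> w - \<theta>" by linarith
    finally show "m \<in> {m::int. (of_int m + \<theta>)\<^sup>2 \<le> w\<^sup>2} \<longleftrightarrow> m \<in> {\<lceil>- w - \<theta>\<rceil>..\<lfloor>w - \<theta>\<rfloor>}"
      by (simp add: ceiling_le_iff le_floor_iff)
  qed
  moreover have "\<bar>real (card {\<lceil>- w - \<theta>\<rceil>..\<lfloor>w - \<theta>\<rfloor>}) - 2 * w\<bar> \<le> 1"
  proof -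
    have fl: "real_of_int \<lceil>- w - \<theta>\<rceil> < - w - \<theta> + 1" "- w - \<theta> \<le> real_of_int \<lceil>- w - \<theta>\<rceil>"
      "real_of_int \<lfloor>w - \<theta>\<rfloor> \<le> w - \<theta>" "w - \<theta> - 1 < real_of_int \<lfloor>w - \<theta>\<rfloor>" by linarith+
    have "- 1 < real_of_int \<lfloor>w - \<theta>\<rfloor> - real_of_int \<lceil>- w - \<theta>\<rceil> + 1" using fl w by linarith
    then have "0 \<le> \<lfloor>w - \<theta>\<rfloor> - \<lceil>- w - \<theta>\<rceil> + 1" by linarith
    then have "real (card {\<lceil>- w - \<theta>\<rceil>..\<lfloor>w - \<theta>\<rfloor>}) = real_of_int \<lfloor>w - \<theta>\<rfloor> - real_of_int \<lceil>- w - \<theta>\<rceil> + 1"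
      by (simp add: algebra_simps)
    then show ?thesis using fl by linarith
  qed
  ultimately show "finite {m::int. (of_int m + \<theta>)\<^sup>2 \<le> w\<^sup>2}"
    "\<bar>real (card {m::int. (of_int m + \<theta>)\<^sup>2 \<le> w\<^sup>2}) - 2 * w\<bar> \<le> 1" by simp_all
qed

definition off_axis :: "int \<Rightarrow> int \<Rightarrow> int \<Rightarrow> nat \<Rightarrow> (int \<times> int) set" where
  "off_axis a b c k = {(m, n). n \<noteq> 0 \<and> a * m\<^sup>2 + b * m * n + c * n\<^sup>2 \<le> int k}"

lemma form_complete_square:
  assumes a: "a > 0" and disc: "4 * a * c - b\<^sup>2 = q"
  shows "a * m\<^sup>2 + b * m * n + c * n\<^sup>2 \<le> (k::int) \<longleftrightarrow>
    (of_int m + of_int (b * n) / (2 * of_int a))\<^sup>2 \<le> of_int k / of_int a - of_int (q * n\<^sup>2) / (4 * (of_int a)\<^sup>2 :: real)"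
proof -
  have le_div: "x \<le> z \<longleftrightarrow> x / d \<le> z / d" if "d > 0" for x z d :: real
    using that by (simp add: divide_le_cancel)
  have "a * m\<^sup>2 + b * m * n + c * n\<^sup>2 \<le> k \<longleftrightarrow> 4 * a * (a * m\<^sup>2 + b * m * n + c * n\<^sup>2) \<le> 4 * a * k" using a by simp
  also have "4 * a * (a * m\<^sup>2 + b * m * n + c * n\<^sup>2) = (2 * a * m + b * n)\<^sup>2 + q * n\<^sup>2"
    unfolding disc[symmetric] by (simp add: power2_eq_square algebra_simps)
  also have "(2 * a * m + b * n)\<^sup>2 + q * n\<^sup>2 \<le> 4 * a * k \<longleftrightarrow>
      (of_int ((2 * a * m + b * n)\<^sup>2 + q * n\<^sup>2) :: real) \<le> of_int (4 * a * k)" by (simp only: of_int_le_iff)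
  also have "\<dots> \<longleftrightarrow> (of_int ((2 * a * m + b * n)\<^sup>2 + q * n\<^sup>2) :: real) / (4 * (of_int a)\<^sup>2) \<le> of_int (4 * a * k) / (4 * (of_int a)\<^sup>2)"
    by (rule le_div) (use a in simp)
  also have "(of_int ((2 * a * m + b * n)\<^sup>2 + q * n\<^sup>2) :: real) / (4 * (of_int a)\<^sup>2) =
      (of_int m + of_int (b * n) / (2 * of_int a))\<^sup>2 + of_int (q * n\<^sup>2) / (4 * (of_int a)\<^sup>2)"
    using a by (simp add: power2_eq_square field_simps)
  also have "of_int (4 * a * k) / (4 * (of_int a)\<^sup>2) = (of_int k / of_int a :: real)"
    using a by (simp add: power2_eq_square)
  finally show ?thesis by (simp add: algebra_simps)
qed

text \<open>Row n of the ellipse is an interval of length 2 y sqrt(t^2 - n^2) with t = r/y. Rounding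
  costs 1 in each of the 2 N rows, at most 4 r because y >= 1/2; the sum over the rows costs 4 y t =
  4 r. For r < y only the axis n = 0 is met.\<close>

lemma off_axis_count:
  fixes k :: nat
  assumes a: "a > 0" and disc: "4 * a * c - b\<^sup>2 = q" and q: "3 * a\<^sup>2 \<le> q"
  defines "y \<equiv> sqrt (of_int q) / (2 * of_int a)" and "r \<equiv> sqrt (real k / of_int a)"
  shows "r < y \<Longrightarrow> off_axis a b c k = {}" "finite (off_axis a b c k)"
    "r \<ge> y \<Longrightarrow> \<bar>real (card (off_axis a b c k)) - 4 * quarter_disc * r\<^sup>2 / y\<bar> \<le> 8 * r"
proof -
  have q0: "q > 0" using q a by (metis less_le_trans mult_pos_pos zero_less_numeral zero_less_power)
  have y0: "y > 0" using a q0 by (simp add: y_def)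
  have r0: "r \<ge> 0" using a by (simp add: r_def)
  have r2: "r\<^sup>2 = real k / of_int a" using a by (simp add: r_def)
  have y2: "y\<^sup>2 = of_int q / (4 * (of_int a)\<^sup>2)" using q0 by (simp add: y_def power_divide power_mult_distrib)
  have "of_int (3 * a\<^sup>2) \<le> (of_int q :: real)" using q by (simp only: of_int_le_iff)
  then have "3 * (of_int a)\<^sup>2 \<le> (of_int q :: real)" by simp
  then have "(of_int a)\<^sup>2 \<le> (of_int q :: real)" using zero_le_power2[of "real_of_int a"] by linarith
  then have "(1 / 2)\<^sup>2 \<le> y\<^sup>2" unfolding y2 using a by (simp add: power2_eq_square field_simps)
  then have y12: "y \<ge> 1 / 2" by (rule power2_le_imp_le) (use y0 in simp)
  define t where "t = r / y"
  have t0: "t \<ge> 0" using r0 y0 by (simp add: t_def)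
  have rt: "r = y * t" using y0 by (simp add: t_def)
  define N where "N = nat \<lfloor>t\<rfloor>"
  have Nt: "real N \<le> t" "t < real N + 1" using t0 unfolding N_def by linarith+
  define \<theta> where "\<theta> = (\<lambda>n::int. of_int (b * n) / (2 * of_int a) :: real)"
  define M where "M = (\<lambda>n. {m::int. a * m\<^sup>2 + b * m * n + c * n\<^sup>2 \<le> int k})"
  have Mn: "m \<in> M n \<longleftrightarrow> (of_int m + \<theta> n)\<^sup>2 \<le> y\<^sup>2 * (t\<^sup>2 - (of_int n)\<^sup>2)" for m n
  proof -
    have "y\<^sup>2 * (t\<^sup>2 - (of_int n)\<^sup>2) = r\<^sup>2 - y\<^sup>2 * (of_int n)\<^sup>2" by (simp add: rt algebra_simps power_mult_distrib)
    also have "\<dots> = of_int (int k) / of_int a - of_int (q * n\<^sup>2) / (4 * (of_int a)\<^sup>2)" unfolding r2 y2 by simp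
    finally show ?thesis unfolding M_def \<theta>_def mem_Collect_eq form_complete_square[OF a disc] by simp
  qed
  have M_empty: "M n = {}" if "\<bar>of_int n\<bar> > t" for n
  proof -
    have "t\<^sup>2 < (of_int n)\<^sup>2" using power_strict_mono[OF that t0, of 2] by simp
    then have "y\<^sup>2 * (t\<^sup>2 - (of_int n)\<^sup>2) < 0" using y0 by (simp add: mult_pos_neg)
    then have "m \<notin> M n" for m unfolding Mn by (metis not_le order_trans zero_le_power2)
    then show ?thesis by blast
  qed
  define I where "I = {n::int. n \<noteq> 0 \<and> \<bar>n\<bar> \<le> int N}"
  have I_le: "\<bar>of_int n\<bar> \<le> t" if "n \<in> I" for n
  proof -
    have "real_of_int \<bar>n\<bar> \<le> real N" using that unfolding I_def by (metis mem_Collect_eq of_int_le_iff of_int_of_nat_eq)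
    then show ?thesis using Nt by simp
  qed
  have notI: "M n = {}" if "n \<noteq> 0" "n \<notin> I" for n
  proof (rule M_empty)
    have "int N + 1 \<le> \<bar>n\<bar>" using that by (simp add: I_def)
    then have "real_of_int (int N + 1) \<le> of_int \<bar>n\<bar>" by (simp only: of_int_le_iff)
    then show "\<bar>of_int n\<bar> > t" using Nt by simp
  qed
  have M_card: "finite (M n)" "\<bar>real (card (M n)) - 2 * (y * sqrt (t\<^sup>2 - (of_int n)\<^sup>2))\<bar> \<le> 1" if "n \<in> I" for n
  proof -
    have "(of_int n)\<^sup>2 \<le> t\<^sup>2" using power_mono[OF I_le[OF that], of 2] by simp
    then have "y\<^sup>2 * (t\<^sup>2 - (of_int n)\<^sup>2) = (y * sqrt (t\<^sup>2 - (of_int n)\<^sup>2))\<^sup>2" "y * sqrt (t\<^sup>2 - (of_int n)\<^sup>2) \<ge> 0"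
      using y0 by (simp_all add: power_mult_distrib)
    moreover then have "M n = {m. (of_int m + \<theta> n)\<^sup>2 \<le> (y * sqrt (t\<^sup>2 - (of_int n)\<^sup>2))\<^sup>2}" using Mn by auto
    ultimately show "finite (M n)" "\<bar>real (card (M n)) - 2 * (y * sqrt (t\<^sup>2 - (of_int n)\<^sup>2))\<bar> \<le> 1"
      using integers_in_interval[of "y * sqrt (t\<^sup>2 - (of_int n)\<^sup>2)" "\<theta> n"] by simp_all
  qed
  have finI: "finite I" by (rule finite_subset[of _ "{- int N..int N}"]) (auto simp: I_def)
  have off: "off_axis a b c k = (\<lambda>(n, m). (m, n)) ` (SIGMA n:I. M n)"
  proof (intro subset_antisym subsetI)
    fix p assume "p \<in> off_axis a b c k"
    then obtain m n where p: "p = (m, n)" "n \<noteq> 0" "m \<in> M n" by (auto simp: off_axis_def M_def)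
    then have "n \<in> I" using notI by blast
    then show "p \<in> (\<lambda>(n, m). (m, n)) ` (SIGMA n:I. M n)" using p by force
  qed (auto simp: off_axis_def M_def I_def)
  show "finite (off_axis a b c k)" unfolding off using finI M_card(1) by (intro finite_imageI finite_SigmaI) auto
  show "off_axis a b c k = {}" if "r < y"
  proof -
    have "t < 1" using that y0 by (simp add: t_def)
    then have "N = 0" unfolding N_def by simp
    then have "I = {}" by (auto simp: I_def)
    then show ?thesis unfolding off by simp
  qed
  show "\<bar>real (card (off_axis a b c k)) - 4 * quarter_disc * r\<^sup>2 / y\<bar> \<le> 8 * r" if "r \<ge> y"
  proof -
    have t1: "t \<ge> 1" using that y0 by (simp add: t_def)
    have "card (off_axis a b c k) = card (SIGMA n:I. M n)"
      unfolding off by (rule card_image) (auto simp: inj_on_def)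
    also have "\<dots> = (\<Sum>n\<in>I. card (M n))" using finI M_card(1) by (intro card_SigmaI) auto
    finally have card: "real (card (off_axis a b c k)) = (\<Sum>n\<in>I. real (card (M n)))" by simp
    define S where "S = (\<Sum>n\<in>{1..N}. sqrt (t\<^sup>2 - (real n)\<^sup>2))"
    have I_eq: "I = int ` {1..N} \<union> (\<lambda>n. - int n) ` {1..N}"
    proof (intro subset_antisym subsetI)
      fix n assume n: "n \<in> I"
      show "n \<in> int ` {1..N} \<union> (\<lambda>n. - int n) ` {1..N}"
      proof (cases "n > 0")
        case True
        then have "n = int (nat n)" "nat n \<in> {1..N}" using n by (auto simp: I_def)
        then show ?thesis by blast
      next
        case False
        then have "n = - int (nat (- n))" "nat (- n) \<in> {1..N}" using n by (auto simp: I_def)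
        then show ?thesis by blast
      qed
    qed (auto simp: I_def)
    have "card I = 2 * N"
      unfolding I_eq by (subst card_Un_disjoint) (auto simp: card_image inj_on_def)
    have S2: "(\<Sum>n\<in>I. sqrt (t\<^sup>2 - (of_int n)\<^sup>2)) = 2 * S"
      unfolding I_eq S_def by (subst sum.union_disjoint) (auto simp: sum.reindex inj_on_def)
    have "real (card (off_axis a b c k)) - 2 * y * (2 * S) = (\<Sum>n\<in>I. real (card (M n)) - 2 * (y * sqrt (t\<^sup>2 - (of_int n)\<^sup>2)))"
      unfolding card S2[symmetric] sum_subtractf by (simp add: sum_distrib_left mult.assoc)
    also have "\<bar>\<dots>\<bar> \<le> (\<Sum>n\<in>I. 1)"
      by (rule order_trans[OF sum_abs sum_mono]) (rule M_card(2))
    finally have 1: "\<bar>real (card (off_axis a b c k)) - 2 * y * (2 * S)\<bar> \<le> 2 * real N" using \<open>card I = 2 * N\<close> by simp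
    have "\<bar>S - quarter_disc * t\<^sup>2\<bar> \<le> t" unfolding S_def by (rule sum_sqrt_quarter_disc[OF t1 N_def])
    then have "4 * y * \<bar>S - quarter_disc * t\<^sup>2\<bar> \<le> 4 * y * t" using y0 by (intro mult_left_mono) auto
    then have 2: "\<bar>4 * y * S - 4 * y * (quarter_disc * t\<^sup>2)\<bar> \<le> 4 * r"
      using y0 rt by (simp add: abs_mult[symmetric] right_diff_distrib[symmetric] abs_mult)
    have 3: "4 * y * (quarter_disc * t\<^sup>2) = 4 * quarter_disc * r\<^sup>2 / y"
      unfolding rt using y0 by (simp add: power2_eq_square)
    have "1 / 2 * t \<le> y * t" using y12 t0 by (intro mult_right_mono) auto
    then have 4: "2 * real N \<le> 4 * r" using Nt unfolding rt by linarith
    show ?thesis using 1 2 4 unfolding 3 by linarith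
  qed
qed

text \<open>The density 2 \<pi>/sqrt q of lattice points. The leading coefficient cancels in 4
  \<open>quarter_disc\<close> r^2/y, so the density is the same for all classes.\<close>

definition kappa :: "real \<Rightarrow> real" where "kappa q = 8 * quarter_disc / sqrt q"

text \<open>The saving q^(-\<delta>) has to be uniform in the leading coefficient a. If the count is
  0, then k <= q makes the main term itself small enough; otherwise q <= 4 a k converts the error
  sqrt(k/a) into this saving.\<close>

lemma off_axis_bound:
  assumes a: "a > 0" and disc: "4 * a * c - b\<^sup>2 = q" and q: "3 * a\<^sup>2 \<le> q"
    and k: "k \<ge> 1" and d: "0 < \<delta>" "\<delta> \<le> 1 / 2"
  shows "\<bar>real (card (off_axis a b c k)) - kappa (of_int q) * real k\<bar> \<le> 16 * of_int q powr (- \<delta>) * real k powr (1 / 2 + \<delta>)"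
proof -
  define Q where "Q = real_of_int q"
  define A where "A = real_of_int a"
  have A1: "A \<ge> 1" using a by (simp add: A_def)
  have "of_int (3 * a\<^sup>2) \<le> (of_int q :: real)" using q by (simp only: of_int_le_iff)
  then have Q3: "3 * A\<^sup>2 \<le> Q" by (simp add: A_def Q_def)
  have "1 \<le> A\<^sup>2" using A1 by (rule one_le_power)
  then have Q0: "Q > 0" using Q3 by linarith
  have k0: "real k > 0" using k by simp
  define y where "y = sqrt Q / (2 * A)"
  define r where "r = sqrt (real k / A)"
  have y0: "y > 0" using Q0 A1 by (simp add: y_def)
  show ?thesis
  proof (cases "r < y")
    case True
    have "off_axis a b c k = {}" using off_axis_count(1)[OF a disc q, of k] True by (simp add: r_def y_def A_def Q_def)
    then have "\<bar>real (card (off_axis a b c k)) - kappa Q * real k\<bar> = kappa Q * real k"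
      using quarter_disc_bounds(1) Q0 by (simp add: kappa_def)
    also have "\<dots> \<le> 8 / sqrt Q * real k"
      using quarter_disc_bounds(2) Q0 by (intro mult_right_mono) (auto simp: kappa_def divide_right_mono)
    also have "8 / sqrt Q * real k = 8 * (Q powr (- (1/2)) * (real k powr (1 / 2 - \<delta>) * real k powr (1 / 2 + \<delta>)))"
    proof -
      have "1 / sqrt Q = Q powr (- (1/2))" unfolding powr_minus_divide using Q0 by (simp add: powr_half_sqrt)
      moreover have "real k powr (1 / 2 - \<delta>) * real k powr (1 / 2 + \<delta>) = real k powr 1"
        unfolding powr_add[symmetric] by (rule arg_cong[where f = "(powr) (real k)"]) simp
      moreover have "8 / sqrt Q * real k = 8 * ((1 / sqrt Q) * real k powr 1)" using k0 by simp
      ultimately show ?thesis by simp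
    qed
    also have "\<dots> \<le> 8 * (Q powr (- (1/2)) * (Q powr (1 / 2 - \<delta>) * real k powr (1 / 2 + \<delta>)))"
    proof -
      have "r\<^sup>2 < y\<^sup>2" using True A1 by (intro power_strict_mono) (auto simp: r_def)
      then have "real k / A < Q / (4 * A\<^sup>2)" using A1 Q0 by (simp add: r_def y_def power_divide power_mult_distrib)
      then have "real k * (4 * A) < Q" using A1 by (simp add: power2_eq_square field_simps)
      moreover have "real k * 1 \<le> real k * (4 * A)" using A1 by (intro mult_left_mono) auto
      ultimately have "real k \<le> Q" by linarith
      then show ?thesis using d by (intro mult_left_mono mult_right_mono powr_mono2) auto
    qed
    also have "\<dots> = 8 * ((Q powr (- (1/2)) * Q powr (1 / 2 - \<delta>)) * real k powr (1 / 2 + \<delta>))" by simp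
    also have "Q powr (- (1/2)) * Q powr (1 / 2 - \<delta>) = Q powr (- \<delta>)" by (simp add: powr_add[symmetric])
    also have "8 * (Q powr (- \<delta>) * real k powr (1 / 2 + \<delta>)) \<le> 16 * Q powr (- \<delta>) * real k powr (1 / 2 + \<delta>)" by simp
    finally show ?thesis by (simp add: Q_def)
  next
    case False
    have "4 * quarter_disc * r\<^sup>2 / y = kappa Q * real k"
      using A1 Q0 k0 by (simp add: r_def y_def kappa_def field_simps)
    then have "\<bar>real (card (off_axis a b c k)) - kappa Q * real k\<bar> \<le> 8 * r"
      using off_axis_count(3)[OF a disc q, of k] False by (simp add: r_def y_def A_def Q_def)
    also have "r = sqrt (1 / A) * sqrt (real k)" by (simp add: r_def real_sqrt_mult[symmetric])
    also have "sqrt (1 / A) = (1 / A) powr (1 / 2)" using A1 by (simp add: powr_half_sqrt)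
    also have "8 * ((1 / A) powr (1 / 2) * sqrt (real k)) \<le> 8 * ((2 * (real k powr \<delta> * Q powr (- \<delta>))) * sqrt (real k))"
    proof -
      have "(1 / A) powr (1 / 2) \<le> (1 / A) powr \<delta>" using d A1 by (intro powr_mono') auto
      also have "\<dots> \<le> (4 * real k / Q) powr \<delta>"
      proof (rule powr_mono2)
        have "y\<^sup>2 \<le> r\<^sup>2" using False y0 by (intro power_mono) auto
        then have "Q / (4 * A\<^sup>2) \<le> real k / A" using A1 Q0 by (simp add: r_def y_def power_divide power_mult_distrib)
        then have "Q \<le> real k * (4 * A)" using A1 by (simp add: power2_eq_square field_simps)
        then show "1 / A \<le> 4 * real k / Q" using A1 Q0 by (simp add: field_simps)
      qed (use d A1 in auto)
      \<comment> \<open>Since \<delta> <= 1/2, the factor 4^\<delta> is at most 2; it doubles the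
        constant 8 to 16.\<close>
      also have "\<dots> = 4 powr \<delta> * (real k powr \<delta> * Q powr (- \<delta>))"
        using Q0 k0 by (simp add: powr_divide powr_mult powr_minus_divide)
      also have "\<dots> \<le> 2 * (real k powr \<delta> * Q powr (- \<delta>))"
      proof (rule mult_right_mono)
        have "4 powr \<delta> \<le> 4 powr (1 / 2 :: real)" using d by (intro powr_mono) auto
        then show "4 powr \<delta> \<le> (2 :: real)" by (simp add: powr_half_sqrt)
      qed simp
      finally show ?thesis by (intro mult_left_mono mult_right_mono) auto
    qed
    also have "sqrt (real k) = real k powr (1 / 2)" using k0 by (simp add: powr_half_sqrt)
    also have "8 * ((2 * (real k powr \<delta> * Q powr (- \<delta>))) * real k powr (1 / 2)) = 16 * Q powr (- \<delta>) * (real k powr (1 / 2) * real k powr \<delta>)"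
      by simp
    also have "real k powr (1 / 2) * real k powr \<delta> = real k powr (1 / 2 + \<delta>)" by (simp add: powr_add)
    finally show ?thesis by (simp add: Q_def)
  qed
qed

section \<open>The Dirichlet series attached to the ideal classes\<close>

lemma has_sum_Suc_iff:
  "(h has_sum x) {1::nat..} \<longleftrightarrow> ((\<lambda>n. h (Suc n)) has_sum x) UNIV"
proof -
  have "{1::nat..} = Suc ` UNIV" by (auto simp: image_iff) (metis Suc_le_D)
  then show ?thesis by (simp add: has_sum_reindex o_def)
qed

text \<open>The absolutely convergent double sum over pairs (m, d) is regrouped by the product k = m
  d.\<close>

lemma Dirichlet_product:
  fixes f g :: "nat \<Rightarrow> complex"
  assumes f: "summable (\<lambda>n. norm (f (Suc n)))" and g: "summable (\<lambda>n. norm (g (Suc n)))"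
  shows "(\<lambda>k. \<Sum>d | d dvd Suc k. f (Suc k div d) * g d) sums ((\<Sum>n. f (Suc n)) * (\<Sum>n. g (Suc n)))"
proof -
  define N where "N = {1::nat..}"
  have hs: "(h has_sum (\<Sum>n. h (Suc n))) N" if "summable (\<lambda>n. norm (h (Suc n)))" for h :: "nat \<Rightarrow> complex"
    unfolding N_def has_sum_Suc_iff
    by (rule norm_summable_imp_has_sum[OF that summable_sums[OF summable_norm_cancel[OF that]]])
  have as: "(\<lambda>n. norm (h n)) summable_on N" if "summable (\<lambda>n. norm (h (Suc n)))" for h :: "nat \<Rightarrow> complex"
  proof -
    have "((\<lambda>n. norm (h (Suc n))) has_sum (\<Sum>n. norm (h (Suc n)))) UNIV"
      by (rule norm_summable_imp_has_sum) (use that summable_sums[OF that] in simp_all)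
    then have "((\<lambda>n. norm (h n)) has_sum (\<Sum>n. norm (h (Suc n)))) N" unfolding N_def has_sum_Suc_iff .
    then show ?thesis by (rule has_sum_imp_summable)
  qed
  define F where "F = (\<lambda>(m, d). f m * g d)"
  have "(\<lambda>z. norm (F z)) summable_on N \<times> N"
    unfolding Infinite_Sum.abs_summable_on_Sigma_iff
  proof (intro conjI ballI)
    fix m assume "m \<in> N"
    show "(\<lambda>d. norm (F (m, d))) summable_on N"
      using summable_on_cmult_right[OF as[OF g], of "norm (f m)"] by (simp add: F_def norm_mult)
  next
    have "(\<Sum>\<^sub>\<infinity>d\<in>N. norm (F (m, d))) = norm (f m) * (\<Sum>\<^sub>\<infinity>d\<in>N. norm (g d))" for m
      using infsum_cmult_right[of "norm (f m)" "\<lambda>d. norm (g d)" N] as[OF g] by (simp add: F_def norm_mult)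
    moreover have "(\<Sum>\<^sub>\<infinity>d\<in>N. norm (g d)) \<ge> 0" by (intro infsum_nonneg) simp
    ultimately show "(\<lambda>m. norm (\<Sum>\<^sub>\<infinity>d\<in>N. norm (F (m, d)))) summable_on N"
      using summable_on_cmult_left[OF as[OF f], of "\<Sum>\<^sub>\<infinity>d\<in>N. norm (g d)"] by simp
  qed
  then have "F summable_on N \<times> N" by (rule Infinite_Sum.abs_summable_summable)
  moreover have "((\<lambda>d. F (m, d)) has_sum f m * (\<Sum>n. g (Suc n))) N" for m
    using has_sum_cmult_right[OF hs[OF g], of "f m"] by (simp add: F_def)
  moreover have "((\<lambda>m. f m * (\<Sum>n. g (Suc n))) has_sum (\<Sum>n. f (Suc n)) * (\<Sum>n. g (Suc n))) N"
    by (rule has_sum_cmult_left[OF hs[OF f]])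
  ultimately have FG: "(F has_sum (\<Sum>n. f (Suc n)) * (\<Sum>n. g (Suc n))) (N \<times> N)"
    by (intro has_sum_SigmaI) auto
  define D where "D = (SIGMA k:N. {d. d dvd k})"
  define \<phi> where "\<phi> = (\<lambda>(k::nat, d). (k div d, d))"
  have dpos: "d > 0 \<and> k div d > 0" if "k \<in> N" "d dvd k" for k d
    using that by (auto simp: N_def elim!: dvdE)
  have inj: "inj_on \<phi> D"
    by (auto simp: inj_on_def \<phi>_def D_def) (metis dvd_div_mult_self)
  have img: "\<phi> ` D = N \<times> N"
  proof (intro subset_antisym subsetI)
    fix z assume "z \<in> \<phi> ` D"
    then show "z \<in> N \<times> N" using dpos by (force simp: \<phi>_def D_def N_def)
  next
    fix z assume "z \<in> N \<times> N"
    then obtain m d where z: "z = (m, d)" "m \<ge> 1" "d \<ge> 1" by (auto simp: N_def)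
    then have "\<phi> (m * d, d) = z" "(m * d, d) \<in> D" by (auto simp: \<phi>_def D_def N_def)
    then show "z \<in> \<phi> ` D" by (metis imageI)
  qed
  have "(F \<circ> \<phi> has_sum (\<Sum>n. f (Suc n)) * (\<Sum>n. g (Suc n))) D"
    using FG unfolding img[symmetric] has_sum_reindex[OF inj] .
  then have "((\<lambda>k. \<Sum>d | d dvd k. f (k div d) * g d) has_sum (\<Sum>n. f (Suc n)) * (\<Sum>n. g (Suc n))) N"
    unfolding D_def
  proof (rule has_sum_SigmaD)
    fix k assume "k \<in> N"
    then have "finite {d. d dvd k}" by (simp add: N_def)
    from has_sum_finite[OF this, of "\<lambda>d. f (k div d) * g d"]
    show "((\<lambda>d. (F \<circ> \<phi>) (k, d)) has_sum (\<Sum>d | d dvd k. f (k div d) * g d)) {d. d dvd k}"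
      by (simp add: F_def \<phi>_def)
  qed
  then show ?thesis unfolding N_def has_sum_Suc_iff by (rule has_sum_imp_sums)
qed

lemma of_nat_powr_mult: "(of_nat (m * n) :: complex) powr z = of_nat m powr z * of_nat n powr z"
  using powr_times_real[of "of_nat m" "of_nat n" z] by simp

text \<open>On its axis the form represents only the numbers a n^2, each by n and -n, so the terms
  reassemble to \<zeta>(2 w); Re w > 1/2 gives absolute convergence.\<close>

lemma square_series:
  assumes w: "Re w > 1 / 2" and a: "(a::int) > 0"
  shows "(\<lambda>j. of_nat (card {m::int. m \<noteq> 0 \<and> a * m\<^sup>2 = int (Suc j)}) * of_nat (Suc j) powr (- w)) sums
    (2 * of_int a powr (- w) * zeta (2 * w))"
proof -
  define b where "b = nat a"
  have b: "b > 0" "a = int b" using a by (simp_all add: b_def)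
  have w2: "Re (2 * w) > 1" using w by simp
  have term_eq: "2 * of_int a powr (- w) * of_nat (Suc n) powr (- (2 * w)) = 2 * of_nat (b * (Suc n)\<^sup>2) powr (- w)" for n
  proof -
    have "of_nat (b * (Suc n)\<^sup>2) powr (- w) = of_nat b powr (- w) * (of_nat (Suc n) powr (- w) * of_nat (Suc n) powr (- w))"
      unfolding power2_eq_square of_nat_powr_mult ..
    also have "of_nat (Suc n) powr (- w) * of_nat (Suc n) powr (- w) = (of_nat (Suc n) :: complex) powr (- (2 * w))"
      unfolding powr_add[symmetric] by simp
    finally show ?thesis using b by simp
  qed
  have "((\<lambda>n. of_nat (Suc n) powr (- (2 * w))) has_sum zeta (2 * w)) UNIV"
    by (rule norm_summable_imp_has_sum[OF powr_summable_complex[OF w2] zeta_sums[OF w2]])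
  then have "((\<lambda>n. 2 * of_int a powr (- w) * of_nat (Suc n) powr (- (2 * w))) has_sum 2 * of_int a powr (- w) * zeta (2 * w)) UNIV"
    by (rule has_sum_cmult_right)
  then have hs: "((\<lambda>n. 2 * of_nat (b * (Suc n)\<^sup>2) powr (- w)) has_sum 2 * of_int a powr (- w) * zeta (2 * w)) UNIV"
    unfolding term_eq .
  define g where "g = (\<lambda>n. b * (Suc n)\<^sup>2 - 1)"
  have Sg: "Suc (g n) = b * (Suc n)\<^sup>2" for n using b by (simp add: g_def)
  have inj: "inj g"
  proof (rule injI)
    fix x y assume "g x = g y"
    then have "b * (Suc x)\<^sup>2 = b * (Suc y)\<^sup>2" using Sg by metis
    then have "(Suc x)\<^sup>2 = (Suc y)\<^sup>2" using b by simp
    then have "Suc x = Suc y" by (rule power_eq_imp_eq_base) auto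
    then show "x = y" by simp
  qed
  have "((\<lambda>j. 2 * of_nat (Suc j) powr (- w)) \<circ> g has_sum 2 * of_int a powr (- w) * zeta (2 * w)) UNIV"
    using hs unfolding o_def Sg .
  then have "((\<lambda>j. 2 * of_nat (Suc j) powr (- w)) has_sum 2 * of_int a powr (- w) * zeta (2 * w)) (range g)"
    by (simp only: has_sum_reindex[OF inj])
  moreover have "((\<lambda>j. 2 * of_nat (Suc j) powr (- w)) has_sum 2 * of_int a powr (- w) * zeta (2 * w)) (range g) \<longleftrightarrow>
     ((\<lambda>j. of_nat (card {m::int. m \<noteq> 0 \<and> a * m\<^sup>2 = int (Suc j)}) * of_nat (Suc j) powr (- w)) has_sum 2 * of_int a powr (- w) * zeta (2 * w)) UNIV"
  proof (rule has_sum_cong_neutral)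
    fix j assume j: "j \<in> UNIV - range g"
    have "{m::int. m \<noteq> 0 \<and> a * m\<^sup>2 = int (Suc j)} = {}"
    proof (rule ccontr)
      assume "\<not> ?thesis"
      then obtain m where m: "m \<noteq> 0" "a * m\<^sup>2 = int (Suc j)" by blast
      define n where "n = nat \<bar>m\<bar> - 1"
      have "int (Suc n) = \<bar>m\<bar>" using m(1) by (simp add: n_def)
      then have "int (b * (Suc n)\<^sup>2) = a * m\<^sup>2" unfolding of_nat_mult of_nat_power b(2) by simp
      then have "b * (Suc n)\<^sup>2 = Suc j" using m(2) by (simp only: of_nat_eq_iff)
      then have "g n = j" by (simp add: g_def)
      then show False using j by blast
    qed
    then show "of_nat (card {m::int. m \<noteq> 0 \<and> a * m\<^sup>2 = int (Suc j)}) * (of_nat (Suc j) :: complex) powr (- w) = 0"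
      by (simp only: card.empty of_nat_0 mult_zero_left)
  next
    fix j assume "j \<in> range g \<inter> UNIV"
    then obtain n where n: "Suc j = b * (Suc n)\<^sup>2" using Sg by auto
    have "{m::int. m \<noteq> 0 \<and> a * m\<^sup>2 = int (Suc j)} = {int (Suc n), - int (Suc n)}"
    proof (intro subset_antisym subsetI)
      fix m assume "m \<in> {m::int. m \<noteq> 0 \<and> a * m\<^sup>2 = int (Suc j)}"
      then have "a * m\<^sup>2 = a * (int (Suc n))\<^sup>2" unfolding n b(2) by simp
      then have "m\<^sup>2 = (int (Suc n))\<^sup>2" using a by simp
      then show "m \<in> {int (Suc n), - int (Suc n)}" unfolding power2_eq_iff by blast
    qed (auto simp: n b(2) simp del: of_nat_Suc)
    moreover have "card {int (Suc n), - int (Suc n)} = 2" by simp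
    ultimately show "2 * (of_nat (Suc j) :: complex) powr (- w) =
      of_nat (card {m::int. m \<noteq> 0 \<and> a * m\<^sup>2 = int (Suc j)}) * of_nat (Suc j) powr (- w)"
      by (simp only: of_nat_numeral)
  qed auto
  ultimately show ?thesis by (intro has_sum_imp_sums) simp
qed

section \<open>Representations by the reduced forms of all classes\<close>

context imag_quadratic
begin

definition fB :: "int \<Rightarrow> int" where "fB x = int q - 2 * x"
definition fC :: "int \<Rightarrow> int \<Rightarrow> int" where "fC a x = f x div a"

lemma Q_eq: "Q a x m n = a * m\<^sup>2 + fB x * m * n + fC a x * n\<^sup>2"
  by (simp add: Q_def fB_def fC_def)

lemma transversal_form:
  assumes "is_transversal T" "(a, x) \<in> T"
  shows "a > 0" "\<bar>fB x\<bar> \<le> a" "a \<le> fC a x" "4 * a * fC a x - (fB x)\<^sup>2 = int q" "3 * a\<^sup>2 \<le> int q" "a \<le> int q"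
proof -
  note t = transversalD(3)[OF assms]
  show a: "a > 0" and B: "\<bar>fB x\<bar> \<le> a" using t by (simp_all add: fB_def)
  have af: "a * fC a x = f x" using t by (simp add: fC_def)
  then have "a * a \<le> a * fC a x" using t by simp
  then show C: "a \<le> fC a x" using a by simp
  have "4 * f x = (2 * x - int q)\<^sup>2 + int q" by (rule fp_eq[OF q_mod])
  moreover have "(2 * x - int q)\<^sup>2 = (fB x)\<^sup>2" by (simp add: fB_def power2_commute)
  ultimately show disc: "4 * a * fC a x - (fB x)\<^sup>2 = int q" using af by (simp add: mult.assoc)
  have "(fB x)\<^sup>2 \<le> a\<^sup>2" using B a by (simp add: abs_le_square_iff[symmetric])
  moreover have "a * a \<le> a * fC a x" using a C by (intro mult_left_mono) auto
  ultimately show "3 * a\<^sup>2 \<le> int q" using disc by (simp add: power2_eq_square)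
  moreover have "a * 1 \<le> a * a" using a by (intro mult_left_mono) auto
  ultimately show "a \<le> int q" by (simp add: power2_eq_square)
qed

lemma Q_finite:
  assumes T: "is_transversal T" "(a, x) \<in> T"
  shows "finite {(m, n). Q a x m n \<le> int k}"
proof (rule finite_subset)
  note t = transversal_form[OF T]
  show "{(m, n). Q a x m n \<le> int k} \<subseteq> off_axis a (fB x) (fC a x) k \<union> ({- int k..int k} \<times> {0})"
  proof
    fix p assume "p \<in> {(m, n). Q a x m n \<le> int k}"
    then obtain m n where p: "p = (m, n)" "Q a x m n \<le> int k" by blast
    show "p \<in> off_axis a (fB x) (fC a x) k \<union> ({- int k..int k} \<times> {0})"
    proof (cases "n = 0")
      case True
      then have "a * m\<^sup>2 \<le> int k" using p by (simp add: Q_eq)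
      moreover have "1 * m\<^sup>2 \<le> a * m\<^sup>2" using t(1) by (intro mult_right_mono) auto
      moreover have "\<bar>m\<bar> * 1 \<le> \<bar>m\<bar> * \<bar>m\<bar>"
      proof (cases "m = 0")
        case False
        then have "1 \<le> \<bar>m\<bar>" by linarith
        then show ?thesis by (rule mult_left_mono) simp
      qed simp
      ultimately have "\<bar>m\<bar> \<le> int k" by (simp add: power2_eq_square abs_mult_self_eq)
      then show ?thesis using p True by auto
    qed (use p in \<open>auto simp: off_axis_def Q_eq\<close>)
  qed
  show "finite (off_axis a (fB x) (fC a x) k \<union> ({- int k..int k} \<times> {0}))"
    using off_axis_count(2)[OF t(1,4,5)] by simp
qed

text \<open>As |b| <= a <= c, the form is at least a (m^2 - |m n| + n^2), and the second factor is a
  positive integer.\<close>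

lemma Q_ge:
  assumes T: "is_transversal T" "(a, x) \<in> T" and nz: "(m, n) \<noteq> (0, 0)"
  shows "Q a x m n \<ge> a"
proof -
  note t = transversal_form[OF T]
  have "fB x * m * n \<ge> - (a * (\<bar>m\<bar> * \<bar>n\<bar>))"
  proof -
    have "\<bar>fB x * m * n\<bar> = \<bar>fB x\<bar> * (\<bar>m\<bar> * \<bar>n\<bar>)" by (simp add: abs_mult)
    also have "\<dots> \<le> a * (\<bar>m\<bar> * \<bar>n\<bar>)" using t(2) by (intro mult_right_mono) auto
    finally show ?thesis by linarith
  qed
  moreover have "fC a x * n\<^sup>2 \<ge> a * n\<^sup>2" using t(3) by (intro mult_right_mono) auto
  moreover have "a * m\<^sup>2 - a * (\<bar>m\<bar> * \<bar>n\<bar>) + a * n\<^sup>2 \<ge> a"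
  proof -
    have "m\<^sup>2 - \<bar>m\<bar> * \<bar>n\<bar> + n\<^sup>2 = (\<bar>m\<bar> - \<bar>n\<bar>)\<^sup>2 + \<bar>m\<bar> * \<bar>n\<bar>" by (simp add: power2_eq_square algebra_simps abs_mult_self_eq)
    also have "\<dots> \<ge> 1"
    proof (cases "\<bar>m\<bar> = \<bar>n\<bar>")
      case True
      then have "m \<noteq> 0" "n \<noteq> 0" using nz by auto
      then have "\<bar>m\<bar> * \<bar>n\<bar> > 0" by (intro mult_pos_pos) auto
      then show ?thesis using zero_le_power2[of "\<bar>m\<bar> - \<bar>n\<bar>"] by linarith
    next
      case False
      then have "(\<bar>m\<bar> - \<bar>n\<bar>)\<^sup>2 > 0" by simp
      moreover have "\<bar>m\<bar> * \<bar>n\<bar> \<ge> 0" by simp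
      ultimately show ?thesis by linarith
    qed
    finally have "a * 1 \<le> a * (m\<^sup>2 - \<bar>m\<bar> * \<bar>n\<bar> + n\<^sup>2)" using t(1) by (intro mult_left_mono) auto
    then show ?thesis by (simp add: algebra_simps)
  qed
  ultimately show ?thesis unfolding Q_eq by linarith
qed

definition reps :: "int \<Rightarrow> int \<Rightarrow> nat \<Rightarrow> (int \<times> int) set" where
  "reps a x k = {(m, n). (m, n) \<noteq> (0, 0) \<and> Q a x m n = int k}"
definition prim_reps :: "int \<Rightarrow> int \<Rightarrow> nat \<Rightarrow> (int \<times> int) set" where
  "prim_reps a x k = {(m, n). coprime m n \<and> Q a x m n = int k}"

lemma finite_reps:
  assumes "is_transversal T" "(a, x) \<in> T"
  shows "finite (reps a x k)" "finite (prim_reps a x k)"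
proof -
  have "reps a x k \<subseteq> {(m, n). Q a x m n \<le> int k}" "prim_reps a x k \<subseteq> {(m, n). Q a x m n \<le> int k}"
    by (auto simp: reps_def prim_reps_def)
  then show "finite (reps a x k)" "finite (prim_reps a x k)"
    using finite_subset[OF _ Q_finite[OF assms, of k]] by simp_all
qed

text \<open>Dividing (m, n) by its gcd g leaves a primitive representation of k/g^2, which matches
  the shape of \<open>form_count\<close>.\<close>

lemma card_reps:
  assumes T: "is_transversal T" "(a, x) \<in> T" and k: "k > 0"
  shows "card (reps a x k) = (\<Sum>g | g ^ 2 dvd k. card (prim_reps a x (k div g ^ 2)))"
proof -
  define D where "D = {g. g ^ 2 dvd k}"
  have D_le: "g \<le> k" "g > 0" if "g \<in> D" for g
  proof -
    have "g dvd k" using that unfolding D_def by (metis dvd_mult_left mem_Collect_eq power2_eq_square)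
    then show "g \<le> k" "g > 0" using k by (auto intro: dvd_imp_le dvd_pos_nat)
  qed
  have finD: "finite D" by (rule finite_subset[of _ "{..k}"]) (use D_le in auto)
  define h where "h = (\<lambda>(g::nat, m::int, n::int). (int g * m, int g * n))"
  have Qg: "Q a x (i * m) (i * n) = i\<^sup>2 * Q a x m n" for i m n
    by (simp add: Q_eq power2_eq_square algebra_simps)
  have "bij_betw h (SIGMA g:D. prim_reps a x (k div g ^ 2)) (reps a x k)"
  proof (rule bij_betwI')
    fix u v assume uv: "u \<in> (SIGMA g:D. prim_reps a x (k div g ^ 2))" "v \<in> (SIGMA g:D. prim_reps a x (k div g ^ 2))"
    obtain g m n g' m' n' where u: "u = (g, m, n)" "v = (g', m', n')" by (metis surj_pair)
    have cop: "coprime m n" "coprime m' n'" "g > 0" "g' > 0" using uv D_le by (auto simp: u prim_reps_def)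
    show "(h u = h v) = (u = v)"
    proof
      assume eq: "h u = h v"
      have "gcd (int g * m) (int g * n) = int g" "gcd (int g' * m') (int g' * n') = int g'"
        using cop by (simp_all add: gcd_mult_left)
      then have "g = g'" using eq by (simp add: h_def u)
      then show "u = v" using eq cop by (simp add: h_def u)
    qed simp
  next
    fix u assume "u \<in> (SIGMA g:D. prim_reps a x (k div g ^ 2))"
    then obtain g m n where u: "u = (g, m, n)" "g \<in> D" "coprime m n" "Q a x m n = int (k div g ^ 2)"
      by (auto simp: prim_reps_def)
    then have "Q a x (int g * m) (int g * n) = int (g ^ 2 * (k div g ^ 2))" unfolding Qg by simp
    also have "\<dots> = int k" using u(2) by (simp add: D_def)
    finally show "h u \<in> reps a x k" using u(3) D_le(2)[OF u(2)] by (auto simp: h_def u(1) reps_def)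
  next
    fix p assume "p \<in> reps a x k"
    then obtain m n where p: "p = (m, n)" "(m, n) \<noteq> (0, 0)" "Q a x m n = int k" by (auto simp: reps_def)
    define i where "i = gcd m n"
    have i0: "i > 0" using p(2) by (auto simp: i_def)
    obtain m' n' where mn: "m = i * m'" "n = i * n'" unfolding i_def by (metis dvd_def gcd_dvd1 gcd_dvd2)
    have gi: "gcd m n = i" by (simp add: i_def)
    have "i * gcd m' n' = gcd (i * m') (i * n')" using i0 by (simp add: gcd_mult_left)
    also have "\<dots> = i" by (simp only: mn[symmetric] gi)
    finally have "i * gcd m' n' = i" .
    then have cop: "coprime m' n'" using i0 by (simp add: coprime_iff_gcd_eq_1)
    define g where "g = nat i"
    have g: "int g = i" using i0 by (simp add: g_def)
    have ki: "int k = int (g ^ 2) * Q a x m' n'" using p(3) unfolding mn Qg by (simp add: g)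
    then have "int (g ^ 2) dvd int k" by simp
    then have gk: "g ^ 2 dvd k" by (simp only: int_dvd_int_iff)
    have "int (k div g ^ 2) = int k div int (g ^ 2)" by (rule zdiv_int)
    also have "\<dots> = Q a x m' n'" unfolding ki using i0 g by simp
    finally have "(g, m', n') \<in> (SIGMA g:D. prim_reps a x (k div g ^ 2))" using cop gk by (simp add: D_def prim_reps_def)
    moreover have "p = h (g, m', n')" by (simp add: h_def p(1) mn g)
    ultimately show "\<exists>u\<in>(SIGMA g:D. prim_reps a x (k div g ^ 2)). p = h u" by blast
  qed
  then have "card (reps a x k) = card (SIGMA g:D. prim_reps a x (k div g ^ 2))" by (rule bij_betw_same_card[symmetric])
  also have "\<dots> = (\<Sum>g\<in>D. card (prim_reps a x (k div g ^ 2)))"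
    using finD finite_reps(2)[OF T] by (intro card_SigmaI) auto
  finally show ?thesis by (simp add: D_def)
qed

lemma sum_prim_reps:
  assumes T: "is_transversal T" and k: "k > 0"
  shows "(\<Sum>(a, x)\<in>T. card (prim_reps a x k)) = 2 * rho (int q) k"
proof -
  have "{((a, x), m, n). (a, x) \<in> T \<and> coprime m n \<and> Q a x m n = int k} = (SIGMA t:T. case t of (a, x) \<Rightarrow> prim_reps a x k)"
    by (auto simp: prim_reps_def)
  moreover have "card (SIGMA t:T. case t of (a, x) \<Rightarrow> prim_reps a x k) = (\<Sum>t\<in>T. card (case t of (a, x) \<Rightarrow> prim_reps a x k))"
    using transversalD(1)[OF T] finite_reps(2)[OF T] by (intro card_SigmaI) auto
  ultimately show ?thesis using transversal_count[OF T k] by (simp add: case_prod_unfold)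
qed

lemma sum_reps:
  assumes T: "is_transversal T" and k: "k > 0"
  shows "(\<Sum>(a, x)\<in>T. card (reps a x k)) = 2 * form_count (int q) k"
proof -
  have "(\<Sum>(a, x)\<in>T. card (reps a x k)) = (\<Sum>(a, x)\<in>T. \<Sum>g | g ^ 2 dvd k. card (prim_reps a x (k div g ^ 2)))"
    using card_reps[OF T _ k] by (intro sum.cong refl) auto
  also have "\<dots> = (\<Sum>g | g ^ 2 dvd k. \<Sum>(a, x)\<in>T. card (prim_reps a x (k div g ^ 2)))"
    unfolding case_prod_unfold by (rule sum.swap)
  also have "\<dots> = (\<Sum>g | g ^ 2 dvd k. 2 * rho (int q) (k div g ^ 2))"
  proof (intro sum.cong refl sum_prim_reps[OF T])
    fix g assume "g \<in> {g. g ^ 2 dvd k}"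
    then obtain j where "k = g ^ 2 * j" by blast
    then show "k div g ^ 2 > 0" using k by auto
  qed
  finally show ?thesis by (simp add: form_count_def sum_distrib_left)
qed

lemma sum_off_axis:
  assumes T: "is_transversal T" "(a, x) \<in> T"
  shows "(\<Sum>j<k. card {(m, n). n \<noteq> 0 \<and> Q a x m n = int (Suc j)}) = card (off_axis a (fB x) (fC a x) k)"
proof (induction k)
  case 0
  have "off_axis a (fB x) (fC a x) 0 = {}"
  proof (rule ccontr)
    assume "\<not> ?thesis"
    then obtain m n where "n \<noteq> 0" "Q a x m n \<le> 0" by (auto simp: off_axis_def Q_eq)
    then show False using Q_ge[OF T, of m n] transversal_form(1)[OF T] by simp
  qed
  then show ?case by simp
next
  case (Suc k)
  have "off_axis a (fB x) (fC a x) (Suc k) = off_axis a (fB x) (fC a x) k \<union> {(m, n). n \<noteq> 0 \<and> Q a x m n = int (Suc k)}"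
    by (auto simp: off_axis_def Q_eq)
  moreover have "off_axis a (fB x) (fC a x) k \<inter> {(m, n). n \<noteq> 0 \<and> Q a x m n = int (Suc k)} = {}"
    by (auto simp: off_axis_def Q_eq)
  moreover have "finite (off_axis a (fB x) (fC a x) k)"
    using off_axis_count(2) transversal_form[OF T] by blast
  moreover have "finite {(m, n). n \<noteq> 0 \<and> Q a x m n = int (Suc k)}"
    by (rule finite_subset[OF _ Q_finite[OF T, of "Suc k"]]) auto
  ultimately show ?case using Suc by (simp add: card_Un_disjoint)
qed

lemma card_reps_split:
  assumes T: "is_transversal T" "(a, x) \<in> T"
  shows "card (reps a x k) = card {m. m \<noteq> 0 \<and> a * m\<^sup>2 = int k} + card {(m, n). n \<noteq> 0 \<and> Q a x m n = int k}"
proof -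
  have eq: "reps a x k = (\<lambda>m. (m, 0)) ` {m. m \<noteq> 0 \<and> a * m\<^sup>2 = int k} \<union> {(m, n). n \<noteq> 0 \<and> Q a x m n = int k}"
    by (auto simp: reps_def Q_eq)
  have fin: "finite (reps a x k)" by (rule finite_reps(1)[OF T])
  then have "finite ((\<lambda>m. (m, 0::int)) ` {m. m \<noteq> 0 \<and> a * m\<^sup>2 = int k})" "finite {(m, n). n \<noteq> 0 \<and> Q a x m n = int k}"
    unfolding eq by simp_all
  then have "card (reps a x k) = card ((\<lambda>m. (m, 0::int)) ` {m. m \<noteq> 0 \<and> a * m\<^sup>2 = int k}) + card {(m, n). n \<noteq> 0 \<and> Q a x m n = int k}"
    unfolding eq by (rule card_Un_disjoint) auto
  also have "card ((\<lambda>m. (m, 0::int)) ` {m. m \<noteq> 0 \<and> a * m\<^sup>2 = int k}) = card {m. m \<noteq> 0 \<and> a * m\<^sup>2 = int k}"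
    by (rule card_image) (auto intro: inj_onI)
  finally show ?thesis .
qed

text \<open>
  The series \<open>\<Sum>\<^sub>k (R(k) - h\<kappa>)k\<^sup>-\<^sup>s\<close>, where \<open>R(k)\<close> counts the representations of \<open>k\<close> by all classes, equals
  \<open>\<zeta>(s)(2L(s) - h\<kappa>)\<close> and hence vanishes at a zero of \<open>\<zeta>\<close>. The representations on the axis \<open>n = 0\<close>
  contribute \<open>2a\<^sup>-\<^sup>s\<zeta>(2s)\<close> per class, and the others are small by Abel summation.
\<close>

theorem class_sum_bound:
  assumes psi: "odd_real_primitive (int q) \<psi>" and T: "is_transversal T"
    and z: "zeta w = 0" "w \<noteq> 1" and d: "0 < \<delta>" "\<delta> \<le> 1 / 2" "1 / 2 + \<delta> < Re w"
  shows "norm (\<Sum>(a, x)\<in>T. (of_int a :: complex) powr (- w)) * norm (zeta (2 * w)) \<le>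
     real (card T) * (8 * real q powr (- \<delta>) * norm w * (\<Sum>k. real (Suc k) powr (1 / 2 + \<delta> - Re w - 1)))"
proof -
  interpret psi: odd_real_primitive "int q" \<psi> by (rule psi)
  define \<alpha> where "\<alpha> = 1 / 2 + \<delta>"
  define H where "H = {s. Re s > \<alpha>}"
  have q0: "q > 0" using q4 by simp
  define r0 where "r0 = (\<lambda>(t :: int \<times> int) k. card {m::int. m \<noteq> 0 \<and> fst t * m\<^sup>2 = int k})"
  define r1 where "r1 = (\<lambda>t k. card {(m, n). n \<noteq> 0 \<and> Q (fst t) (snd t) m n = int k})"
  define \<kappa> where "\<kappa> = kappa (real q)"
  \<comment> \<open>Subtracting the common density \<kappa> leaves partial sums of order N^(1/2 +
    \<delta>), so the series \<open>E\<close> is holomorphic for Re s > 1/2 + \<delta>, a region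
    that contains w.\<close>
  define cc where "cc = (\<lambda>t k. complex_of_real (real (r1 t k) - \<kappa>))"
  define E where "E = (\<lambda>t s. \<Sum>k. cc t (Suc k) * of_nat (Suc k) powr (- s))"
  define B where "B = 16 * real q powr (- \<delta>)"
  have bd: "norm (\<Sum>k<N. cc t (Suc k)) \<le> B * real N powr \<alpha>" if t: "t \<in> T" and N: "N \<ge> 1" for t :: "int \<times> int" and N
  proof -
    obtain a x where ax: "t = (a, x)" by (cases t)
    then have aT: "(a, x) \<in> T" using t by simp
    have "(\<Sum>k<N. cc t (Suc k)) = of_real (real (\<Sum>k<N. r1 t (Suc k)) - \<kappa> * real N)"
      by (simp add: cc_def sum_subtractf mult.commute)
    also have "(\<Sum>k<N. r1 t (Suc k)) = card (off_axis a (fB x) (fC a x) N)"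
      using sum_off_axis[OF T aT, of N] by (simp add: r1_def ax)
    finally have "norm (\<Sum>k<N. cc t (Suc k)) = \<bar>real (card (off_axis a (fB x) (fC a x) N)) - \<kappa> * real N\<bar>"
      by (simp only: norm_of_real)
    also have "\<dots> \<le> B * real N powr \<alpha>"
      using off_axis_bound[OF transversal_form(1,4,5)[OF T aT] N d(1,2)] by (simp add: B_def \<alpha>_def \<kappa>_def)
    finally show ?thesis .
  qed
  have B0: "B \<ge> 0" by (simp add: B_def)
  have \<alpha>0: "\<alpha> \<ge> 0" using d by (simp add: \<alpha>_def)
  have E: "E t holomorphic_on H" "\<And>s. s \<in> H \<Longrightarrow> (\<lambda>k. cc t (Suc k) * of_nat (Suc k) powr (- s)) sums E t s"
    "\<And>s. s \<in> H \<Longrightarrow> norm (E t s) \<le> B * norm s * (\<Sum>k. real (Suc k) powr (\<alpha> - Re s - 1))" if t: "t \<in> T" for t :: "int \<times> int"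
    using Dirichlet_series_Abel[OF bd[OF t] \<alpha>0 B0] unfolding H_def E_def by blast+
  define ax where "ax = (\<lambda>s. \<Sum>t\<in>T. 2 * of_int (fst t) powr (- s) * zeta (2 * s))"
  define F where "F = (\<lambda>s. ax s + (\<Sum>t\<in>T. E t s))"
  have apos: "fst t > 0" if "t \<in> T" for t using transversal_form(1)[OF T, of "fst t" "snd t"] that by simp
  have "zeta \<circ> (\<lambda>s. 2 * s) holomorphic_on H"
  proof (rule holomorphic_on_compose_gen[OF _ zeta_holomorphic])
    show "(\<lambda>s. 2 * s) ` H \<subseteq> - {1}"
    proof
      fix u assume "u \<in> (\<lambda>s. 2 * s) ` H"
      then have "Re u > 1" using d(1) by (auto simp: H_def \<alpha>_def)
      then show "u \<in> - {1}" by auto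
    qed
  qed (intro holomorphic_intros)
  then have z2: "(\<lambda>s. zeta (2 * s)) holomorphic_on H" by (simp add: o_def)
  have Fhol: "F holomorphic_on H" unfolding F_def ax_def
    by (intro holomorphic_intros z2 E(1)) auto
  define h where "h = real (card T)"
  have total: "(\<Sum>t\<in>T. of_nat (r0 t k) + cc t k) = of_int (2 * (\<Sum>d | d dvd k. \<psi> (int d))) - of_real (h * \<kappa>)" if k: "k > 0" for k
  proof -
    have "(\<Sum>t\<in>T. of_nat (r0 t k) + cc t k) = of_nat (\<Sum>t\<in>T. r0 t k + r1 t k) - (of_real (h * \<kappa>) :: complex)"
      by (simp add: cc_def sum.distrib sum_subtractf h_def)
    also have "(\<Sum>t\<in>T. r0 t k + r1 t k) = (\<Sum>(a, x)\<in>T. card (reps a x k))"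
      using card_reps_split[OF T] by (intro sum.cong refl) (auto simp: r0_def r1_def)
    also have "\<dots> = 2 * form_count (int q) k" by (rule sum_reps[OF T k])
    also have "(of_nat (2 * form_count (int q) k) :: complex) = of_int (2 * int (form_count (int q) k))" by simp
    finally show ?thesis unfolding psi.form_count_eq[OF k] .
  qed
  have Fsums: "(\<lambda>k. (of_int (2 * (\<Sum>d | d dvd Suc k. \<psi> (int d))) - of_real (h * \<kappa>)) * of_nat (Suc k) powr (- s)) sums F s" if s: "s \<in> H" for s
  proof -
    have "Re s > 1 / 2" using s d(1) by (simp add: H_def \<alpha>_def)
    then have "(\<lambda>k. (\<Sum>t\<in>T. of_nat (r0 t (Suc k)) * of_nat (Suc k) powr (- s)) +
        (\<Sum>t\<in>T. cc t (Suc k) * of_nat (Suc k) powr (- s))) sums F s"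
      unfolding F_def ax_def r0_def by (intro sums_add sums_sum E(2)[OF _ s] square_series apos)
    then show ?thesis unfolding total[OF zero_less_Suc, symmetric] sum_distrib_right sum.distrib[symmetric] distrib_right .
  qed
  define L where "L = (\<lambda>s. \<Sum>k. of_int (\<psi> (int (Suc k))) * (of_nat (Suc k) :: complex) powr (- s))"
  have psi1: "norm (of_int (\<psi> n) :: complex) \<le> 1" for n
    using psi.chi_cases[of n] by auto
  have Lb: "norm (\<Sum>k<N. of_int (\<psi> (int (Suc k))) :: complex) \<le> real q * real N powr 0" if "N \<ge> 1" for N
  proof -
    have per: "\<psi> (int (Suc (k + q))) = \<psi> (int (Suc k))" for k
      using psi.per[of "int (Suc k)"] by (simp add: algebra_simps)
    \<comment> \<open>The character is odd, so n -> -n negates the sum over a full period.\<close>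
    have full: "(\<Sum>k<q. \<psi> (int (Suc k))) = 0"
    proof -
      have "(\<Sum>k<q. \<psi> (int (Suc k))) = (\<Sum>n\<in>{0..<int q}. \<psi> (n + 1))"
        by (rule sum.reindex_bij_witness[of _ nat int]) (auto simp: add.commute)
      also have "\<dots> = (\<Sum>n\<in>{0..<int q}. \<psi> n)"
        using psi.sum_reindex[of \<psi> 1 1] psi.chi_mod by simp
      finally have 1: "(\<Sum>k<q. \<psi> (int (Suc k))) = (\<Sum>n\<in>{0..<int q}. \<psi> n)" .
      have "(\<Sum>n\<in>{0..<int q}. \<psi> n) = (\<Sum>n\<in>{0..<int q}. \<psi> (- 1 * n + 0))"
        using psi.sum_reindex[of \<psi> "- 1" 0] psi.chi_mod by simp
      also have "\<dots> = - (\<Sum>n\<in>{0..<int q}. \<psi> n)"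
        using psi.mult[of "- 1"] psi.neg by (simp add: sum_negf[symmetric])
      finally show ?thesis using 1 by simp
    qed
    have "\<bar>\<Sum>k<N. \<psi> (int (Suc k))\<bar> \<le> int q" for N
    proof (induction N rule: less_induct)
      case (less N)
      show ?case
      proof (cases "N \<le> q")
        case True
        have "\<bar>\<Sum>k<N. \<psi> (int (Suc k))\<bar> \<le> (\<Sum>k<N. \<bar>\<psi> (int (Suc k))\<bar>)" by (rule sum_abs)
        also have "\<dots> \<le> (\<Sum>k<N. 1)"
        proof (rule sum_mono)
          show "\<bar>\<psi> (int (Suc k))\<bar> \<le> 1" for k using psi.chi_cases[of "int (Suc k)"] by auto
        qed
        finally show ?thesis using True by simp
      next
        case False
        then obtain M where M: "N = M + q" by (metis le_add_diff_inverse2 nat_le_linear)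
        have "(\<Sum>k<N. \<psi> (int (Suc k))) = (\<Sum>k<q. \<psi> (int (Suc k))) + (\<Sum>k\<in>{q..<q + M}. \<psi> (int (Suc k)))"
          using sum.atLeastLessThan_concat[of 0 q "q + M" "\<lambda>k. \<psi> (int (Suc k))"] M
          by (simp add: atLeast0LessThan add.commute)
        also have "(\<Sum>k\<in>{q..<q + M}. \<psi> (int (Suc k))) = (\<Sum>k<M. \<psi> (int (Suc (k + q))))"
          by (rule sum.reindex_bij_witness[of _ "\<lambda>k. k + q" "\<lambda>k. k - q"]) auto
        finally have "(\<Sum>k<N. \<psi> (int (Suc k))) = (\<Sum>k<M. \<psi> (int (Suc k)))" unfolding per full by simp
        moreover have "M < N" using M q0 by simp
        ultimately show ?thesis using less by simp
      qed
    qed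
    then have "real_of_int \<bar>\<Sum>k<N. \<psi> (int (Suc k))\<bar> \<le> of_int (int q)" by (simp only: of_int_le_iff)
    then have "\<bar>real_of_int (\<Sum>k<N. \<psi> (int (Suc k)))\<bar> \<le> real q" by simp
    moreover have "norm (\<Sum>k<N. of_int (\<psi> (int (Suc k))) :: complex) = \<bar>real_of_int (\<Sum>k<N. \<psi> (int (Suc k)))\<bar>"
      by (metis norm_of_int of_int_sum)
    ultimately show ?thesis using that by simp
  qed
  have Lhol: "L holomorphic_on {s. Re s > 0}"
    unfolding L_def by (rule Dirichlet_series_Abel(1)[OF Lb]) auto
  define Y where "Y = (\<lambda>s. zeta s * (2 * L s - of_real (h * \<kappa>)))"
  have FY: "F s = Y s" if s: "Re s > 1" for s
  proof -
    have sH: "s \<in> H" using s d(2) by (simp add: H_def \<alpha>_def)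
    define fz where "fz = (\<lambda>n. (of_nat n :: complex) powr (- s))"
    define gz where "gz = (\<lambda>n. of_int (\<psi> (int n)) * (of_nat n :: complex) powr (- s))"
    have fs: "summable (\<lambda>n. norm (fz (Suc n)))" unfolding fz_def by (rule powr_summable_complex[OF s])
    have gs: "summable (\<lambda>n. norm (gz (Suc n)))"
    proof (rule summable_comparison_test'[OF fs])
      show "norm (norm (gz (Suc n))) \<le> norm (fz (Suc n))" for n
        unfolding fz_def gz_def norm_mult using psi1[of "int (Suc n)"] by (simp add: mult_left_le_one_le)
    qed
    have zs: "(\<lambda>n. fz (Suc n)) sums zeta s" unfolding fz_def by (rule zeta_sums[OF s])
    have "(\<lambda>k. \<Sum>d | d dvd Suc k. fz (Suc k div d) * gz d) sums (zeta s * L s)"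
      using Dirichlet_product[OF fs gs] sums_unique[OF zs] by (simp add: L_def gz_def)
    moreover have "(\<Sum>d | d dvd Suc k. fz (Suc k div d) * gz d) = of_int (\<Sum>d | d dvd Suc k. \<psi> (int d)) * fz (Suc k)" for k
    proof -
      have "fz (Suc k div d) * gz d = of_int (\<psi> (int d)) * fz (Suc k)" if "d dvd Suc k" for d
      proof -
        have "fz (Suc k) = fz (Suc k div d) * of_nat d powr (- s)"
          using that of_nat_powr_mult[of "Suc k div d" d "- s"] by (simp add: fz_def del: of_nat_Suc)
        then show ?thesis by (simp add: gz_def)
      qed
      then show ?thesis by (simp add: sum_distrib_right)
    qed
    ultimately have "(\<lambda>k. of_int (\<Sum>d | d dvd Suc k. \<psi> (int d)) * fz (Suc k)) sums (zeta s * L s)" by simp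
    then have "(\<lambda>k. 2 * (of_int (\<Sum>d | d dvd Suc k. \<psi> (int d)) * fz (Suc k)) - of_real (h * \<kappa>) * fz (Suc k)) sums
        (2 * (zeta s * L s) - of_real (h * \<kappa>) * zeta s)"
      by (intro sums_diff sums_mult zs)
    moreover have "(\<lambda>k. 2 * (of_int (\<Sum>d | d dvd Suc k. \<psi> (int d)) * fz (Suc k)) - of_real (h * \<kappa>) * fz (Suc k)) sums F s"
      using Fsums[OF sH] by (simp add: fz_def algebra_simps)
    ultimately have "F s = 2 * (zeta s * L s) - of_real (h * \<kappa>) * zeta s" using sums_unique2 by blast
    then show ?thesis by (simp add: Y_def algebra_simps)
  qed
  have wH: "w \<in> H" using d(3) by (simp add: H_def \<alpha>_def)
  \<comment> \<open>The point 1 is removed because \<open>zeta\<close> has an arbitrary value there;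
    the punctured half-plane is still connected.\<close>
  have "F w = Y w"
  proof (rule analytic_continuation_open[of "{s. Re s > 1}" "H - {1}" F Y])
    show "open {s. Re s > 1}" by (rule open_halfplane)
    show "open (H - {1})" unfolding H_def by (intro open_Diff open_halfplane) auto
    have "2 \<in> {s. Re s > 1}" by simp
    then show "{s. Re s > 1} \<noteq> {}" by blast
    show "connected (H - {1})"
      unfolding H_def by (intro connected_open_delete open_halfplane connected_halfplane) simp
    show "{s. Re s > 1} \<subseteq> H - {1}" using d(2) by (auto simp: H_def \<alpha>_def)
    show "F holomorphic_on H - {1}" using Fhol by (rule holomorphic_on_subset) auto
    have "L holomorphic_on H - {1}" using Lhol by (rule holomorphic_on_subset) (use d(1) in \<open>auto simp: H_def \<alpha>_def\<close>)
    moreover have "zeta holomorphic_on H - {1}" using zeta_holomorphic by (rule holomorphic_on_subset) auto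
    ultimately show "Y holomorphic_on H - {1}" unfolding Y_def by (intro holomorphic_intros)
    show "F s = Y s" if "s \<in> {s. Re s > 1}" for s using FY that by simp
  qed (use wH z in auto)
  then have "F w = 0" using z by (simp add: Y_def)
  then have "norm (ax w) = norm (\<Sum>t\<in>T. E t w)" unfolding F_def by (metis add_eq_0_iff norm_minus_cancel)
  also have "\<dots> \<le> (\<Sum>t\<in>T. B * norm w * (\<Sum>k. real (Suc k) powr (\<alpha> - Re w - 1)))"
    by (rule sum_norm_le) (rule E(3)[OF _ wH])
  finally have "norm (ax w) \<le> real (card T) * (B * norm w * (\<Sum>k. real (Suc k) powr (\<alpha> - Re w - 1)))" by simp
  moreover have "ax w = 2 * (\<Sum>(a, x)\<in>T. of_int a powr (- w)) * zeta (2 * w)"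
    unfolding ax_def by (simp add: sum_distrib_left sum_distrib_right case_prod_unfold)
  ultimately show ?thesis by (simp add: norm_mult B_def \<alpha>_def mult_ac)
qed

end

section \<open>The class sum is not too small\<close>

context imag_quadratic
begin

definition low :: "nat \<Rightarrow> bool" where "low k \<longleftrightarrow> 4 * k\<^sup>2 < q"

text \<open>Off the axis 4 a k >= q n^2 >= q, and a <= k since a is the least value of the form;
  this gives q <= 4 k^2 against \<open>low k\<close>. So a low number is represented primitively
  only as the leading coefficient itself.\<close>

lemma low_prim_reps:
  assumes T: "is_transversal T" "(a, x) \<in> T" and k: "k > 0" "low k"
  shows "prim_reps a x k = (if a = int k then {(1, 0), (- 1, 0)} else {})"
proof -
  note t = transversal_form[OF T]
  have n0: "n = 0" if "coprime m n" "Q a x m n = int k" for m n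
  proof (rule ccontr)
    assume n: "n \<noteq> 0"
    have "a \<le> int k" using Q_ge[OF T, of m n] that n by simp
    have "4 * a * Q a x m n = (2 * a * m + fB x * n)\<^sup>2 + int q * n\<^sup>2"
      unfolding t(4)[symmetric] Q_eq by (simp add: power2_eq_square algebra_simps)
    then have "4 * a * int k = (2 * a * m + fB x * n)\<^sup>2 + int q * n\<^sup>2" using that(2) by simp
    moreover have "n\<^sup>2 \<ge> 1" using n by (simp add: int_one_le_iff_zero_less)
    then have "int q * 1 \<le> int q * n\<^sup>2" by (intro mult_left_mono) auto
    ultimately have "int q \<le> 4 * a * int k" using zero_le_power2[of "2 * a * m + fB x * n"] by linarith
    also have "\<dots> \<le> 4 * int k * int k" using \<open>a \<le> int k\<close> by (intro mult_right_mono) auto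
    finally have "int q \<le> int (4 * k\<^sup>2)" by (simp add: power2_eq_square)
    then have "q \<le> 4 * k\<^sup>2" by (simp only: of_nat_le_iff)
    then show False using k(2) by (simp add: low_def)
  qed
  show ?thesis
  proof (intro subset_antisym subsetI)
    fix p assume "p \<in> prim_reps a x k"
    then obtain m n where p: "p = (m, n)" "coprime m n" "Q a x m n = int k" by (auto simp: prim_reps_def)
    have "n = 0" using n0 p by blast
    then have "is_unit m" using p(2) by simp
    then have "m = 1 \<or> m = - 1" by auto
    moreover then have "a = int k" using p(3) \<open>n = 0\<close> by (auto simp: Q_eq)
    ultimately show "p \<in> (if a = int k then {(1, 0), (- 1, 0)} else {})" using p(1) \<open>n = 0\<close> by auto
  next
    fix p :: "int \<times> int" assume "p \<in> (if a = int k then {(1, 0), (- 1, 0)} else {})"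
    then show "p \<in> prim_reps a x k" by (auto simp: prim_reps_def Q_eq split: if_splits)
  qed
qed

lemma card_low:
  assumes T: "is_transversal T" and k: "k > 0" "low k"
  shows "card {t \<in> T. fst t = int k} = rho (int q) k"
proof -
  have "2 * rho (int q) k = (\<Sum>(a, x)\<in>T. card (prim_reps a x k))" using sum_prim_reps[OF T k(1)] by simp
  also have "\<dots> = (\<Sum>t\<in>T. if fst t = int k then 2 else 0)"
    using low_prim_reps[OF T _ k] by (intro sum.cong refl) auto
  also have "\<dots> = (\<Sum>t\<in>{t \<in> T. fst t = int k}. 2)"
    by (rule sum.inter_filter[symmetric]) (rule transversalD(1)[OF T])
  finally show ?thesis by simp
qed

lemma sum_rho_le:
  assumes T: "is_transversal T" and I: "finite I" "\<And>k. k \<in> I \<Longrightarrow> k > 0 \<and> low k"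
  shows "(\<Sum>k\<in>I. rho (int q) k) \<le> card T"
proof -
  have "(\<Sum>k\<in>I. rho (int q) k) = (\<Sum>k\<in>I. card {t \<in> T. fst t = int k})"
    using card_low[OF T] I(2) by (intro sum.cong refl) auto
  also have "\<dots> = card (\<Union>k\<in>I. {t \<in> T. fst t = int k})"
    using transversalD(1)[OF T] I(1) by (intro card_UN_disjoint[symmetric]) auto
  also have "\<dots> \<le> card T" using transversalD(1)[OF T] by (intro card_mono) auto
  finally show ?thesis .
qed

text \<open>Among the low powers of p, the exponent 0 accounts for one class and every other
  exponent for two. With j the least exponent that is not low, 1 + 2 (j - 1) <= h, whence 2 j <= 2
  h.\<close>

lemma split_prime_large:
  assumes T: "is_transversal T" and p: "prime p" "\<not> p dvd q" "int p dvd f x"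
  shows "q \<le> 4 * p ^ (2 * card T)"
proof -
  have p2: "p \<ge> 2" using p(1) by (rule prime_ge_2_nat)
  have pq: "\<not> int p dvd int q" using p(2) by simp
  have "q < 2 ^ q" by (rule less_exp)
  also have "\<dots> \<le> p ^ q" using p2 by (intro power_mono) auto
  finally have "q \<le> p ^ q" by simp
  also have "\<dots> \<le> 4 * (p ^ q)\<^sup>2" by (simp add: power2_eq_square)
  finally have ex: "\<exists>i. \<not> low (p ^ i)" unfolding low_def by (intro exI[of _ q]) simp
  define j where "j = (LEAST i. \<not> low (p ^ i))"
  have j: "\<not> low (p ^ j)" unfolding j_def by (rule LeastI_ex[OF ex])
  have lowj: "low (p ^ i)" if "i < j" for i using that not_less_Least unfolding j_def by blast
  have "j \<noteq> 0" by (rule notI) (use j q4 in \<open>simp add: low_def\<close>)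
  have inj: "inj_on (\<lambda>i. p ^ i) {..<j}" using p2 by (auto intro!: inj_onI simp: power_inject_exp)
  have "(\<Sum>k\<in>(\<lambda>i. p ^ i) ` {..<j}. rho (int q) k) \<le> card T"
    by (rule sum_rho_le[OF T]) (use lowj p2 in auto)
  then have "(\<Sum>i<j. rho (int q) (p ^ i)) \<le> card T" by (simp add: sum.reindex[OF inj] o_def)
  moreover obtain j' where j': "j = Suc j'" using \<open>j \<noteq> 0\<close> not0_implies_Suc by blast
  moreover have "rho (int q) (p ^ Suc i) = 2" for i
    using rho_unramified[OF q_mod p(1) pq, of "Suc i"] p(3) by auto
  then have "(\<Sum>i<Suc j'. rho (int q) (p ^ i)) = 1 + 2 * j'" by (simp add: sum.lessThan_Suc_shift del: sum.lessThan_Suc)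
  ultimately have "2 * j \<le> 2 * card T" by simp
  have "q \<le> 4 * (p ^ j)\<^sup>2" using j by (simp add: low_def)
  also have "(p ^ j)\<^sup>2 = p ^ (2 * j)" by (simp add: power_mult[symmetric] mult.commute)
  also have "p ^ (2 * j) \<le> p ^ (2 * card T)" using \<open>2 * j \<le> 2 * card T\<close> p2 by (intro power_increasing) auto
  finally show ?thesis by simp
qed

text \<open>If all primes of k divide q, each of them occurs only once, because
  \<open>fundamental\<close> allows no root of \<open>f\<close> modulo its square.\<close>

lemma rho_pos_cases:
  assumes k: "k > 0" "rho (int q) k > 0"
  shows "(\<exists>S\<subseteq>prime_factors q. k = \<Prod>S) \<or> (\<exists>p x. prime p \<and> p dvd k \<and> \<not> p dvd q \<and> int p dvd f x)"
proof -
  have "{x \<in> {0..<int k}. int k dvd f x} \<noteq> {}" using k(2) unfolding rho_def by (metis card.empty less_irrefl)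
  then obtain x where x: "int k dvd f x" by blast
  show ?thesis
  proof (cases "\<exists>p. prime p \<and> p dvd k \<and> \<not> p dvd q")
    case True
    then obtain p where p: "prime p" "p dvd k" "\<not> p dvd q" by blast
    then have "int p dvd f x" using x by (meson dvd_trans int_dvd_int_iff)
    then show ?thesis using p by blast
  next
    case False
    have m1: "multiplicity p k = 1" if p: "p \<in> prime_factors k" for p
    proof (rule multiplicity_eqI)
      have pr: "prime p" "p dvd k" using p by (auto simp: prime_factors_dvd)
      show "p ^ 1 dvd k" using pr by simp
      show "\<not> p ^ Suc 1 dvd k"
      proof
        assume "p ^ Suc 1 dvd k"
        then have "p\<^sup>2 dvd k" by (simp add: power2_eq_square)
        then have "int (p\<^sup>2) dvd int k" by (simp only: int_dvd_int_iff)
        then have "int (p\<^sup>2) dvd f x" using x dvd_trans by blast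
        then have "(int p)\<^sup>2 dvd f x" by simp
        moreover have "int p dvd int q" "prime (int p)" using False pr by auto
        ultimately show False using fund unfolding fundamental_def by blast
      qed
    qed
    have "k = (\<Prod>p\<in>prime_factors k. p ^ multiplicity p k)" using prod_prime_factors[of k] k(1) by simp
    also have "\<dots> = \<Prod>(prime_factors k)" using m1 by (intro prod.cong refl) simp
    finally have "k = \<Prod>(prime_factors k)" .
    moreover have "prime_factors k \<subseteq> prime_factors q" using False q4 by (auto simp: prime_factors_dvd)
    ultimately show ?thesis by blast
  qed
qed

lemma prod_primes_props:
  assumes "S \<subseteq> prime_factors q"
  shows "\<Prod>S > 0" "\<Prod>S dvd q" "rho (int q) (\<Prod>S) = 1"
proof -
  have fin: "finite S" using assms finite_subset by blast
  have pr: "prime p" "p dvd q" if "p \<in> S" for p using assms that by (auto simp: prime_factors_dvd)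
  have "\<Prod>S > 0 \<and> \<Prod>S dvd q \<and> rho (int q) (\<Prod>S) = 1" using fin pr
  proof (induction S)
    case (insert p S)
    then have IH: "\<Prod>S > 0" "\<Prod>S dvd q" "rho (int q) (\<Prod>S) = 1" by auto
    have p: "prime p" "p dvd q" using insert by auto
    have cop: "coprime p (\<Prod>S)"
    proof (rule prod_coprime_right)
      fix r assume "r \<in> S"
      then have "prime r" "p \<noteq> r" using insert by auto
      then show "coprime p r" using p(1) primes_coprime by blast
    qed
    have "rho (int q) p = 1" using rho_ramified(1)[OF fund p(1)] p(2) by simp
    then have "rho (int q) (p * \<Prod>S) = 1"
      using rho_mult[OF cop, of "int q"] IH p(1) prime_gt_0_nat by simp
    moreover have "p * \<Prod>S dvd q" using cop p(2) IH(2) by (simp add: divides_mult)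
    ultimately show ?case using insert IH(1) p(1) prime_gt_0_nat by simp
  qed simp
  then show "\<Prod>S > 0" "\<Prod>S dvd q" "rho (int q) (\<Prod>S) = 1" by auto
qed

lemma inj_prod_primes: "inj_on Prod (Pow (prime_factors q))"
proof (rule inj_onI)
  fix S S' assume S: "S \<in> Pow (prime_factors q)" "S' \<in> Pow (prime_factors q)" "\<Prod>S = \<Prod>S'"
  have mem: "p \<in> S \<longleftrightarrow> p \<in> prime_factors q \<and> p dvd \<Prod>S" if S: "S \<subseteq> prime_factors q" for S p
  proof
    assume "p \<in> S" then show "p \<in> prime_factors q \<and> p dvd \<Prod>S"
      using S finite_subset[OF S] by (auto intro: dvd_prodI[of S p "\<lambda>x. x", simplified])
  next
    assume p: "p \<in> prime_factors q \<and> p dvd \<Prod>S"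
    then have "prime p" by (auto simp: prime_factors_dvd)
    then obtain r where "r \<in> S" "p dvd r" using p prime_dvd_prod_iff[OF finite_subset[OF S], of p "\<lambda>x. x"] by auto
    moreover then have "prime r" using S by (auto simp: prime_factors_dvd)
    ultimately show "p \<in> S" using primes_dvd_imp_eq \<open>prime p\<close> by blast
  qed
  have sub: "S \<subseteq> prime_factors q" "S' \<subseteq> prime_factors q" using S by blast+
  show "S = S'"
  proof (rule Set.set_eqI)
    show "p \<in> S \<longleftrightarrow> p \<in> S'" for p unfolding mem[OF sub(1)] mem[OF sub(2)] S(3) ..
  qed
qed

definition low_sets :: "nat set set" where "low_sets = {S \<in> Pow (prime_factors q). low (\<Prod>S)}"

lemma finite_low_sets: "finite low_sets" unfolding low_sets_def by simp

lemma card_low_sets: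
  assumes T: "is_transversal T" shows "card low_sets \<le> card T"
proof -
  have sub: "low_sets \<subseteq> Pow (prime_factors q)" by (auto simp: low_sets_def)
  have inj: "inj_on Prod low_sets" by (rule inj_on_subset[OF inj_prod_primes sub])
  have "card low_sets = (\<Sum>S\<in>low_sets. rho (int q) (\<Prod>S))"
    using prod_primes_props(3) sub by (simp add: subset_iff)
  also have "\<dots> = (\<Sum>k\<in>Prod ` low_sets. rho (int q) k)" by (simp add: sum.reindex[OF inj])
  also have "\<dots> \<le> card T"
    by (rule sum_rho_le[OF T]) (use finite_low_sets prod_primes_props(1) sub in \<open>auto simp: low_sets_def\<close>)
  finally show ?thesis .
qed

text \<open>If \<open>p \<ge> 5\<close> divides \<open>q\<close>, then of two complementary products of the other primes one is low.\<close>

lemma card_prime_factor_sets: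
  assumes T: "is_transversal T" shows "2 ^ card (prime_factors q) \<le> 4 * card T"
proof (cases "\<exists>p\<in>prime_factors q. p \<ge> 5")
  case False
  \<comment> \<open>Here 2^t is at most 4, and the empty product already provides one class.\<close>
  have "prime_factors q \<subseteq> {2, 3}"
  proof
    fix p assume p: "p \<in> prime_factors q"
    then have pr: "prime p" by (simp add: in_prime_factors_iff)
    have "p < 5" using False p by (meson not_le)
    moreover have "p \<ge> 2" using pr by (rule prime_ge_2_nat)
    moreover have "p \<noteq> 4"
    proof
      assume "p = 4"
      then have "2 dvd p" by simp
      then have "p = 2" using primes_dvd_imp_eq[of 2 p] pr by simp
      then show False using \<open>p = 4\<close> by simp
    qed
    ultimately have "p = 2 \<or> p = 3" by linarith
    then show "p \<in> {2, 3}" by blast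
  qed
  then have "card (prime_factors q) \<le> card {2, 3 :: nat}" by (intro card_mono) auto
  then have "(2::nat) ^ card (prime_factors q) \<le> 2 ^ 2" by (intro power_increasing) auto
  moreover have "{} \<in> low_sets" using q4 by (simp add: low_sets_def low_def)
  then have "card low_sets > 0" using finite_low_sets card_gt_0_iff by blast
  ultimately show ?thesis using card_low_sets[OF T] by simp
next
  case True
  then obtain p where p: "p \<in> prime_factors q" "p \<ge> 5" by blast
  define R where "R = prime_factors q - {p}"
  have finR: "finite R" by (simp add: R_def)
  have "\<Prod>(prime_factors q) \<le> q" using prod_primes_props(2)[of "prime_factors q"] q4 by (simp add: dvd_imp_le)
  moreover have "\<Prod>(prime_factors q) = p * \<Prod>R" using p(1) unfolding R_def by (subst prod.remove[of _ p]) auto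
  ultimately have pR: "p * \<Prod>R \<le> q" by simp
  have R0: "\<Prod>R > 0" by (rule prod_primes_props(1)) (simp add: R_def)
  have "5 * \<Prod>R \<le> p * \<Prod>R" using p(2) by (intro mult_right_mono) auto
  then have R4: "4 * \<Prod>R < q" using pR R0 by linarith
  have comp: "S \<in> low_sets \<or> R - S \<in> low_sets" if "S \<subseteq> R" for S
  proof (rule ccontr)
    assume no: "\<not> ?thesis"
    have "S \<subseteq> prime_factors q" "R - S \<subseteq> prime_factors q" using that by (auto simp: R_def)
    then have "q \<le> 4 * (\<Prod>S)\<^sup>2" "q \<le> 4 * (\<Prod>(R - S))\<^sup>2" using no by (auto simp: low_sets_def low_def)
    then have "q * q \<le> (4 * (\<Prod>S)\<^sup>2) * (4 * (\<Prod>(R - S))\<^sup>2)" by (rule mult_le_mono)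
    also have "\<dots> = (4 * (\<Prod>S * \<Prod>(R - S)))\<^sup>2" by (simp add: power2_eq_square)
    also have "\<Prod>S * \<Prod>(R - S) = \<Prod>R" using prod.subset_diff[OF that finR, of "\<lambda>x. x"] by simp
    finally have "q\<^sup>2 \<le> (4 * \<Prod>R)\<^sup>2" by (simp add: power2_eq_square)
    then have "q \<le> 4 * \<Prod>R" by (rule power2_le_imp_le) simp
    then show False using R4 by simp
  qed
  have "Pow R \<subseteq> low_sets \<union> (\<lambda>S. R - S) ` low_sets"
  proof
    fix S assume S: "S \<in> Pow R"
    then have "S = R - (R - S)" by auto
    then show "S \<in> low_sets \<union> (\<lambda>S. R - S) ` low_sets" using comp[of S] S by blast
  qed
  then have "card (Pow R) \<le> card (low_sets \<union> (\<lambda>S. R - S) ` low_sets)" using finite_low_sets by (intro card_mono) auto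
  also have "\<dots> \<le> card low_sets + card ((\<lambda>S. R - S) ` low_sets)" by (rule card_Un_le)
  also have "\<dots> \<le> card low_sets + card low_sets" using card_image_le[OF finite_low_sets] by (intro add_mono) auto
  finally have "2 ^ card R \<le> 2 * card T" using card_low_sets[OF T] finR by (simp add: card_Pow)
  moreover have "card (prime_factors q) = Suc (card R)" using card_Suc_Diff1[OF _ p(1)] by (simp add: R_def)
  ultimately show ?thesis by simp
qed

text \<open>X bounds a^(-w) when a has a split prime factor, by \<open>split_prime_large\<close>,
  and Y bounds it when a is not low. In 5 h Y, one h comes from the transversal and 4 h from the at
  most 2^t <= 4 h products of ramified primes that are not low. The denominator 16 h^2 is (4 h)^2, a
  bound for 4^t.\<close>

theorem class_sum_lower_bound:
  assumes T: "is_transversal T" and w: "Re w > 1 / 2"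
  defines "h \<equiv> real (card T)"
  shows "1 / (16 * h\<^sup>2) \<le> norm (\<Sum>(a, x)\<in>T. (of_int a :: complex) powr (- w)) +
    h * (real q / 4) powr (- (1 / (4 * h))) + 5 * h * (sqrt (real q) / 2) powr (- (1 / 2))"
proof -
  define \<sigma> where "\<sigma> = Re w"
  define X where "X = (real q / 4) powr (- (1 / (4 * h)))"
  define Y where "Y = (sqrt (real q) / 2) powr (- (1 / 2))"
  define u where "u = (\<lambda>k::nat. (of_nat k :: complex) powr (- w))"
  define PF where "PF = prime_factors q"
  have finT: "finite T" using transversalD(1)[OF T] .
  have X0: "X \<ge> 0" and Y0: "Y \<ge> 0" by (simp_all add: X_def Y_def)
  have "{} \<in> low_sets" using q4 by (simp add: low_sets_def low_def)
  then have "card low_sets > 0" using finite_low_sets card_gt_0_iff by blast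
  then have cT: "card T \<ge> 1" using card_low_sets[OF T] by simp
  then have h1: "h \<ge> 1" by (simp add: h_def)
  have u_norm: "norm (u k) \<le> real k powr (- (1 / 2))" if "k > 0" for k
    using that w unfolding u_def by (simp add: norm_of_nat_powr powr_mono)
  have u_high: "norm (u k) \<le> Y" if k: "k > 0" "\<not> low k" for k
  proof -
    have "q \<le> 4 * k\<^sup>2" using k(2) by (simp add: low_def)
    then have "real q \<le> real (4 * k\<^sup>2)" by (simp only: of_nat_le_iff)
    then have "real q \<le> (2 * real k)\<^sup>2" by (simp add: power_mult_distrib)
    then have "sqrt (real q) \<le> sqrt ((2 * real k)\<^sup>2)" by (rule real_sqrt_le_mono)
    then have "sqrt (real q) \<le> \<bar>2 * real k\<bar>" by (simp only: real_sqrt_abs)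
    then have "sqrt (real q) / 2 \<le> real k" by simp
    then have "real k powr (- (1 / 2)) \<le> Y" unfolding Y_def using q4 by (intro powr_mono2') auto
    then show ?thesis using u_norm[OF k(1)] by linarith
  qed
  have u_split: "norm (u k) \<le> X" if k: "k > 0" "p dvd k" and p: "prime p" "\<not> p dvd q" "int p dvd f x" for k p x
  proof -
    have p0: "p > 0" using p(1) prime_gt_0_nat by blast
    have "q \<le> 4 * p ^ (2 * card T)" by (rule split_prime_large[OF T p])
    then have "real q \<le> real (4 * p ^ (2 * card T))" by (simp only: of_nat_le_iff)
    moreover have "real p powr (2 * h) = real p ^ (2 * card T)"
      using powr_realpow[of "real p" "2 * card T"] p0 by (simp add: h_def)
    ultimately have "real q / 4 \<le> real p powr (2 * h)" by simp
    then have "(real p powr (2 * h)) powr (- (1 / (4 * h))) \<le> X"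
      unfolding X_def using q4 h1 by (intro powr_mono2') auto
    also have "(real p powr (2 * h)) powr (- (1 / (4 * h))) = real p powr (- (1 / 2))"
      using h1 by (simp add: powr_powr)
    finally have "real p powr (- (1 / 2)) \<le> X" .
    moreover have "p \<le> k" using k by (simp add: dvd_imp_le)
    then have "real k powr (- (1 / 2)) \<le> real p powr (- (1 / 2))" using p0 by (intro powr_mono2') auto
    ultimately show ?thesis using u_norm[OF k(1)] by linarith
  qed
  \<comment> \<open>The representatives whose leading coefficient is a low product of ramified
    primes; \<open>card_low\<close> shows that each such product occurs exactly once.\<close>
  define T1 where "T1 = {t \<in> T. \<exists>S\<in>low_sets. fst t = int (\<Prod>S)}"
  define v where "v = (\<lambda>t::int \<times> int. (of_int (fst t) :: complex) powr (- w))"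
  have v_nat: "\<exists>k>0. fst t = int k \<and> v t = u k" if "t \<in> T" for t
  proof -
    have "fst t > 0" using transversal_form(1)[OF T, of "fst t" "snd t"] that by simp
    then have "fst t = int (nat (fst t))" "nat (fst t) > 0" by simp_all
    then show ?thesis unfolding v_def u_def by (intro exI[of _ "nat (fst t)"] conjI) simp_all
  qed
  have low_props: "\<Prod>S > 0" "low (\<Prod>S)" "rho (int q) (\<Prod>S) = 1" if "S \<in> low_sets" for S
    using that prod_primes_props[of S] by (auto simp: low_sets_def)
  have rest: "norm (v t) \<le> X + Y" if t: "t \<in> T - T1" for t
  proof -
    obtain k where k: "k > 0" "fst t = int k" "v t = u k" using v_nat[of t] t by blast
    show ?thesis
    proof (cases "low k")
      case False
      then show ?thesis using u_high[OF k(1)] X0 by (simp add: k(3))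
    next
      case True
      have "t \<in> {t \<in> T. fst t = int k}" using t k by simp
      moreover have "finite {t \<in> T. fst t = int k}" using finT by simp
      ultimately have "card {t \<in> T. fst t = int k} > 0" using card_gt_0_iff by blast
      then have "rho (int q) k > 0" using card_low[OF T k(1) True] by simp
      then consider S where "S \<subseteq> prime_factors q" "k = \<Prod>S" | p x where "prime p" "p dvd k" "\<not> p dvd q" "int p dvd f x"
        using rho_pos_cases[OF k(1)] by blast
      then show ?thesis
      proof cases
        case 1
        then have "S \<in> low_sets" using True by (simp add: low_sets_def)
        then have "t \<in> T1" using t k(2) 1 by (auto simp: T1_def)
        then show ?thesis using t by blast
      next
        case 2
        have "norm (u k) \<le> X" by (rule u_split[OF k(1) 2(2,1,3,4)])
        then show ?thesis using Y0 by (simp add: k(3))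
      qed
    qed
  qed
  have sum1: "(\<Sum>t\<in>T1. v t) = (\<Sum>S\<in>low_sets. u (\<Prod>S))"
  proof -
    have disjoint_fibres: "{t \<in> T. fst t = a} \<inter> {t \<in> T. fst t = b} = {}" if "a \<noteq> b" for a b
      using that by auto
    have T1_eq: "T1 = (\<Union>S\<in>low_sets. {t \<in> T. fst t = int (\<Prod>S)})" unfolding T1_def by blast
    have disj: "{t \<in> T. fst t = int (\<Prod>S)} \<inter> {t \<in> T. fst t = int (\<Prod>S')} = {}"
      if S: "S \<in> low_sets" "S' \<in> low_sets" "S \<noteq> S'" for S S'
    proof -
      have "S = S'" if "\<Prod>S = \<Prod>S'"
        by (rule inj_onD[OF inj_prod_primes that]) (use S in \<open>simp_all add: low_sets_def\<close>)
      then have "int (\<Prod>S) \<noteq> int (\<Prod>S')" using S(3) unfolding of_nat_eq_iff by blast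
      then show ?thesis by (rule disjoint_fibres)
    qed
    have "(\<Sum>t\<in>T1. v t) = (\<Sum>S\<in>low_sets. \<Sum>t\<in>{t \<in> T. fst t = int (\<Prod>S)}. v t)"
      unfolding T1_eq
    proof (rule sum.UNION_disjoint[OF finite_low_sets])
      show "\<forall>S\<in>low_sets. finite {t \<in> T. fst t = int (\<Prod>S)}" using finT by simp
    qed (use disj in blast)
    also have "\<dots> = (\<Sum>S\<in>low_sets. u (\<Prod>S))"
    proof (rule sum.cong[OF refl])
      fix S assume S: "S \<in> low_sets"
      have "(\<Sum>t\<in>{t \<in> T. fst t = int (\<Prod>S)}. v t) = (\<Sum>t\<in>{t \<in> T. fst t = int (\<Prod>S)}. u (\<Prod>S))"
        by (rule sum.cong[OF refl]) (simp add: v_def u_def del: of_nat_prod of_int_prod)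
      also have "\<dots> = of_nat (card {t \<in> T. fst t = int (\<Prod>S)}) * u (\<Prod>S)" by simp
      also have "card {t \<in> T. fst t = int (\<Prod>S)} = 1" using card_low[OF T low_props(1,2)[OF S]] low_props(3)[OF S] by simp
      finally show "(\<Sum>t\<in>{t \<in> T. fst t = int (\<Prod>S)}. v t) = u (\<Prod>S)" by simp
    qed
    finally show ?thesis .
  qed
  have finPF: "finite PF" by (simp add: PF_def)
  have pPF: "p \<ge> 2" if "p \<in> PF" for p using that prime_ge_2_nat by (auto simp: PF_def prime_factors_dvd)
  have u_prod: "u (\<Prod>S) = (\<Prod>p\<in>S. u p)" if "finite S" for S
    using that
  proof (induction S)
    case (insert p S)
    then show ?case using of_nat_powr_mult[of p "\<Prod>S" "- w"] by (simp add: u_def)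
  qed (simp add: u_def)
  have "(\<Prod>p\<in>PF. u p + 1) = (\<Sum>S\<in>Pow PF. u (\<Prod>S))"
    unfolding prod_add[OF finPF] using finite_subset[OF _ finPF] by (intro sum.cong refl) (auto simp: u_prod)
  also have "\<dots> = (\<Sum>S\<in>low_sets. u (\<Prod>S)) + (\<Sum>S\<in>Pow PF - low_sets. u (\<Prod>S))"
  proof -
    have "low_sets \<subseteq> Pow PF" by (auto simp: low_sets_def PF_def)
    then show ?thesis using sum.subset_diff[of low_sets "Pow PF" "\<lambda>S. u (\<Prod>S)"] finPF by (simp add: add.commute)
  qed
  finally have euler: "(\<Prod>p\<in>PF. u p + 1) = (\<Sum>t\<in>T1. v t) + (\<Sum>S\<in>Pow PF - low_sets. u (\<Prod>S))" unfolding sum1 .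
  have card4: "2 ^ card PF \<le> 4 * card T" unfolding PF_def by (rule card_prime_factor_sets[OF T])
  then have "real (2 ^ card PF) \<le> real (4 * card T)" by (simp only: of_nat_le_iff)
  then have c4: "2 ^ card PF \<le> 4 * h" by (simp add: h_def)
  have "norm (\<Sum>S\<in>Pow PF - low_sets. u (\<Prod>S)) \<le> (\<Sum>S\<in>Pow PF - low_sets. Y)"
  proof (rule sum_norm_le)
    fix S assume S: "S \<in> Pow PF - low_sets"
    then have "\<Prod>S > 0" using prod_primes_props(1)[of S] by (simp add: PF_def)
    moreover have "\<not> low (\<Prod>S)" using S by (simp add: low_sets_def PF_def)
    ultimately show "norm (u (\<Prod>S)) \<le> Y" by (rule u_high)
  qed
  also have "\<dots> = real (card (Pow PF - low_sets)) * Y" by simp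
  also have "\<dots> \<le> (4 * h) * Y"
  proof (rule mult_right_mono[OF _ Y0])
    have "card (Pow PF - low_sets) \<le> card (Pow PF)" using finPF by (intro card_mono) auto
    then have "real (card (Pow PF - low_sets)) \<le> real (2 ^ card PF)" using finPF by (simp only: of_nat_le_iff card_Pow)
    then have "real (card (Pow PF - low_sets)) \<le> 2 ^ card PF" by (simp only: of_nat_power of_nat_numeral)
    then show "real (card (Pow PF - low_sets)) \<le> 4 * h" using c4 by (rule order_trans)
  qed
  finally have high: "norm (\<Sum>S\<in>Pow PF - low_sets. u (\<Prod>S)) \<le> 4 * h * Y" .
  have "norm (\<Sum>t\<in>T - T1. v t) \<le> (\<Sum>t\<in>T - T1. X + Y)" by (rule sum_norm_le[OF rest])
  also have "\<dots> = real (card (T - T1)) * (X + Y)" by simp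
  also have "\<dots> \<le> h * (X + Y)"
    unfolding h_def using X0 Y0 finT by (intro mult_right_mono) (auto intro: card_mono)
  finally have T2: "norm (\<Sum>t\<in>T - T1. v t) \<le> h * (X + Y)" .
  have "(\<Sum>t\<in>T. v t) = (\<Sum>t\<in>T - T1. v t) + (\<Sum>t\<in>T1. v t)"
    using finT by (intro sum.subset_diff) (auto simp: T1_def)
  then have "(\<Prod>p\<in>PF. u p + 1) = (\<Sum>t\<in>T. v t) - (\<Sum>t\<in>T - T1. v t) + (\<Sum>S\<in>Pow PF - low_sets. u (\<Prod>S))"
    unfolding euler by simp
  then have "norm (\<Prod>p\<in>PF. u p + 1) \<le> norm (\<Sum>t\<in>T. v t) + norm (\<Sum>t\<in>T - T1. v t) + norm (\<Sum>S\<in>Pow PF - low_sets. u (\<Prod>S))"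
    using norm_triangle_ineq[of "(\<Sum>t\<in>T. v t) - (\<Sum>t\<in>T - T1. v t)"] norm_triangle_ineq4[of "\<Sum>t\<in>T. v t" "\<Sum>t\<in>T - T1. v t"]
    by (metis (no_types, lifting) add_mono_thms_linordered_semiring(3) order_trans)
  also have "\<dots> \<le> norm (\<Sum>t\<in>T. v t) + h * (X + Y) + 4 * h * Y" using T2 high by linarith
  finally have upper: "norm (\<Prod>p\<in>PF. u p + 1) \<le> norm (\<Sum>t\<in>T. v t) + h * X + 5 * h * Y" by (simp add: algebra_simps)
  \<comment> \<open>The worst prime is 2, where 1 - 2^(-1/2) still exceeds 1/4.\<close>
  have factor: "1 / 4 \<le> norm (u p + 1)" if p: "p \<in> PF" for p
  proof -
    have "norm (u p) \<le> real p powr (- (1 / 2))" using pPF[OF p] by (intro u_norm) auto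
    also have "\<dots> \<le> 2 powr (- (1 / 2))" using pPF[OF p] by (intro powr_mono2') auto
    also have "\<dots> = 1 / sqrt 2" unfolding powr_minus_divide by (simp add: powr_half_sqrt)
    also have "\<dots> \<le> 3 / 4"
    proof -
      have "4 / 3 \<le> sqrt (2::real)" by (rule real_le_rsqrt) (simp add: power2_eq_square)
      then show ?thesis by (simp add: field_simps)
    qed
    finally have "norm (u p) \<le> 3 / 4" .
    moreover have "1 \<le> norm (u p + 1) + norm (u p)"
      using norm_triangle_ineq4[of "u p + 1" "u p"] by simp
    ultimately show ?thesis by linarith
  qed
  have "1 / (16 * h\<^sup>2) = 1 / (4 * h)\<^sup>2" by (simp add: power2_eq_square)
  also have "\<dots> \<le> 1 / (2 ^ card PF)\<^sup>2" using c4 h1 by (intro divide_left_mono power_mono) auto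
  also have "\<dots> = (1 / 4) ^ card PF" by (simp add: power_divide power2_eq_square power_mult_distrib[symmetric])
  also have "\<dots> = (\<Prod>p\<in>PF. 1 / 4)" by simp
  also have "\<dots> \<le> (\<Prod>p\<in>PF. norm (u p + 1))" by (intro prod_mono) (use factor in auto)
  also have "\<dots> = norm (\<Prod>p\<in>PF. u p + 1)" by (simp add: prod_norm)
  finally have "1 / (16 * h\<^sup>2) \<le> norm (\<Sum>t\<in>T. v t) + h * X + 5 * h * Y" using upper by linarith
  moreover have "(\<Sum>t\<in>T. v t) = (\<Sum>(a, x)\<in>T. (of_int a :: complex) powr (- w))"
    by (simp add: v_def case_prod_unfold)
  ultimately show ?thesis by (simp add: X_def Y_def)
qed

end

text \<open>The cube stands for h^3 with h <= log q. In the middle term exp(3 log log q) meets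
  exp(-(log log q)^\<eta>/8); the other two terms are powers of q.\<close>

lemma class_number_error_tendsto_0:
  assumes "\<eta> > 1" "\<delta> > 0"
  shows "((\<lambda>q::real. 16 * (ln q) ^ 3 * (C * q powr (- \<delta>) + exp (- (ln (ln q) powr \<eta> / 8)) +
    5 * (sqrt q / 2) powr (- (1 / 2)))) \<longlongrightarrow> 0) at_top"
proof -
  have 1: "((\<lambda>q::real. (ln q) ^ 3 * q powr (- \<delta>)) \<longlongrightarrow> 0) at_top" using assms(2) by real_asymp
  have 2: "((\<lambda>q::real. (ln q) ^ 3 * exp (- (ln (ln q) powr \<eta> / 8))) \<longlongrightarrow> 0) at_top" using assms(1) by real_asymp
  have 3: "((\<lambda>q::real. (ln q) ^ 3 * (sqrt q / 2) powr (- (1 / 2))) \<longlongrightarrow> 0) at_top" by real_asymp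
  have "((\<lambda>q::real. 16 * C * ((ln q) ^ 3 * q powr (- \<delta>)) + 16 * ((ln q) ^ 3 * exp (- (ln (ln q) powr \<eta> / 8))) +
      80 * ((ln q) ^ 3 * (sqrt q / 2) powr (- (1 / 2)))) \<longlongrightarrow> 16 * C * 0 + 16 * 0 + 80 * 0) at_top"
    by (intro tendsto_add tendsto_mult tendsto_const 1 2 3)
  then show ?thesis by (simp add: algebra_simps)
qed

theorem corollary1:
  fixes \<beta> \<gamma> \<eta> :: real
  assumes "Complex \<beta> \<gamma> \<noteq> 1" and "zeta (Complex \<beta> \<gamma>) = 0"
    and "\<beta> > 1 / 2" and "\<eta> > 1"
  shows "\<exists>q0 :: real. \<forall>q :: nat. real q > q0 \<longrightarrow>
           (\<exists>X. primitive_character q X \<and> real_character X \<and> X (- 1) = - 1) \<longrightarrow>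
           real (class_number (imag_quadratic_field q)) > ln (real q) / (ln (ln (real q))) powr \<eta>"
proof -
  define w where "w = Complex \<beta> \<gamma>"
  have Re_w: "Re w = \<beta>" by (simp add: w_def)
  \<comment> \<open>Half of the margin \<beta> - 1/2 keeps 1/2 + \<delta> strictly below \<beta>;
    the cap 1/2 is the range of the lattice point bound.\<close>
  define \<delta> where "\<delta> = min (1 / 2) ((\<beta> - 1 / 2) / 2)"
  have \<delta>: "0 < \<delta>" "\<delta> \<le> 1 / 2" "1 / 2 + \<delta> < Re w"
    using assms(3) unfolding Re_w \<delta>_def by (auto simp: min_def field_simps)
  define Z where "Z = norm (zeta (2 * w))"
  have Z: "Z > 0" using zeta_nonzero[of "2 * w"] assms(3) Re_w by (simp add: Z_def)
  define C where "C = 8 * norm w * (\<Sum>k. real (Suc k) powr (1 / 2 + \<delta> - Re w - 1)) / Z"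
  define err where "err = (\<lambda>q::real. 16 * (ln q) ^ 3 * (C * q powr (- \<delta>) + exp (- (ln (ln q) powr \<eta> / 8)) +
    5 * (sqrt q / 2) powr (- (1 / 2))))"
  have "eventually (\<lambda>q. err q < 1) at_top"
    unfolding err_def by (rule order_tendstoD(2)[OF class_number_error_tendsto_0[OF assms(4) \<delta>(1)]]) simp
  then obtain N where N: "\<And>q. q \<ge> N \<Longrightarrow> err q < 1" unfolding eventually_at_top_linorder by blast
  \<comment> \<open>The bound 16 gives q > 4 and log(q/4) >= (log q)/2, and exp(exp 1) gives log log
    q > 1.\<close>
  define q0 where "q0 = max N (max 16 (exp (exp 1)))"
  have "real (class_number (imag_quadratic_field q)) > ln (real q) / (ln (ln (real q))) powr \<eta>"
    if q: "real q > q0" and X: "primitive_character q X" "real_character X" "X (- 1) = - 1" for q X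
  proof (rule ccontr)
    assume "\<not> ?thesis"
    then have small: "real (class_number (imag_quadratic_field q)) \<le> ln (real q) / (ln (ln (real q))) powr \<eta>" by simp
    have q16: "real q > 16" and qe: "real q > exp (exp 1)" and qN: "real q \<ge> N" using q by (simp_all add: q0_def)
    obtain \<psi> where \<psi>: "real_primitive (int q) \<psi>" "\<And>n. X n = of_int (\<psi> n)"
      using real_primitive_of_character[OF X(1,2)] by blast
    have "of_int (\<psi> (- 1)) = (of_int (- 1) :: complex)" using \<psi>(2)[of "- 1"] X(3) by simp
    then have neg: "\<psi> (- 1) = - 1" by (simp only: of_int_eq_iff)
    interpret odd: odd_real_primitive "int q" \<psi>
      by (rule odd_real_primitive.intro[OF \<psi>(1)], rule odd_real_primitive_axioms.intro, rule neg)
    interpret iq: imag_quadratic q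
      by standard (use odd.fundamental[OF neg] q16 in auto)
    obtain T where T: "iq.is_transversal T" using iq.transversal_exists by blast
    define h where "h = real (card T)"
    have h_eq: "h = real (class_number (imag_quadratic_field q))" using iq.transversalD(2)[OF T] by (simp add: h_def)
    define S where "S = norm (\<Sum>(a, x)\<in>T. (of_int a :: complex) powr (- w))"
    have "S * Z \<le> h * (8 * real q powr (- \<delta>) * norm w * (\<Sum>k. real (Suc k) powr (1 / 2 + \<delta> - Re w - 1)))"
      unfolding S_def Z_def h_def
      by (rule iq.class_sum_bound[OF odd.odd_real_primitive_axioms T]) (use assms \<delta> in \<open>simp_all add: w_def\<close>)
    also have "\<dots> = h * (C * real q powr (- \<delta>)) * Z" using Z by (simp add: C_def)
    finally have S: "S \<le> h * (C * real q powr (- \<delta>))" using Z by simp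
    define Y where "Y = (sqrt (real q) / 2) powr (- (1 / 2))"
    have low: "1 / (16 * h\<^sup>2) \<le> S + h * (real q / 4) powr (- (1 / (4 * h))) + 5 * h * Y"
      unfolding S_def h_def Y_def by (rule iq.class_sum_lower_bound[OF T]) (use assms(3) Re_w in simp)
    define l where "l = ln (real q)"
    define L where "L = ln l"
    have l1: "l > exp 1" using qe q16 exp_less_cancel_iff[of "exp 1" l] by (simp add: l_def)
    have l0: "l > 0" using l1 exp_gt_zero[of "1::real"] by linarith
    have L1: "L > 1" using l1 l0 exp_less_cancel_iff[of 1 L] by (simp add: L_def)
    have Lpow: "L powr \<eta> \<ge> 1" using L1 assms(4) by (simp add: ge_one_powr_ge_zero)
    have hl: "h \<le> l / L powr \<eta>" using small unfolding h_eq L_def l_def .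
    \<comment> \<open>The lattice \<open>lat (tau 1 0)\<close> is the ring of integers, whose class
      must have a representative in T.\<close>
    have h0: "h > 0"
    proof (rule ccontr)
      assume "\<not> h > 0"
      then have "card T = 0" by (simp add: h_def)
      then have "T = {}" using iq.transversalD(1)[OF T] by simp
      moreover have "iq.cls (iq.lat (iq.tau 1 0)) \<in> iq.cls ` Collect iq.frac" using iq.frac_lat[of 1 0] by auto
      ultimately show False using iq.transversalD(5)[OF T] by auto
    qed
    have "l / L powr \<eta> \<le> l / 1" using Lpow l0 by (intro divide_left_mono) auto
    then have h_le_l: "h \<le> l" using hl by simp
    \<comment> \<open>The constant 8 is made of the 4 in the exponent 1/(4 h) and the 2 in log(q/4)
      >= l/2; the assumed bound on h supplies the power of L.\<close>
    have X_bound: "(real q / 4) powr (- (1 / (4 * h))) \<le> exp (- (L powr \<eta> / 8))"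
    proof -
      have "ln 16 < l" unfolding l_def using q16 by (subst ln_less_cancel_iff) auto
      moreover have "ln (16::real) = 2 * ln 4" using ln_realpow[of 4 2] by simp
      ultimately have "l / 2 \<le> l - ln 4" by simp
      moreover have "ln (real q / 4) = l - ln 4" unfolding l_def using q16 by (subst ln_div) auto
      ultimately have lq: "l / 2 \<le> ln (real q / 4)" by simp
      have "h * L powr \<eta> \<le> l" using hl Lpow pos_le_divide_eq[of "L powr \<eta>" h l] by linarith
      then have "L powr \<eta> / 8 \<le> (l / 2) / (4 * h)" using h0 by (simp add: field_simps)
      also have "\<dots> \<le> ln (real q / 4) / (4 * h)" using lq h0 by (intro divide_right_mono) auto
      finally have "exp (- (ln (real q / 4) / (4 * h))) \<le> exp (- (L powr \<eta> / 8))" by simp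
      moreover have "(real q / 4) powr (- (1 / (4 * h))) = exp (- (ln (real q / 4) / (4 * h)))"
        using q16 by (simp add: powr_def)
      ultimately show ?thesis by simp
    qed
    define D where "D = C * real q powr (- \<delta>) + exp (- (L powr \<eta> / 8)) + 5 * Y"
    have "1 / (16 * h\<^sup>2) \<le> h * (C * real q powr (- \<delta>)) + h * exp (- (L powr \<eta> / 8)) + 5 * h * Y"
      using low S mult_left_mono[OF X_bound, of h] h0 by linarith
    also have "\<dots> = h * D" by (simp add: D_def algebra_simps)
    finally have "1 \<le> h * D * (16 * h\<^sup>2)" using h0 by (simp add: pos_divide_le_eq)
    then have 1: "1 \<le> 16 * h ^ 3 * D" by (simp add: power2_eq_square power3_eq_cube mult_ac)
    have "16 * h ^ 3 \<ge> 0" using h0 by simp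
    then have "D > 0" using 1 mult_nonneg_nonpos[of "16 * h ^ 3" D] by linarith
    then have "16 * h ^ 3 * D \<le> 16 * l ^ 3 * D" using h_le_l h0 by (intro mult_right_mono mult_left_mono power_mono) auto
    also have "\<dots> = err (real q)" by (simp add: err_def D_def Y_def l_def L_def)
    also have "\<dots> < 1" by (rule N[OF qN])
    finally show False using 1 by simp
  qed
  then show ?thesis by blast
qed

end
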